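(* There exist diagonal holomorphic kernels $k,\ell,\tilde{s}$ (on a common domain containing the origin) such that $\tilde{s}$ is a complete Pick kernel and $\frac{\tilde{s}}{k}$ and $\frac{\ell}{\tilde{s}}$ are positive kernels, but $(k,\ell)$ is not a complete Pick pair.
   Context: A (positive) kernel on a non-empty set $X$ is a function $k:X\times X\to\mathbb{C}$ such that $[k(z_i,z_j)]_{i,j=1}^n$ is positive semi-definite for all finite choices of points; $\mathcal{H}_k$ is the reproducing kernel Hilbert space. $\mathrm{Mult}(\mathcal{H}_k\otimes\mathbb{C}^N,\mathcal{H}_\ell\otimes\mathbb{C}^N)$ is the set of $\Phi:X\to\mathbb{M}_N$ (complex $N\times N$ matrices) with $\Phi f\in\mathcal{H}_\ell\otimes\mathbb{C}^N$ for all $f\in\mathcal{H}_k\otimes\mathbb{C}^N$, normed by the operator norm of $f\mapsto\Phi f$. $(k,\ell)$ is a complete Pick pair on $X$ if for all $n,N\ge1$, all $z_1,\dots,z_n\in X$ and all $W_1,\dots,W_n\in\mathbb{M}_N$ with $[\ell(z_i,z_j)I_{N\times N}-k(z_i,z_j)W_iW_j^*]_{i,j=1}^n$ positive semi-definite, there is $\Phi\in\mathrm{Mult}(\mathcal{H}_k\otimes\mathbb{C}^N,\mathcal{H}_\ell\otimes\mathbb{C}^N)$ of norm at most one with $\Phi(z_i)=W_i$ for all $i$. A kernel $s$ is a complete Pick kernel if $(s,s)$ is a complete Pick pair. A domain is open, connected and non-empty. A diagonal holomorphic kernel on a domain $\Omega\subseteq\mathbb{C}^d$, $\mathbf{0}\in\Omega$,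 is a kernel $f$ on $\Omega$, holomorphic in $z$ and conjugate holomorphic in $w$, whose power series at $\mathbf{0}$ has the form $f(z,w)=\sum_{a\in\mathbb{N}^d}f_az^a\overline{w}^a$ with all $f_a>0$ ($\mathbb{N}$ includes $0$). *)

theory Defs
  imports
    "HOL-Analysis.Analysis"
    "Jordan_Normal_Form.Schur_Decomposition"
begin

hide_const (open) Finite_Cartesian_Product.vec Finite_Cartesian_Product.mat
unbundle no vec_syntax

section \<open>Kernels\<close>

text \<open>Over the complex numbers \<open>0 \<le> \<langle>A v, v\<rangle>\<close> for all \<open>v\<close> (in the order where \<open>0 \<le> c\<close> means
  that \<open>c\<close> is real and non-negative) forces \<open>A\<close> to be Hermitian.\<close>

definition psd :: "complex mat \<Rightarrow> bool" where
  "psd A \<longleftrightarrow> A \<in> carrier_mat (dim_row A) (dim_row A) \<and>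
     (\<forall>v \<in> carrier_vec (dim_row A). 0 \<le> (A *\<^sub>v v) \<bullet>c v)"

definition is_kernel :: "'x set \<Rightarrow> ('x \<Rightarrow> 'x \<Rightarrow> complex) \<Rightarrow> bool" where
  "is_kernel X k \<longleftrightarrow> X \<noteq> {} \<and>
     (\<forall>(n::nat) z. (\<forall>i<n. z i \<in> X) \<longrightarrow> psd (mat n n (\<lambda>(i, j). k (z i) (z j))))"


section \<open>Reproducing kernel Hilbert spaces\<close>

text \<open>A space of functions on \<open>X\<close> is a set \<open>H\<close> of functions on the ambient type that vanish
  outside \<open>X\<close>. Its inner product \<open>ip\<close> matters on \<open>H\<close> only and is linear in the first
  argument.\<close>

definition hnorm :: "(('x \<Rightarrow> complex) \<Rightarrow> ('x \<Rightarrow> complex) \<Rightarrow> complex) \<Rightarrow> ('x \<Rightarrow> complex) \<Rightarrow> real" where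
  "hnorm ip f = sqrt (Re (ip f f))"

definition hilbert_function_space ::
  "'x set \<Rightarrow> ('x \<Rightarrow> complex) set \<Rightarrow> (('x \<Rightarrow> complex) \<Rightarrow> ('x \<Rightarrow> complex) \<Rightarrow> complex) \<Rightarrow> bool" where
  "hilbert_function_space X H ip \<longleftrightarrow>
     (\<forall>f\<in>H. \<forall>x. x \<notin> X \<longrightarrow> f x = 0) \<and>
     (\<lambda>x. 0) \<in> H \<and>
     (\<forall>f\<in>H. \<forall>g\<in>H. (\<lambda>x. f x + g x) \<in> H) \<and>
     (\<forall>c. \<forall>f\<in>H. (\<lambda>x. c * f x) \<in> H) \<and>
     (\<forall>f\<in>H. \<forall>g\<in>H. \<forall>h\<in>H. ip (\<lambda>x. f x + g x) h = ip f h + ip g h) \<and>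
     (\<forall>c. \<forall>f\<in>H. \<forall>h\<in>H. ip (\<lambda>x. c * f x) h = c * ip f h) \<and>
     (\<forall>f\<in>H. \<forall>g\<in>H. ip g f = cnj (ip f g)) \<and>
     (\<forall>f\<in>H. 0 \<le> ip f f) \<and>
     (\<forall>f\<in>H. ip f f = 0 \<longrightarrow> f = (\<lambda>x. 0)) \<and>
     (\<forall>F :: nat \<Rightarrow> 'x \<Rightarrow> complex.
        (\<forall>n. F n \<in> H) \<and>
        (\<forall>e>0. \<exists>M. \<forall>m\<ge>M. \<forall>n\<ge>M. hnorm ip (\<lambda>x. F m x - F n x) < e) \<longrightarrow>
        (\<exists>f\<in>H. (\<lambda>n. hnorm ip (\<lambda>x. F n x - f x)) \<longlonglongrightarrow> 0))"

definition is_rkhs ::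
  "'x set \<Rightarrow> ('x \<Rightarrow> 'x \<Rightarrow> complex) \<Rightarrow>
   ('x \<Rightarrow> complex) set \<Rightarrow> (('x \<Rightarrow> complex) \<Rightarrow> ('x \<Rightarrow> complex) \<Rightarrow> complex) \<Rightarrow> bool" where
  "is_rkhs X k H ip \<longleftrightarrow> hilbert_function_space X H ip \<and>
     (\<forall>w\<in>X. (\<lambda>z. if z \<in> X then k z w else 0) \<in> H \<and>
            (\<forall>f\<in>H. ip f (\<lambda>z. if z \<in> X then k z w else 0) = f w))"

text \<open>\<open>H \<otimes> \<complex>\<^sup>N\<close> is identified with the functions \<open>X \<rightarrow> \<complex>\<^sup>N\<close> all of whose components
  lie in \<open>H\<close>.\<close>

definition tensor_space :: "nat \<Rightarrow> ('x \<Rightarrow> complex) set \<Rightarrow> ('x \<Rightarrow> complex vec) set" where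
  "tensor_space N H =
     {f. (\<forall>x. f x \<in> carrier_vec N) \<and> (\<forall>i<N. (\<lambda>x. f x $ i) \<in> H)}"

definition tensor_norm ::
  "nat \<Rightarrow> (('x \<Rightarrow> complex) \<Rightarrow> ('x \<Rightarrow> complex) \<Rightarrow> complex) \<Rightarrow> ('x \<Rightarrow> complex vec) \<Rightarrow> real" where
  "tensor_norm N ip f = sqrt (\<Sum>i<N. (hnorm ip (\<lambda>x. f x $ i))\<^sup>2)"


section \<open>Multipliers and complete Pick pairs\<close>

definition mult_op ::
  "nat \<Rightarrow> 'x set \<Rightarrow> ('x \<Rightarrow> complex mat) \<Rightarrow> ('x \<Rightarrow> complex vec) \<Rightarrow> 'x \<Rightarrow> complex vec" where
  "mult_op N X \<Phi> f = (\<lambda>x. if x \<in> X then \<Phi> x *\<^sub>v f x else 0\<^sub>v N)"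

definition Mult ::
  "nat \<Rightarrow> 'x set \<Rightarrow> ('x \<Rightarrow> complex) set \<Rightarrow> ('x \<Rightarrow> complex) set \<Rightarrow> ('x \<Rightarrow> complex mat) set" where
  "Mult N X H G =
     {\<Phi>. (\<forall>x\<in>X. \<Phi> x \<in> carrier_mat N N) \<and>
         (\<forall>f \<in> tensor_space N H. mult_op N X \<Phi> f \<in> tensor_space N G)}"

text \<open>The operator norm of \<open>f \<mapsto> \<Phi> f\<close>; extended reals avoid having to know beforehand that
  the operator is bounded.\<close>

definition mult_norm ::
  "nat \<Rightarrow> 'x set \<Rightarrow>
   ('x \<Rightarrow> complex) set \<Rightarrow> (('x \<Rightarrow> complex) \<Rightarrow> ('x \<Rightarrow> complex) \<Rightarrow> complex) \<Rightarrow>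
   (('x \<Rightarrow> complex) \<Rightarrow> ('x \<Rightarrow> complex) \<Rightarrow> complex) \<Rightarrow> ('x \<Rightarrow> complex mat) \<Rightarrow> ereal" where
  "mult_norm N X H ipH ipG \<Phi> =
     (SUP f \<in> {f \<in> tensor_space N H. tensor_norm N ipH f \<le> 1}.
        ereal (tensor_norm N ipG (mult_op N X \<Phi> f)))"

definition block_mat :: "nat \<Rightarrow> nat \<Rightarrow> (nat \<Rightarrow> nat \<Rightarrow> complex mat) \<Rightarrow> complex mat" where
  "block_mat n N B =
     mat (n * N) (n * N) (\<lambda>(p, q). B (p div N) (q div N) $$ (p mod N, q mod N))"

definition pick_matrix ::
  "('x \<Rightarrow> 'x \<Rightarrow> complex) \<Rightarrow> ('x \<Rightarrow> 'x \<Rightarrow> complex) \<Rightarrow> nat \<Rightarrow> nat \<Rightarrow>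
   (nat \<Rightarrow> 'x) \<Rightarrow> (nat \<Rightarrow> complex mat) \<Rightarrow> complex mat" where
  "pick_matrix k l n N z W =
     block_mat n N (\<lambda>i j. l (z i) (z j) \<cdot>\<^sub>m 1\<^sub>m N - k (z i) (z j) \<cdot>\<^sub>m (W i * mat_adjoint (W j)))"

text \<open>By the Moore--Aronszajn theorem a kernel has exactly one reproducing kernel Hilbert space, so
  quantifying over \<open>(H, ipH)\<close> and \<open>(G, ipG)\<close> only names the spaces of \<open>k\<close> and \<open>l\<close>.\<close>

definition complete_pick_pair ::
  "'x set \<Rightarrow> ('x \<Rightarrow> 'x \<Rightarrow> complex) \<Rightarrow> ('x \<Rightarrow> 'x \<Rightarrow> complex) \<Rightarrow> bool" where
  "complete_pick_pair X k l \<longleftrightarrow>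
     (\<forall>H ipH G ipG. is_rkhs X k H ipH \<longrightarrow> is_rkhs X l G ipG \<longrightarrow>
       (\<forall>n\<ge>1. \<forall>N\<ge>1. \<forall>z W.
          (\<forall>i<n. z i \<in> X) \<longrightarrow> (\<forall>i<n. W i \<in> carrier_mat N N) \<longrightarrow>
          psd (pick_matrix k l n N z W) \<longrightarrow>
          (\<exists>\<Phi> \<in> Mult N X H G. mult_norm N X H ipH ipG \<Phi> \<le> 1 \<and> (\<forall>i<n. \<Phi> (z i) = W i))))"

definition complete_pick_kernel :: "'x set \<Rightarrow> ('x \<Rightarrow> 'x \<Rightarrow> complex) \<Rightarrow> bool" where
  "complete_pick_kernel X s \<longleftrightarrow> is_kernel X s \<and> complete_pick_pair X s s"


section \<open>Diagonal holomorphic kernels\<close>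

text \<open>Since the dimension \<open>d\<close> is existentially quantified, \<open>\<complex>\<^sup>d\<close> is realised inside
  \<open>nat \<Rightarrow> complex\<close> (product topology, which restricts to the Euclidean topology) as the functions
  supported on \<open>{..<d}\<close>; multi-indices are treated in the same way.\<close>

definition Cspace :: "nat \<Rightarrow> (nat \<Rightarrow> complex) set" where
  "Cspace d = {z. \<forall>i\<ge>d. z i = 0}"

definition multi_indices :: "nat \<Rightarrow> (nat \<Rightarrow> nat) set" where
  "multi_indices d = {a. \<forall>i\<ge>d. a i = 0}"

definition monomial :: "nat \<Rightarrow> (nat \<Rightarrow> nat) \<Rightarrow> (nat \<Rightarrow> complex) \<Rightarrow> complex" where
  "monomial d a z = (\<Prod>i<d. z i ^ a i)"

definition polydisc :: "nat \<Rightarrow> real \<Rightarrow> (nat \<Rightarrow> complex) set" where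
  "polydisc d r = {z \<in> Cspace d. \<forall>i<d. cmod (z i) < r}"

definition domain_in :: "nat \<Rightarrow> (nat \<Rightarrow> complex) set \<Rightarrow> bool" where
  "domain_in d \<Omega> \<longleftrightarrow> openin (top_of_set (Cspace d)) \<Omega> \<and> connected \<Omega> \<and> \<Omega> \<noteq> {}"

text \<open>Holomorphy in several variables: continuous, and holomorphic in each variable separately.\<close>

definition holomorphic_several ::
  "nat \<Rightarrow> ((nat \<Rightarrow> complex) \<Rightarrow> complex) \<Rightarrow> (nat \<Rightarrow> complex) set \<Rightarrow> bool" where
  "holomorphic_several d g \<Omega> \<longleftrightarrow> continuous_on \<Omega> g \<and>
     (\<forall>z\<in>\<Omega>. \<forall>i<d. (\<lambda>t. g (z(i := t))) holomorphic_on {t. z(i := t) \<in> \<Omega>})"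

definition diagonal_holomorphic_kernel ::
  "nat \<Rightarrow> (nat \<Rightarrow> complex) set \<Rightarrow> ((nat \<Rightarrow> complex) \<Rightarrow> (nat \<Rightarrow> complex) \<Rightarrow> complex) \<Rightarrow> bool" where
  "diagonal_holomorphic_kernel d \<Omega> f \<longleftrightarrow>
     domain_in d \<Omega> \<and> (\<lambda>i. 0) \<in> \<Omega> \<and> is_kernel \<Omega> f \<and>
     (\<forall>w\<in>\<Omega>. holomorphic_several d (\<lambda>z. f z w) \<Omega>) \<and>
     (\<forall>z\<in>\<Omega>. holomorphic_several d (\<lambda>w. cnj (f z w)) \<Omega>) \<and>
     (\<exists>c :: (nat \<Rightarrow> nat) \<Rightarrow> real. (\<forall>a \<in> multi_indices d. 0 < c a) \<and>
       (\<exists>r>0. polydisc d r \<subseteq> \<Omega> \<and>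
         (\<forall>z \<in> polydisc d r. \<forall>w \<in> polydisc d r.
            ((\<lambda>a. of_real (c a) * monomial d a z * cnj (monomial d a w)) has_sum f z w)
              (multi_indices d))))"

text \<open>That \<open>f / g\<close> is a kernel on \<open>X\<close> includes that it is defined on all of \<open>X \<times> X\<close>, which the
  convention \<open>x / 0 = 0\<close> would hide.\<close>

definition is_quotient_kernel ::
  "'x set \<Rightarrow> ('x \<Rightarrow> 'x \<Rightarrow> complex) \<Rightarrow> ('x \<Rightarrow> 'x \<Rightarrow> complex) \<Rightarrow> bool" where
  "is_quotient_kernel X f g \<longleftrightarrow>
     (\<forall>z\<in>X. \<forall>w\<in>X. g z w \<noteq> 0) \<and> is_kernel X (\<lambda>z w. f z w / g z w)"

end

theory Submission
  imports Defs
begin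

text \<open>
  The example lives on the unit disc, and all kernels are functions of \<open>x = z \<sqdot> cnj w\<close>. The complete
  Pick kernel is the Szego kernel \<open>s = 1 / (1 - x)\<close>, and \<open>l = s\<close>. The first kernel is \<open>k = s / h\<close>
  with \<open>h = 1 / (1 - x\<^sup>2 / 4)\<^sup>2\<close>. The function \<open>h\<close> has non-negative Taylor coefficients, so \<open>s / k = h\<close>
  is a positive kernel; but \<open>h\<close> is not a complete Pick kernel, because \<open>1 - 1 / h\<close> has a negative
  coefficient at \<open>x\<^sup>4\<close>. This shows in the coefficients \<open>1, 1, 1/2, 1/2, 9/16, 9/16, ...\<close> of \<open>k\<close>,
  which drop from the second to the third one and rise again from the fourth to the fifth.

  The failing Pick problem is scalar and has three nodes \<open>z\<^sub>i\<close>, the cube roots of unity scaled to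
  modulus \<open>1/2\<close>, with targets \<open>w\<^sub>i = 256/255 \<sqdot> z\<^sub>i\<^sup>2\<close>. Between nodes \<open>x\<^sup>3 = 1/64\<close>, so every kernel becomes
  a quadratic polynomial in \<open>x\<close>, and \<open>l - k w\<^sub>i cnj w\<^sub>j\<close> becomes \<open>\<alpha> + \<beta> x\<close> with positive \<open>\<alpha>\<close> and \<open>\<beta>\<close>:
  the Pick matrix is positive semi-definite. A solution \<open>\<Phi>\<close> would make \<open>l - k \<Phi>(z) cnj \<Phi>(w)\<close> a
  positive kernel on the nodes and the origin. Testing it with the vector \<open>(1/3, 1/3, 1/3, -1)\<close>
  removes the terms \<open>\<beta> x\<close> and the mixed terms, since \<open>z\<^sub>i\<close> and \<open>z\<^sub>i\<^sup>2\<close> have mean zero, and leaves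
  \<open>\<alpha> - 1 - |\<Phi>(0)|\<^sup>2\<close>. But \<open>\<alpha> = 65024/65025\<close> is less than one, whatever the value of \<open>\<Phi>(0)\<close>; this
  contradiction is \<open>not_pick_pair\<close>.

  Three pieces of theory carry this. A matrix function is a multiplier of norm at most one as soon
  as \<open>l - k \<Phi>(z) \<Phi>(w)\<^sup>*\<close> is positive (\<open>contractive_multiplierI\<close>, through the Riesz representation
  \<open>riesz_pairs\<close>), and conversely in the scalar case (\<open>scalar_multiplier_kernel\<close>). The Szego kernel is
  a complete Pick kernel (\<open>szego_complete_pick\<close>) by the lurking isometry argument: the Pick
  condition says that two finite families of vectors have the same Gram matrix, hence a partial
  isometry relates them, and that isometry is the colligation of a transfer function which
  interpolates (\<open>realization\<close>). Finally the Hilbert spaces of \<open>k\<close> and \<open>l\<close> exist as images of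
  square-summable sequences (\<open>rkhs_of_feature_map\<close>); without them the Pick property of \<open>(k, l)\<close> would
  hold vacuously.
\<close>

lemma cnj_mult_self: "c * cnj c = of_real ((cmod c)\<^sup>2)"
  by (metis complex_norm_square)

lemma nonneg_complex_iff: "0 \<le> (c::complex) \<longleftrightarrow> 0 \<le> Re c \<and> Im c = 0"
  by (auto simp: less_eq_complex_def)

section \<open>Spaces of functions with a semi-inner product\<close>

text \<open>The form may be degenerate and the space incomplete: the same lemmas serve Hilbert spaces, the
  standard form on \<open>\<complex>\<^sup>n\<close> and the possibly degenerate forms given by Pick matrices.\<close>
locale semi_inner =
  fixes H :: "('x \<Rightarrow> complex) set" and ip :: "('x \<Rightarrow> complex) \<Rightarrow> ('x \<Rightarrow> complex) \<Rightarrow> complex"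
  assumes zero_mem: "(\<lambda>x. 0) \<in> H"
    and add_mem: "f \<in> H \<Longrightarrow> g \<in> H \<Longrightarrow> (\<lambda>x. f x + g x) \<in> H"
    and scale_mem: "f \<in> H \<Longrightarrow> (\<lambda>x. c * f x) \<in> H"
    and ip_add: "f \<in> H \<Longrightarrow> g \<in> H \<Longrightarrow> h \<in> H \<Longrightarrow> ip (\<lambda>x. f x + g x) h = ip f h + ip g h"
    and ip_scale: "f \<in> H \<Longrightarrow> h \<in> H \<Longrightarrow> ip (\<lambda>x. c * f x) h = c * ip f h"
    and ip_cnj: "f \<in> H \<Longrightarrow> g \<in> H \<Longrightarrow> ip g f = cnj (ip f g)"
    and ip_nonneg: "f \<in> H \<Longrightarrow> 0 \<le> ip f f"
begin

lemma diff_mem: "f \<in> H \<Longrightarrow> g \<in> H \<Longrightarrow> (\<lambda>x. f x - g x) \<in> H"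
  using add_mem[of f "\<lambda>x. (-1) * g x"] scale_mem[of g "-1"] by simp

lemma sum_mem: "(\<And>i. i \<in> I \<Longrightarrow> f i \<in> H) \<Longrightarrow> (\<lambda>x. \<Sum>i\<in>I. c i * f i x) \<in> H"
proof (induction I rule: infinite_finite_induct)
  case (insert i I)
  have "(\<lambda>x. c i * f i x + (\<Sum>i\<in>I. c i * f i x)) \<in> H"
    using insert by (intro add_mem scale_mem) auto
  then show ?case using insert by simp
qed (auto simp: zero_mem)

lemma ip_zero: "h \<in> H \<Longrightarrow> ip (\<lambda>x. 0) h = 0"
  using ip_scale[of "\<lambda>x. 0" h 0] zero_mem by simp

lemma ip_diff: "f \<in> H \<Longrightarrow> g \<in> H \<Longrightarrow> h \<in> H \<Longrightarrow> ip (\<lambda>x. f x - g x) h = ip f h - ip g h"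
  using ip_add[of f "\<lambda>x. (-1) * g x" h] ip_scale[of g h "-1"] scale_mem[of g "-1"] by simp

lemma ip_sum: "(\<And>i. i \<in> I \<Longrightarrow> f i \<in> H) \<Longrightarrow> h \<in> H \<Longrightarrow>
  ip (\<lambda>x. \<Sum>i\<in>I. c i * f i x) h = (\<Sum>i\<in>I. c i * ip (f i) h)"
proof (induction I rule: infinite_finite_induct)
  case (insert i I)
  have "ip (\<lambda>x. c i * f i x + (\<Sum>i\<in>I. c i * f i x)) h
      = c i * ip (f i) h + ip (\<lambda>x. (\<Sum>i\<in>I. c i * f i x)) h"
    using insert by (subst ip_add) (auto intro!: scale_mem sum_mem simp: ip_scale)
  then show ?case using insert by simp
qed (auto simp: ip_zero)

lemma ip_add_right: "f \<in> H \<Longrightarrow> g \<in> H \<Longrightarrow> h \<in> H \<Longrightarrow> ip h (\<lambda>x. f x + g x) = ip h f + ip h g"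
  using ip_add[of f g h] ip_cnj[of "\<lambda>x. f x + g x" h] ip_cnj[of f h] ip_cnj[of g h] add_mem by simp

lemma ip_diff_right: "f \<in> H \<Longrightarrow> g \<in> H \<Longrightarrow> h \<in> H \<Longrightarrow> ip h (\<lambda>x. f x - g x) = ip h f - ip h g"
  using ip_diff[of f g h] ip_cnj[of "\<lambda>x. f x - g x" h] ip_cnj[of f h] ip_cnj[of g h] diff_mem by simp

lemma ip_scale_right: "f \<in> H \<Longrightarrow> h \<in> H \<Longrightarrow> ip h (\<lambda>x. c * f x) = cnj c * ip h f"
  using ip_scale[of f h c] ip_cnj[of "\<lambda>x. c * f x" h] ip_cnj[of f h] scale_mem by simp

lemma ip_sum_right: "(\<And>i. i \<in> I \<Longrightarrow> f i \<in> H) \<Longrightarrow> h \<in> H \<Longrightarrow>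
  ip h (\<lambda>x. \<Sum>i\<in>I. c i * f i x) = (\<Sum>i\<in>I. cnj (c i) * ip h (f i))"
  using ip_sum[of I f h c] ip_cnj[of "\<lambda>x. \<Sum>i\<in>I. c i * f i x" h] sum_mem[of I f c] ip_cnj[of _ h]
  by (simp cong: sum.cong)

lemma ip_self: "f \<in> H \<Longrightarrow> ip f f = of_real ((hnorm ip f)\<^sup>2)"
  using ip_nonneg[of f] by (simp add: hnorm_def nonneg_complex_iff complex_eq_iff)

lemma hnorm_nonneg: "f \<in> H \<Longrightarrow> 0 \<le> hnorm ip f"
  using ip_nonneg[of f] by (simp add: hnorm_def nonneg_complex_iff)

lemma hnorm_sq: "f \<in> H \<Longrightarrow> (hnorm ip f)\<^sup>2 = Re (ip f f)"
  by (simp add: ip_self)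

lemma hnorm_scale: "f \<in> H \<Longrightarrow> hnorm ip (\<lambda>x. c * f x) = cmod c * hnorm ip f"
proof -
  assume f: "f \<in> H"
  have "ip (\<lambda>x. c * f x) (\<lambda>x. c * f x) = (c * cnj c) * ip f f"
    using f by (simp add: ip_scale ip_scale_right scale_mem)
  then have "ip (\<lambda>x. c * f x) (\<lambda>x. c * f x) = of_real ((cmod c * hnorm ip f)\<^sup>2)"
    unfolding cnj_mult_self ip_self[OF f] by (simp add: power_mult_distrib)
  then have "(hnorm ip (\<lambda>x. c * f x))\<^sup>2 = (cmod c * hnorm ip f)\<^sup>2"
    using hnorm_sq[OF scale_mem[OF f]] by simp
  then show ?thesis
    using hnorm_nonneg[OF scale_mem[OF f]] hnorm_nonneg[OF f] by (simp add: power2_eq_iff_nonneg)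
qed

lemma hnorm_sq_add: "f \<in> H \<Longrightarrow> g \<in> H \<Longrightarrow>
  (hnorm ip (\<lambda>x. f x + g x))\<^sup>2 = (hnorm ip f)\<^sup>2 + 2 * Re (ip f g) + (hnorm ip g)\<^sup>2"
  using ip_cnj[of f g]
  by (simp add: hnorm_sq add_mem ip_add ip_add_right)

lemma hnorm_sq_diff: "f \<in> H \<Longrightarrow> g \<in> H \<Longrightarrow>
  (hnorm ip (\<lambda>x. f x - g x))\<^sup>2 = (hnorm ip f)\<^sup>2 - 2 * Re (ip f g) + (hnorm ip g)\<^sup>2"
  using ip_cnj[of f g]
  by (simp add: hnorm_sq diff_mem ip_diff ip_diff_right)

lemma cauchy_schwarz:
  assumes f: "f \<in> H" and g: "g \<in> H"
  shows "cmod (ip f g) \<le> hnorm ip f * hnorm ip g"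
proof -
  define a b c where "a = (hnorm ip f)\<^sup>2" and "b = (hnorm ip g)\<^sup>2" and "c = ip f g"
  \<comment> \<open>The square of the norm of \<open>f - t c g\<close>; the case \<open>b = 0\<close> below needs all real \<open>t\<close>.\<close>
  have key: "0 \<le> a - 2 * t * (cmod c)\<^sup>2 + t\<^sup>2 * (cmod c)\<^sup>2 * b" for t :: real
  proof -
    let ?k = "of_real t * c"
    have "0 \<le> (hnorm ip (\<lambda>x. f x - ?k * g x))\<^sup>2" by simp
    also have "\<dots> = a - 2 * Re (cnj ?k * c) + (cmod ?k)\<^sup>2 * b"
      using f g by (subst hnorm_sq_diff)
        (auto simp: scale_mem ip_scale_right hnorm_scale a_def b_def c_def power_mult_distrib)
    also have "Re (cnj ?k * c) = t * (cmod c)\<^sup>2"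
      unfolding cmod_power2 by (simp add: power2_eq_square algebra_simps)
    finally show ?thesis by (simp add: norm_mult power_mult_distrib mult.assoc)
  qed
  have "(cmod c)\<^sup>2 \<le> a * b"
  proof (cases "b = 0")
    case False
    then have "b > 0" by (simp add: b_def)
    have "0 \<le> a - 2 * (1/b) * (cmod c)\<^sup>2 + (1/b)\<^sup>2 * (cmod c)\<^sup>2 * b" by (rule key)
    also have "\<dots> = a - (cmod c)\<^sup>2 / b"
      using \<open>b > 0\<close> by (simp add: field_simps power2_eq_square)
    finally show ?thesis using \<open>b > 0\<close> by (simp add: field_simps)
  next
    case True
    have "(cmod c)\<^sup>2 = 0"
    proof (rule ccontr)
      assume n: "(cmod c)\<^sup>2 \<noteq> 0"
      have "0 \<le> a - 2 * ((a + 1) / (cmod c)\<^sup>2) * (cmod c)\<^sup>2" using key[of "(a + 1) / (cmod c)\<^sup>2"] True by simp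
      then have "0 \<le> a - 2 * (a + 1)" using n by simp
      moreover have "0 \<le> a" by (simp add: a_def)
      ultimately show False by (simp add: algebra_simps)
    qed
    then show ?thesis using True by simp
  qed
  then have "(cmod c)\<^sup>2 \<le> (hnorm ip f * hnorm ip g)\<^sup>2" by (simp add: a_def b_def power_mult_distrib)
  then show ?thesis
    unfolding c_def using hnorm_nonneg[OF f] hnorm_nonneg[OF g] by (meson mult_nonneg_nonneg power2_le_imp_le)
qed

lemma hnorm_triangle: 
  assumes f: "f \<in> H" and g: "g \<in> H" 
  shows "hnorm ip (\<lambda>x. f x + g x) \<le> hnorm ip f + hnorm ip g"
proof (rule power2_le_imp_le)
  have "Re (ip f g) \<le> hnorm ip f * hnorm ip g"
    using cauchy_schwarz[OF f g] complex_Re_le_cmod order_trans by blast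
  then show "(hnorm ip (\<lambda>x. f x + g x))\<^sup>2 \<le> (hnorm ip f + hnorm ip g)\<^sup>2"
    by (simp add: hnorm_sq_add[OF f g] power2_sum)
qed (use hnorm_nonneg[OF f] hnorm_nonneg[OF g] in simp)

lemma hnorm_sq_sum:
  assumes "\<And>y. y \<in> S \<Longrightarrow> U y \<in> H"
  shows "(hnorm ip (\<lambda>x. \<Sum>y\<in>S. c y * U y x))\<^sup>2 = Re (\<Sum>p\<in>S. \<Sum>q\<in>S. ip (U q) (U p) * c q * cnj (c p))"
proof -
  have "ip (\<lambda>x. \<Sum>y\<in>S. c y * U y x) (\<lambda>x. \<Sum>y\<in>S. c y * U y x)
      = (\<Sum>q\<in>S. c q * ip (U q) (\<lambda>x. \<Sum>y\<in>S. c y * U y x))"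
    by (rule ip_sum[OF assms sum_mem[OF assms]])
  also have "\<dots> = (\<Sum>q\<in>S. c q * (\<Sum>p\<in>S. cnj (c p) * ip (U q) (U p)))"
    by (intro sum.cong refl arg_cong2[where f = "(*)"] ip_sum_right assms)
  also have "\<dots> = (\<Sum>q\<in>S. \<Sum>p\<in>S. ip (U q) (U p) * c q * cnj (c p))"
    by (simp add: sum_distrib_left mult_ac)
  also have "\<dots> = (\<Sum>p\<in>S. \<Sum>q\<in>S. ip (U q) (U p) * c q * cnj (c p))"
    by (rule sum.swap)
  finally show ?thesis by (simp add: hnorm_sq[OF sum_mem[OF assms]])
qed

text \<open>Gram--Schmidt for a form that may be degenerate: a residual of norm zero is dropped instead of
  being normalised, so in the end each \<open>v i\<close> is expanded only up to a vector of norm zero.\<close>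
lemma gram_schmidt:
  fixes R :: nat
  assumes "\<And>i. i < R \<Longrightarrow> v i \<in> H"
  shows "\<exists>(r::nat) e. (\<forall>m<r. e m \<in> H) \<and> (\<forall>m<r. \<forall>m'<r. ip (e m) (e m') = (if m = m' then 1 else 0)) \<and>
    (\<forall>i<R. hnorm ip (\<lambda>x. v i x - (\<Sum>m<r. ip (v i) (e m) * e m x)) = 0)"
  using assms
proof (induction R)
  case 0
  then show ?case by (intro exI[of _ 0]) auto
next
  case (Suc R)
  have vH: "\<And>i. i < R \<Longrightarrow> v i \<in> H" using Suc.prems by simp
  from Suc.IH[OF vH, simplified] obtain r :: nat and e where
    "(\<forall>m<r. e m \<in> H) \<and> (\<forall>m<r. \<forall>m'<r. ip (e m) (e m') = (if m = m' then 1 else 0)) \<and>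
      (\<forall>i<R. hnorm ip (\<lambda>x. v i x - (\<Sum>m<r. ip (v i) (e m) * e m x)) = 0)"
    by (elim exE)
  then have e: "\<And>m. m < r \<Longrightarrow> e m \<in> H"
    and on: "\<And>m m'. m < r \<Longrightarrow> m' < r \<Longrightarrow> ip (e m) (e m') = (if m = m' then 1 else 0)"
    and res: "\<And>i. i < R \<Longrightarrow> hnorm ip (\<lambda>x. v i x - (\<Sum>m<r. ip (v i) (e m) * e m x)) = 0"
    by auto
  have vR: "v R \<in> H" using Suc.prems by simp
  define d where "d = (\<lambda>x. v R x - (\<Sum>m<r. ip (v R) (e m) * e m x))"
  have sumH: "(\<lambda>x. \<Sum>m<r. c m * e m x) \<in> H" for c by (rule sum_mem) (use e in auto)
  have d: "d \<in> H" unfolding d_def by (intro diff_mem vR sumH)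
  have ipS: "ip (\<lambda>x. \<Sum>m<r. c m * e m x) h = (\<Sum>m<r. c m * ip (e m) h)" if "h \<in> H" for c h
    by (rule ip_sum) (use e that in auto)
  have dm: "ip d (e m) = 0" if "m < r" for m
  proof -
    have "ip d (e m) = ip (v R) (e m) - (\<Sum>j<r. ip (v R) (e j) * ip (e j) (e m))"
      unfolding d_def using that e by (subst ip_diff) (auto simp: vR sumH ipS)
    also have "(\<Sum>j<r. ip (v R) (e j) * ip (e j) (e m)) = (\<Sum>j<r. if j = m then ip (v R) (e j) else 0)"
      using that by (intro sum.cong) (auto simp: on)
    finally show ?thesis using that by simp
  qed
  show ?case
  proof (cases "hnorm ip d = 0")
    case True
    then show ?thesis using e on res unfolding d_def
      by (intro exI[of _ r] exI[of _ e]) (auto simp: less_Suc_eq)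
  next
    case False
    define n where "n = hnorm ip d"
    have n: "n > 0" using False hnorm_nonneg[OF d] by (simp add: n_def)
    \<comment> \<open>The normalised residual extends the orthonormal family, and it is the only new direction.\<close>
    define \<nu> :: complex where "\<nu> = of_real (1/n)"
    have \<nu>: "\<nu> * (cnj \<nu> * (of_real n)\<^sup>2) = 1"
      using n by (simp add: \<nu>_def power2_eq_square)
    have \<nu>': "cnj \<nu> * \<nu> = 1 / (of_real n)\<^sup>2"
      using n by (simp add: \<nu>_def power2_eq_square)
    define e' where "e' = (\<lambda>m. if m = r then (\<lambda>x. \<nu> * d x) else e m)"
    have er: "e' r = (\<lambda>x. \<nu> * d x)" by (simp add: e'_def)
    have em: "e' m = e m" if "m < r" for m using that by (simp add: e'_def)
    have e'H: "e' m \<in> H" if "m < Suc r" for m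
      using that e d by (auto simp: e'_def less_Suc_eq scale_mem)
    have dd: "ip d d = of_real (n\<^sup>2)" by (simp add: ip_self[OF d] n_def)
    have rr: "ip (e' r) (e' r) = 1"
      unfolding er using d dd \<nu> by (simp add: scale_mem ip_scale ip_scale_right)
    have rm: "ip (e' r) (e' m) = 0" "ip (e' m) (e' r) = 0" if "m < r" for m
      using that dm[OF that] d e ip_cnj[of d "e m"]
      by (auto simp: er em ip_scale ip_scale_right)
    have on': "ip (e' m) (e' m') = (if m = m' then 1 else 0)" if "m < Suc r" "m' < Suc r" for m m'
      using that rr rm on em by (auto simp: less_Suc_eq)
    have exp: "(\<lambda>x. v i x - (\<Sum>m<Suc r. ip (v i) (e' m) * e' m x)) =
       (\<lambda>x. (v i x - (\<Sum>m<r. ip (v i) (e m) * e m x)) - (ip (v i) d / of_real (n\<^sup>2)) * d x)"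
      if "i < Suc R" for i
    proof -
      have "(\<Sum>m<r. ip (v i) (e' m) * e' m x) = (\<Sum>m<r. ip (v i) (e m) * e m x)" for x
        by (intro sum.cong) (auto simp: em)
      moreover have "ip (v i) (e' r) * e' r x = (ip (v i) d / of_real (n\<^sup>2)) * d x" for x
      proof -
        have "ip (v i) (e' r) * e' r x = (cnj \<nu> * \<nu>) * (ip (v i) d * d x)"
          unfolding er using Suc.prems[OF that] d by (simp add: ip_scale_right)
        then show ?thesis unfolding \<nu>' by simp
      qed
      ultimately show ?thesis by (simp add: algebra_simps)
    qed
    have res': "hnorm ip (\<lambda>x. v i x - (\<Sum>m<Suc r. ip (v i) (e' m) * e' m x)) = 0" if i: "i < Suc R" for i
    proof (cases "i < R")
      case True
      let ?u = "\<lambda>x. v i x - (\<Sum>m<r. ip (v i) (e m) * e m x)"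
      have vi: "v i \<in> H" using Suc.prems i by simp
      have u: "?u \<in> H" by (intro diff_mem vi sumH)
      have "ip ?u d = 0" using cauchy_schwarz[OF u d] res[OF True] by simp
      moreover have "ip (\<lambda>x. \<Sum>m<r. ip (v i) (e m) * e m x) d = 0"
        using dm e d ip_cnj[OF d] by (subst ipS) auto
      ultimately have "ip (v i) d = 0" using vi sumH d by (simp add: ip_diff)
      then show ?thesis unfolding exp[OF i] using res[OF True] by simp
    next
      case False
      then have iR: "i = R" using i by simp
      have "ip (\<lambda>x. \<Sum>m<r. ip (v R) (e m) * e m x) d = 0"
        using dm e d ip_cnj[OF d] by (subst ipS) auto
      then have "ip d d = ip (v R) d"
        using ip_diff[OF vR sumH d, of "\<lambda>m. ip (v R) (e m)", folded d_def] by simp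
      have dx: "d x = v R x - (\<Sum>m<r. ip (v R) (e m) * e m x)" for x by (simp add: d_def)
      from \<open>ip d d = ip (v R) d\<close> have "ip (v R) d / of_real (n\<^sup>2) = 1" using n dd by (metis divide_self of_real_eq_0_iff less_irrefl power_eq_0_iff)
      then have "(\<lambda>x. v R x - (\<Sum>m<Suc r. ip (v R) (e' m) * e' m x)) = (\<lambda>x. d x - 1 * d x)"
        using exp[OF i] unfolding iR by (simp only: dx[symmetric])
      then have "(\<lambda>x. v i x - (\<Sum>m<Suc r. ip (v i) (e' m) * e' m x)) = (\<lambda>x. 0)"
        unfolding iR by simp
      then show ?thesis using ip_zero[OF zero_mem] by (simp add: hnorm_def)
    qed
    show ?thesis using e'H on' res' by blast
  qed
qed

lemma parseval:
  fixes r :: nat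
  assumes e: "\<And>m. m < r \<Longrightarrow> e m \<in> H"
    and on: "\<And>m m'. m < r \<Longrightarrow> m' < r \<Longrightarrow> ip (e m) (e m') = (if m = m' then 1 else 0)"
    and u: "u \<in> H" and v: "v \<in> H"
    and res: "hnorm ip (\<lambda>x. u x - (\<Sum>m<r. ip u (e m) * e m x)) = 0"
  shows "ip u v = (\<Sum>m<r. ip u (e m) * ip (e m) v)"
proof -
  have S: "(\<lambda>x. \<Sum>m<r. ip u (e m) * e m x) \<in> H" using e by (intro sum_mem) auto
  have "ip (\<lambda>x. u x - (\<Sum>m<r. ip u (e m) * e m x)) v = 0"
    using cauchy_schwarz[OF diff_mem[OF u S] v] res by simp
  moreover have "ip (\<lambda>x. \<Sum>m<r. ip u (e m) * e m x) v = (\<Sum>m<r. ip u (e m) * ip (e m) v)"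
    using e v by (intro ip_sum) auto
  ultimately show ?thesis using u S v by (simp add: ip_diff)
qed

end

section \<open>Reproducing kernel Hilbert spaces\<close>

lemma hilbert_semi_inner: "hilbert_function_space X H ip \<Longrightarrow> semi_inner H ip"
  unfolding hilbert_function_space_def by unfold_locales blast+

lemma hilbertI:
  assumes "semi_inner H ip"
    and "\<And>f x. f \<in> H \<Longrightarrow> x \<notin> X \<Longrightarrow> f x = 0"
    and "\<And>f. f \<in> H \<Longrightarrow> ip f f = 0 \<Longrightarrow> f = (\<lambda>x. 0)"
    and "\<And>F. \<forall>n. F n \<in> H \<Longrightarrow> \<forall>e>0. \<exists>M::nat. \<forall>m\<ge>M. \<forall>n\<ge>M. hnorm ip (\<lambda>x. F m x - F n x) < e \<Longrightarrow>
      \<exists>f\<in>H. (\<lambda>n. hnorm ip (\<lambda>x. F n x - f x)) \<longlonglongrightarrow> 0"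
  shows "hilbert_function_space X H ip"
proof -
  interpret semi_inner H ip by fact
  show ?thesis
    unfolding hilbert_function_space_def
    by (intro conjI ballI allI impI; (elim conjE)?)
      (assumption | rule assms zero_mem add_mem scale_mem ip_add ip_scale ip_cnj ip_nonneg)+
qed

lemma hilbert_complete:
  assumes "hilbert_function_space X H ip" "\<And>n. F n \<in> H"
    "\<And>e. e > 0 \<Longrightarrow> \<exists>M. \<forall>m\<ge>M. \<forall>n\<ge>M. hnorm ip (\<lambda>x. F m x - F n x) < e"
  obtains f where "f \<in> H" "(\<lambda>n. hnorm ip (\<lambda>x. F n x - f x)) \<longlonglongrightarrow> 0"
  using assms unfolding hilbert_function_space_def by blast

text \<open>The first variation at a minimum: along \<open>t = - \<epsilon> cnj u\<close> the linear term \<open>- 2 \<epsilon> |u|\<^sup>2\<close> would beat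
  the quadratic one for small \<open>\<epsilon>\<close>.\<close>
lemma linear_perturbation_zero:
  fixes u :: complex
  assumes "\<And>t. 0 \<le> 2 * Re (t * u) + (cmod t)\<^sup>2 * b" and "0 \<le> b"
  shows "u = 0"
proof (rule ccontr)
  assume "u \<noteq> 0"
  define e where "e = 1 / (b + 1)"
  have e: "e > 0" "e * b < 1" using \<open>0 \<le> b\<close> by (auto simp: e_def field_simps)
  have "Re (- of_real e * cnj u * u) = - e * (cmod u)\<^sup>2"
    unfolding cmod_power2 by (simp add: power2_eq_square algebra_simps)
  then have "0 \<le> 2 * (- e * (cmod u)\<^sup>2) + (e * cmod u)\<^sup>2 * b"
    using assms(1)[of "- of_real e * cnj u"] e by (simp add: norm_mult)
  also have "\<dots> = (e * (cmod u)\<^sup>2) * (e * b - 2)" by (simp add: power2_eq_square algebra_simps)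
  finally have "0 \<le> (e * (cmod u)\<^sup>2) * (e * b - 2)" .
  moreover have "0 < e * (cmod u)\<^sup>2" using e \<open>u \<noteq> 0\<close> by simp
  ultimately have "0 \<le> e * b - 2" by (metis mult_pos_neg not_le)
  then show False using e by simp
qed

text \<open>Riesz representation of a functional given only by a linear set \<open>D\<close> of pairs (argument, value),
  which spares a proof that the value is determined by the argument. The representing
  vector is the limit of a minimising sequence of \<open>\<parallel>h\<parallel>\<^sup>2 - 2 Re a\<close> over \<open>D\<close>: the parallelogram law makes
  the sequence Cauchy, and the first variation at the limit gives the representation. Since \<open>D\<close> is
  not closed, the limit itself need not occur in \<open>D\<close>, so the variation is done along the sequence.\<close>
lemma riesz_pairs:
  fixes D :: "(('x \<Rightarrow> complex) \<times> complex) set"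
  assumes hil: "hilbert_function_space X H ip"
    and ne: "D \<noteq> {}"
    and DH: "\<And>h a. (h, a) \<in> D \<Longrightarrow> h \<in> H"
    and add: "\<And>h a h' a'. (h, a) \<in> D \<Longrightarrow> (h', a') \<in> D \<Longrightarrow> (\<lambda>x. h x + h' x, a + a') \<in> D"
    and scale: "\<And>h a t. (h, a) \<in> D \<Longrightarrow> (\<lambda>x. t * h x, t * a) \<in> D"
    and bound: "\<And>h a. (h, a) \<in> D \<Longrightarrow> cmod a \<le> C * hnorm ip h" and C: "0 \<le> C"
  obtains f where "f \<in> H" "hnorm ip f \<le> C" "\<And>h a. (h, a) \<in> D \<Longrightarrow> ip h f = a"
proof -
  interpret semi_inner H ip using hil by (rule hilbert_semi_inner)
  define J where "J = (\<lambda>p. (hnorm ip (fst p))\<^sup>2 - 2 * Re (snd p))"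
  have Jlow: "- (C\<^sup>2) \<le> J p" if p: "p \<in> D" for p
  proof -
    have "Re (snd p) \<le> C * hnorm ip (fst p)"
      using bound[of "fst p" "snd p"] p complex_Re_le_cmod order_trans by fastforce
    moreover have "0 \<le> (hnorm ip (fst p) - C)\<^sup>2" by simp
    ultimately show ?thesis by (simp add: J_def power2_diff mult.commute)
  qed
  have bdd: "bdd_below (J ` D)" using Jlow by (intro bdd_belowI[of _ "- (C\<^sup>2)"]) auto
  define m where "m = Inf (J ` D)"
  have mle: "m \<le> J p" if "p \<in> D" for p
    unfolding m_def using that bdd by (intro cInf_lower) auto
  have "\<exists>p\<in>D. J p < m + 1 / (real n + 1)" for n
    using cInf_lessD[of "J ` D" "m + 1 / (real n + 1)"] ne by (auto simp: m_def)
  then obtain P where PD: "\<And>n. P n \<in> D" and PJ: "\<And>n. J (P n) < m + 1 / (real n + 1)" by metis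
  define h a where "h = (\<lambda>n. fst (P n))" and "a = (\<lambda>n. snd (P n))"
  have haD: "(h n, a n) \<in> D" for n using PD by (simp add: h_def a_def)
  have hH: "h n \<in> H" for n using haD DH by blast
  \<comment> \<open>Midpoints lie in \<open>D\<close>, so their value of \<open>J\<close> is at least the infimum.\<close>
  have near: "(hnorm ip (\<lambda>x. h p x - h q x))\<^sup>2 \<le> 2 / (real p + 1) + 2 / (real q + 1)" for p q
  proof -
    have "(\<lambda>x. 1/2 * (h p x + h q x), 1/2 * (a p + a q)) \<in> D"
      using scale[OF add[OF haD haD], of "1/2" p q] by simp
    then have "m \<le> J (\<lambda>x. 1/2 * (h p x + h q x), 1/2 * (a p + a q))" by (rule mle)
    also have "\<dots> = (hnorm ip (\<lambda>x. h p x + h q x))\<^sup>2 / 4 - Re (a p) - Re (a q)"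
    proof -
      have "hnorm ip (\<lambda>x. 1/2 * (h p x + h q x)) = hnorm ip (\<lambda>x. h p x + h q x) / 2"
        using hnorm_scale[OF add_mem[OF hH hH], of "1/2" p q] by simp
      then have "(hnorm ip (\<lambda>x. 1/2 * (h p x + h q x)))\<^sup>2 = (hnorm ip (\<lambda>x. h p x + h q x))\<^sup>2 / 4"
        by (simp only: power_divide) simp
      moreover have "Re (1/2 * (a p + a q)) = (Re (a p) + Re (a q)) / 2" by simp
      ultimately show ?thesis unfolding J_def fst_conv snd_conv by argo
    qed
    finally have 1: "4 * m \<le> (hnorm ip (\<lambda>x. h p x + h q x))\<^sup>2 - 4 * Re (a p) - 4 * Re (a q)" by simp
    have 2: "(hnorm ip (h n))\<^sup>2 - 2 * Re (a n) < m + 1 / (real n + 1)" for n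
      using PJ[of n] by (simp add: J_def h_def a_def)
    show ?thesis using 1 2[of p] 2[of q] hnorm_sq_add[OF hH hH, of p q] hnorm_sq_diff[OF hH hH, of p q]
      by simp
  qed
  have cau: "\<exists>M. \<forall>p\<ge>M. \<forall>q\<ge>M. hnorm ip (\<lambda>x. h p x - h q x) < e" if e: "e > 0" for e
  proof -
    obtain M :: nat where M: "4 / e\<^sup>2 < real M" using reals_Archimedean2 by blast
    have "hnorm ip (\<lambda>x. h p x - h q x) < e" if "p \<ge> M" "q \<ge> M" for p q
    proof -
      have "2 / (real j + 1) < e\<^sup>2 / 2" if "j \<ge> M" for j
      proof -
        have "4 / e\<^sup>2 < real j + 1" using M that by simp
        then show ?thesis using e by (simp add: field_simps)
      qed
      from near[of p q] this[OF \<open>p \<ge> M\<close>] this[OF \<open>q \<ge> M\<close>] have "(hnorm ip (\<lambda>x. h p x - h q x))\<^sup>2 < e\<^sup>2"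
        by simp
      then show ?thesis using e by (simp add: power2_less_imp_less)
    qed
    then show ?thesis by blast
  qed
  obtain f where f: "f \<in> H" and lim: "(\<lambda>n. hnorm ip (\<lambda>x. h n x - f x)) \<longlonglongrightarrow> 0"
    by (rule hilbert_complete[OF hil, of h]) (assumption | rule hH cau that)+
  have iplim: "(\<lambda>n. ip g (h n)) \<longlonglongrightarrow> ip g f" if g: "g \<in> H" for g
  proof -
    have le: "norm (ip g (h n) - ip g f) \<le> hnorm ip g * hnorm ip (\<lambda>x. h n x - f x)" for n
      using cauchy_schwarz[OF g diff_mem[OF hH f], of n] by (simp add: ip_diff_right hH f g)
    have "(\<lambda>n. hnorm ip g * hnorm ip (\<lambda>x. h n x - f x)) \<longlonglongrightarrow> 0"
      using tendsto_mult_left[OF lim, of "hnorm ip g"] by simp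
    then have "(\<lambda>n. ip g (h n) - ip g f) \<longlonglongrightarrow> 0"
      by (rule Lim_null_comparison[OF always_eventually[OF allI[OF le]]])
    then show ?thesis by (simp add: LIM_zero_iff)
  qed
  have inv0: "(\<lambda>n. 1 / (real n + 1)) \<longlonglongrightarrow> 0"
    using LIMSEQ_inverse_real_of_nat by (simp add: inverse_eq_divide add.commute)
  have rep: "ip g f = b" if gb: "(g, b) \<in> D" for g b
  proof -
    have g: "g \<in> H" using gb DH by blast
    have "0 \<le> 2 * Re (t * (ip g f - b)) + (cmod t)\<^sup>2 * (hnorm ip g)\<^sup>2" for t
    proof -
      have "0 \<le> 2 * Re (t * (ip g (h n) - b)) + (cmod t)\<^sup>2 * (hnorm ip g)\<^sup>2 + 1 / (real n + 1)" for n
      proof -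
        have "m \<le> J (\<lambda>x. h n x + t * g x, a n + t * b)"
          by (intro mle add haD scale gb)
        also have "\<dots> = J (P n) + 2 * Re (t * (ip g (h n) - b)) + (cmod t)\<^sup>2 * (hnorm ip g)\<^sup>2"
        proof -
          have "ip (h n) (\<lambda>x. t * g x) = cnj (t * ip g (h n))"
            using g hH ip_cnj[OF g hH] by (simp add: ip_scale_right)
          then have "Re (ip (h n) (\<lambda>x. t * g x)) = Re (t * ip g (h n))" by simp
          then show ?thesis unfolding J_def h_def[symmetric] a_def[symmetric]
            using hnorm_sq_add[OF hH scale_mem[OF g], of n t] g
            by (simp add: h_def a_def hnorm_scale power_mult_distrib algebra_simps)
        qed
        finally show ?thesis using PJ[of n] by simp
      qed
      moreover have "(\<lambda>n. 2 * Re (t * (ip g (h n) - b)) + (cmod t)\<^sup>2 * (hnorm ip g)\<^sup>2 + 1 / (real n + 1))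
        \<longlonglongrightarrow> 2 * Re (t * (ip g f - b)) + (cmod t)\<^sup>2 * (hnorm ip g)\<^sup>2 + 0"
        by (intro tendsto_intros iplim g inv0)
      ultimately have "0 \<le> 2 * Re (t * (ip g f - b)) + (cmod t)\<^sup>2 * (hnorm ip g)\<^sup>2 + 0"
        by (intro LIMSEQ_le_const) auto
      then show ?thesis by simp
    qed
    then show ?thesis using linear_perturbation_zero[of "ip g f - b" "(hnorm ip g)\<^sup>2"] by simp
  qed
  have "hnorm ip f \<le> C"
  proof -
    have le: "cmod (ip f (h n)) \<le> C * (hnorm ip f + hnorm ip (\<lambda>x. h n x - f x))" for n
    proof -
      have "hnorm ip (h n) \<le> hnorm ip f + hnorm ip (\<lambda>x. h n x - f x)"
        using hnorm_triangle[OF f diff_mem[OF hH f], of n] by simp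
      moreover have "cmod (ip f (h n)) = cmod (a n)"
        using rep[OF haD, of n] ip_cnj[OF hH f, of n] by simp
      ultimately show ?thesis using bound[OF haD, of n] C
        by (metis mult_left_mono order_trans)
    qed
    have "(\<lambda>n. C * (hnorm ip f + hnorm ip (\<lambda>x. h n x - f x))) \<longlonglongrightarrow> C * (hnorm ip f + 0)"
      by (intro tendsto_intros lim)
    then have "cmod (ip f f) \<le> C * (hnorm ip f + 0)"
      using LIMSEQ_le[OF tendsto_norm[OF iplim[OF f]]] le by blast
    then have "cmod (ip f f) \<le> C * hnorm ip f" by simp
    then have "hnorm ip f * hnorm ip f \<le> C * hnorm ip f"
      by (simp add: ip_self[OF f] norm_power power2_eq_square norm_mult hnorm_nonneg[OF f])
    then show ?thesis using hnorm_nonneg[OF f] C by (metis mult_le_cancel_right not_less order_le_less)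
  qed
  then show thesis using that f rep by blast
qed

definition kernel_at :: "'x set \<Rightarrow> ('x \<Rightarrow> 'x \<Rightarrow> complex) \<Rightarrow> 'x \<Rightarrow> 'x \<Rightarrow> complex" where
  "kernel_at X k w = (\<lambda>z. if z \<in> X then k z w else 0)"

lemma rkhs_kernel_at:
  assumes "is_rkhs X k H ip"
  shows "w \<in> X \<Longrightarrow> kernel_at X k w \<in> H"
    and "w \<in> X \<Longrightarrow> f \<in> H \<Longrightarrow> ip f (kernel_at X k w) = f w"
  using assms unfolding is_rkhs_def kernel_at_def by blast+

lemma rkhs_hilbert: "is_rkhs X k H ip \<Longrightarrow> hilbert_function_space X H ip"
  by (simp add: is_rkhs_def)

lemma rkhs_vanish: "is_rkhs X k H ip \<Longrightarrow> f \<in> H \<Longrightarrow> x \<notin> X \<Longrightarrow> f x = 0"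
  by (simp add: is_rkhs_def hilbert_function_space_def)

text \<open>The functional that should be the inner product with \<open>g\<close> is prescribed on kernel functions by
  the values of \<open>g\<close>. If it is bounded there, its Riesz representative has the same values as \<open>g\<close>,
  by the reproducing property, and so it is \<open>g\<close>.\<close>
lemma rkhs_membership:
  assumes rk: "is_rkhs X k H ip" and van: "\<And>x. x \<notin> X \<Longrightarrow> g x = 0" and C: "0 \<le> C"
    and bound: "\<And>S c. finite S \<Longrightarrow> S \<subseteq> X \<Longrightarrow>
      cmod (\<Sum>y\<in>S. c y * cnj (g y)) \<le> C * hnorm ip (\<lambda>x. \<Sum>y\<in>S. c y * kernel_at X k y x)"
  shows "g \<in> H" and "hnorm ip g \<le> C"
proof -
  interpret semi_inner H ip using rk by (intro hilbert_semi_inner rkhs_hilbert)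
  define pr where "pr = (\<lambda>S c. ((\<lambda>x. \<Sum>y\<in>S. c y * kernel_at X k y x), \<Sum>y\<in>S. c y * cnj (g y)))"
  define D where "D = {pr S c | S c. finite S \<and> S \<subseteq> X}"
  have Dadd: "(\<lambda>x. h x + h' x, a + a') \<in> D" if "(h, a) \<in> D" "(h', a') \<in> D" for h a h' a'
  proof -
    from that obtain S c S' c' where *: "(h, a) = pr S c" "finite S" "S \<subseteq> X"
      "(h', a') = pr S' c'" "finite S'" "S' \<subseteq> X" unfolding D_def by blast
    define d where "d = (\<lambda>y. (if y \<in> S then c y else 0) + (if y \<in> S' then c' y else 0))"
    have ext: "(\<Sum>y\<in>S \<union> S'. d y * u y) = (\<Sum>y\<in>S. c y * u y) + (\<Sum>y\<in>S'. c' y * u y)" for u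
    proof -
      have "(\<Sum>y\<in>S \<union> S'. d y * u y) = (\<Sum>y\<in>S \<union> S'. if y \<in> S then c y * u y else 0)
          + (\<Sum>y\<in>S \<union> S'. if y \<in> S' then c' y * u y else 0)"
        unfolding sum.distrib[symmetric] by (intro sum.cong) (auto simp: d_def algebra_simps)
      also have "(\<Sum>y\<in>S \<union> S'. if y \<in> S then c y * u y else 0) = (\<Sum>y\<in>S. c y * u y)"
        using * by (intro sum.mono_neutral_cong_right) auto
      also have "(\<Sum>y\<in>S \<union> S'. if y \<in> S' then c' y * u y else 0) = (\<Sum>y\<in>S'. c' y * u y)"
        using * by (intro sum.mono_neutral_cong_right) auto
      finally show ?thesis .
    qed
    have "(\<lambda>x. h x + h' x, a + a') = pr (S \<union> S') d"
      using * unfolding pr_def ext by simp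
    then show ?thesis using * unfolding D_def by blast
  qed
  have Dscale: "(\<lambda>x. t * h x, t * a) \<in> D" if "(h, a) \<in> D" for h a t
  proof -
    from that obtain S c where *: "(h, a) = pr S c" "finite S" "S \<subseteq> X" unfolding D_def by blast
    then have "(\<lambda>x. t * h x, t * a) = pr S (\<lambda>y. t * c y)"
      by (simp add: pr_def sum_distrib_left mult.assoc)
    then show ?thesis using * unfolding D_def by blast
  qed
  have "pr {} undefined \<in> D" unfolding D_def by blast
  then have ne: "D \<noteq> {}" by blast
  have DH: "h \<in> H" if "(h, a) \<in> D" for h a
    using that rkhs_kernel_at(1)[OF rk] by (auto simp: D_def pr_def intro!: sum_mem)
  have bd: "cmod a \<le> C * hnorm ip h" if "(h, a) \<in> D" for h a
    using that bound by (auto simp: D_def pr_def)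
  obtain f where f: "f \<in> H" "hnorm ip f \<le> C" and rep: "\<And>h a. (h, a) \<in> D \<Longrightarrow> ip h f = a"
    by (rule riesz_pairs[OF rkhs_hilbert[OF rk] ne, of C])
      (assumption | rule DH Dadd Dscale bd C that)+
  have "f x = g x" for x
  proof (cases "x \<in> X")
    case True
    have "pr {x} (\<lambda>_. 1) \<in> D" unfolding D_def using True by blast
    then have "ip (kernel_at X k x) f = cnj (g x)" using rep by (simp add: pr_def)
    moreover have "ip (kernel_at X k x) f = cnj (f x)"
      using rkhs_kernel_at[OF rk True] f ip_cnj[of f "kernel_at X k x"] by simp
    ultimately show ?thesis by simp
  next
    case False
    then show ?thesis using van rkhs_vanish[OF rk f(1)] by simp
  qed
  then have "f = g" by blast
  with f show "g \<in> H" "hnorm ip g \<le> C" by auto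
qed

section \<open>Vector-valued functions as scalar functions on a larger set\<close>

text \<open>A vector-valued function on \<open>X\<close> is a scalar function on \<open>X \<times> {..<N}\<close>, and \<open>H \<otimes> \<complex>\<^sup>N\<close> becomes the
  reproducing kernel space of the kernel \<open>k \<otimes> I\<close> there. The scalar membership criterion then covers
  the vector-valued case.\<close>
definition amplify :: "nat \<Rightarrow> ('x \<Rightarrow> complex) set \<Rightarrow> ('x \<times> nat \<Rightarrow> complex) set" where
  "amplify N H = {F. (\<forall>x i. N \<le> i \<longrightarrow> F (x, i) = 0) \<and> (\<forall>i<N. (\<lambda>x. F (x, i)) \<in> H)}"

definition amplify_ip :: "nat \<Rightarrow> (('x \<Rightarrow> complex) \<Rightarrow> ('x \<Rightarrow> complex) \<Rightarrow> complex) \<Rightarrow>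
    ('x \<times> nat \<Rightarrow> complex) \<Rightarrow> ('x \<times> nat \<Rightarrow> complex) \<Rightarrow> complex" where
  "amplify_ip N ip F G = (\<Sum>i<N. ip (\<lambda>x. F (x, i)) (\<lambda>x. G (x, i)))"

definition amplify_kernel :: "('x \<Rightarrow> 'x \<Rightarrow> complex) \<Rightarrow> 'x \<times> nat \<Rightarrow> 'x \<times> nat \<Rightarrow> complex" where
  "amplify_kernel k p q = (if snd p = snd q then k (fst p) (fst q) else 0)"

lemma amplify_semi_inner:
  assumes "semi_inner H ip"
  shows "semi_inner (amplify N H) (amplify_ip N ip)"
proof -
  interpret semi_inner H ip by fact
  show ?thesis
  proof
    fix f g assume "f \<in> amplify N H" "g \<in> amplify N H"
    then show "amplify_ip N ip g f = cnj (amplify_ip N ip f g)"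
      unfolding amplify_ip_def cnj_sum by (intro sum.cong ip_cnj) (auto simp: amplify_def)
  qed (auto simp: amplify_def amplify_ip_def zero_mem add_mem scale_mem ip_add ip_scale
        sum.distrib sum_distrib_left ip_nonneg intro!: sum_nonneg)
qed

lemma amplify_hnorm:
  assumes "semi_inner H ip" "F \<in> amplify N H"
  shows "hnorm (amplify_ip N ip) F = sqrt (\<Sum>i<N. (hnorm ip (\<lambda>x. F (x, i)))\<^sup>2)"
proof -
  interpret semi_inner H ip by fact
  have "Re (amplify_ip N ip F F) = (\<Sum>i<N. (hnorm ip (\<lambda>x. F (x, i)))\<^sup>2)"
    unfolding amplify_ip_def Re_sum
    by (intro sum.cong hnorm_sq[symmetric]) (use assms(2) in \<open>auto simp: amplify_def\<close>)
  then show ?thesis by (simp add: hnorm_def)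
qed

lemma amplify_hilbert:
  assumes hil: "hilbert_function_space X H ip"
  shows "hilbert_function_space (X \<times> {..<N}) (amplify N H) (amplify_ip N ip)"
proof -
  have si: "semi_inner H ip" using hil by (rule hilbert_semi_inner)
  interpret H: semi_inner H ip by (rule si)
  interpret A: semi_inner "amplify N H" "amplify_ip N ip" using si by (rule amplify_semi_inner)
  have van: "f \<in> H \<Longrightarrow> x \<notin> X \<Longrightarrow> f x = 0" and def0: "f \<in> H \<Longrightarrow> ip f f = 0 \<Longrightarrow> f = (\<lambda>x. 0)" for f x
    using hil unfolding hilbert_function_space_def by blast+
  have v: "F p = 0" if F: "F \<in> amplify N H" and p: "p \<notin> X \<times> {..<N}" for F p
  proof (cases "snd p < N")
    case True
    then show ?thesis using van[of "\<lambda>x. F (x, snd p)" "fst p"] F p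
      by (cases p) (auto simp: amplify_def)
  next
    case False
    then show ?thesis using F by (cases p) (auto simp: amplify_def)
  qed
  have d: "F = (\<lambda>x. 0)" if F: "F \<in> amplify N H" and 0: "amplify_ip N ip F F = 0" for F
  proof -
    have comp: "(\<lambda>x. F (x, i)) \<in> H" if "i < N" for i using F that by (simp add: amplify_def)
    have "(\<lambda>x. F (x, i)) = (\<lambda>x. 0)" if i: "i < N" for i
    proof -
      have "(\<Sum>i<N. ip (\<lambda>x. F (x, i)) (\<lambda>x. F (x, i))) = 0" using 0 by (simp add: amplify_ip_def)
      then have "ip (\<lambda>x. F (x, i)) (\<lambda>x. F (x, i)) = 0"
        by (subst (asm) sum_nonneg_eq_0_iff) (use i comp H.ip_nonneg in auto)
      then show ?thesis using def0[OF comp[OF i]] by simp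
    qed
    then have "F (x, i) = 0" for x i using F by (cases "i < N") (auto simp: amplify_def fun_eq_iff)
    then show ?thesis by auto
  qed
  have c: "\<exists>f\<in>amplify N H. (\<lambda>n. hnorm (amplify_ip N ip) (\<lambda>x. F n x - f x)) \<longlonglongrightarrow> 0"
    if F: "\<forall>n. F n \<in> amplify N H"
      and cau: "\<forall>e>0. \<exists>M. \<forall>m\<ge>M. \<forall>n\<ge>M. hnorm (amplify_ip N ip) (\<lambda>x. F m x - F n x) < e"
    for F :: "nat \<Rightarrow> _"
  proof -
    have FH: "(\<lambda>x. F n (x, i)) \<in> H" if "i < N" for i n using F that by (simp add: amplify_def)
    have le: "hnorm ip (\<lambda>x. D (x, i)) \<le> hnorm (amplify_ip N ip) D" if "i < N" "D \<in> amplify N H" for i D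
    proof -
      have "(hnorm ip (\<lambda>x. D (x, i)))\<^sup>2 \<le> (\<Sum>i<N. (hnorm ip (\<lambda>x. D (x, i)))\<^sup>2)"
        using that by (intro member_le_sum) auto
      then show ?thesis unfolding amplify_hnorm[OF si that(2)] by (rule real_le_rsqrt)
    qed
    have ex: "\<exists>f. f \<in> H \<and> (\<lambda>n. hnorm ip (\<lambda>x. F n (x, i) - f x)) \<longlonglongrightarrow> 0" if i: "i < N" for i
    proof -
      have cc: "\<exists>M. \<forall>m\<ge>M. \<forall>n\<ge>M. hnorm ip (\<lambda>x. F m (x, i) - F n (x, i)) < e" if e: "e > 0" for e
      proof -
        obtain M :: nat where M: "\<And>m n. M \<le> m \<Longrightarrow> M \<le> n \<Longrightarrow> hnorm (amplify_ip N ip) (\<lambda>x. F m x - F n x) < e"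
          using cau e by blast
        have "hnorm ip (\<lambda>x. F m (x, i) - F n (x, i)) < e" if "M \<le> m" "M \<le> n" for m n
          using le_less_trans[OF le[OF i A.diff_mem[OF F[rule_format, of m] F[rule_format, of n]]] M[OF that]] .
        then show ?thesis by blast
      qed
      obtain f where "f \<in> H" "(\<lambda>n. hnorm ip (\<lambda>x. F n (x, i) - f x)) \<longlonglongrightarrow> 0"
        by (rule hilbert_complete[OF hil, of "\<lambda>n x. F n (x, i)"]) (assumption | rule FH[OF i] cc that)+
      then show ?thesis by blast
    qed
    define f where "f = (\<lambda>i. SOME f. f \<in> H \<and> (\<lambda>n. hnorm ip (\<lambda>x. F n (x, i) - f x)) \<longlonglongrightarrow> 0)"
    have f: "f i \<in> H" and lim: "(\<lambda>n. hnorm ip (\<lambda>x. F n (x, i) - f i x)) \<longlonglongrightarrow> 0" if "i < N" for i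
      unfolding f_def using someI_ex[OF ex[OF that]] by blast+
    define g where "g = (\<lambda>(x, i). if i < N then f i x else 0)"
    have g: "g \<in> amplify N H" using f by (auto simp: amplify_def g_def)
    have "hnorm (amplify_ip N ip) (\<lambda>x. F n x - g x) = sqrt (\<Sum>i<N. (hnorm ip (\<lambda>x. F n (x, i) - f i x))\<^sup>2)" for n
      using amplify_hnorm[OF si A.diff_mem[OF F[rule_format] g], of n] by (simp add: g_def)
    moreover have "(\<lambda>n. sqrt (\<Sum>i<N. (hnorm ip (\<lambda>x. F n (x, i) - f i x))\<^sup>2)) \<longlonglongrightarrow> sqrt (\<Sum>i<N. 0\<^sup>2)"
      by (intro tendsto_intros lim) auto
    ultimately have "(\<lambda>n. hnorm (amplify_ip N ip) (\<lambda>x. F n x - g x)) \<longlonglongrightarrow> 0" by simp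
    then show ?thesis by (intro bexI[of _ g] g)
  qed
  show ?thesis
    by (rule hilbertI[OF A.semi_inner_axioms]) (assumption | rule v d c)+
qed

lemma amplify_rkhs:
  assumes rk: "is_rkhs X k H ip"
  shows "is_rkhs (X \<times> {..<N}) (amplify_kernel k) (amplify N H) (amplify_ip N ip)"
proof -
  interpret semi_inner H ip using rk by (intro hilbert_semi_inner rkhs_hilbert)
  have "(\<lambda>z. if z \<in> X \<times> {..<N} then amplify_kernel k z q else 0) \<in> amplify N H \<and>
      (\<forall>f\<in>amplify N H. amplify_ip N ip f (\<lambda>z. if z \<in> X \<times> {..<N} then amplify_kernel k z q else 0) = f q)"
    if q: "q \<in> X \<times> {..<N}" for q
  proof -
    obtain w j where wj: "q = (w, j)" "w \<in> X" "j < N" using q by auto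
    have comp: "(\<lambda>x. if (x, i) \<in> X \<times> {..<N} then amplify_kernel k (x, i) q else 0)
        = (if i = j then kernel_at X k w else (\<lambda>x. 0))" for i
      using wj by (auto simp: amplify_kernel_def kernel_at_def fun_eq_iff)
    have "amplify_ip N ip f (\<lambda>z. if z \<in> X \<times> {..<N} then amplify_kernel k z q else 0) = f q"
      if f: "f \<in> amplify N H" for f
    proof -
      have fH: "(\<lambda>x. f (x, i)) \<in> H" if "i < N" for i using f that by (simp add: amplify_def)
      have "amplify_ip N ip f (\<lambda>z. if z \<in> X \<times> {..<N} then amplify_kernel k z q else 0)
        = (\<Sum>i<N. if i = j then f (w, i) else 0)"
        unfolding amplify_ip_def comp
        using fH ip_cnj[OF _ zero_mem] ip_zero rkhs_kernel_at(2)[OF rk wj(2)] ip_diff_right[OF zero_mem zero_mem]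
        by (intro sum.cong) auto
      then show ?thesis using wj by simp
    qed
    moreover have "(\<lambda>z. if z \<in> X \<times> {..<N} then amplify_kernel k z q else 0) \<in> amplify N H"
      unfolding amplify_def mem_Collect_eq comp
      using zero_mem rkhs_kernel_at(1)[OF rk wj(2)] by auto
    ultimately show ?thesis by blast
  qed
  then show ?thesis
    unfolding is_rkhs_def using amplify_hilbert[OF rkhs_hilbert[OF rk]] by blast
qed

section \<open>Multipliers of norm at most one and positive kernels\<close>

text \<open>The functions \<open>U y\<close> are what the adjoint of multiplication by \<open>\<Phi>\<close> does to the kernel functions
  \<open>L y\<close> of the target space. The hypothesis says exactly that this assignment is contractive on
  linear combinations (\<open>dom\<close>). Hence for \<open>f\<close> in the source space the functional attached to \<open>\<Phi> f\<close> is
  bounded by the norm of \<open>f\<close>, and the membership criterion applies.\<close>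
lemma contractive_multiplierI:
  assumes rkH: "is_rkhs X k H ipH" and rkG: "is_rkhs X l G ipG"
    and \<Phi>: "\<And>x. x \<in> X \<Longrightarrow> \<Phi> x \<in> carrier_mat N N"
    and pd: "\<And>S c. finite S \<Longrightarrow> S \<subseteq> X \<times> {..<N} \<Longrightarrow>
      0 \<le> Re (\<Sum>p\<in>S. \<Sum>q\<in>S. (amplify_kernel l p q - k (fst p) (fst q) *
        (\<Sum>j<N. \<Phi> (fst p) $$ (snd p, j) * cnj (\<Phi> (fst q) $$ (snd q, j)))) * c q * cnj (c p))"
  shows "\<Phi> \<in> Mult N X H G" and "mult_norm N X H ipH ipG \<Phi> \<le> 1"
proof -
  have siH: "semi_inner H ipH" and siG: "semi_inner G ipG"
    using rkH rkG by (auto intro: hilbert_semi_inner rkhs_hilbert)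
  interpret A: semi_inner "amplify N H" "amplify_ip N ipH" using siH by (rule amplify_semi_inner)
  interpret B: semi_inner "amplify N G" "amplify_ip N ipG" using siG by (rule amplify_semi_inner)
  let ?Y = "X \<times> {..<N}"
  have rkA: "is_rkhs ?Y (amplify_kernel k) (amplify N H) (amplify_ip N ipH)"
    and rkB: "is_rkhs ?Y (amplify_kernel l) (amplify N G) (amplify_ip N ipG)"
    using rkH rkG by (auto intro: amplify_rkhs)
  define K L where "K = kernel_at ?Y (amplify_kernel k)" and "L = kernel_at ?Y (amplify_kernel l)"
  define U where "U = (\<lambda>y p. \<Sum>j<N. cnj (\<Phi> (fst y) $$ (snd y, j)) * K (fst y, j) p)"
  have KA: "K (x, j) \<in> amplify N H" if "x \<in> X" "j < N" for x j
    unfolding K_def using that by (intro rkhs_kernel_at(1)[OF rkA]) auto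
  have UA: "U y \<in> amplify N H" if "y \<in> ?Y" for y
    unfolding U_def using that by (intro A.sum_mem KA) auto
  have LB: "L y \<in> amplify N G" if "y \<in> ?Y" for y
    unfolding L_def using that by (rule rkhs_kernel_at(1)[OF rkB])
  have ipU: "amplify_ip N ipH F (U y) = (\<Sum>j<N. \<Phi> (fst y) $$ (snd y, j) * F (fst y, j))"
    if "y \<in> ?Y" "F \<in> amplify N H" for y F
  proof -
    have "amplify_ip N ipH F (U y) = (\<Sum>j<N. cnj (cnj (\<Phi> (fst y) $$ (snd y, j))) * amplify_ip N ipH F (K (fst y, j)))"
      unfolding U_def using that by (intro A.ip_sum_right KA) auto
    also have "\<dots> = (\<Sum>j<N. \<Phi> (fst y) $$ (snd y, j) * F (fst y, j))"
      unfolding K_def using that by (intro sum.cong) (auto simp: rkhs_kernel_at(2)[OF rkA])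
    finally show ?thesis .
  qed
  have UU: "amplify_ip N ipH (U q) (U p) = k (fst p) (fst q) *
        (\<Sum>j<N. \<Phi> (fst p) $$ (snd p, j) * cnj (\<Phi> (fst q) $$ (snd q, j)))"
    if "p \<in> ?Y" "q \<in> ?Y" for p q
  proof -
    have "U q (fst p, j) = cnj (\<Phi> (fst q) $$ (snd q, j)) * k (fst p) (fst q)" if "j < N" for j
    proof -
      have "U q (fst p, j) = (\<Sum>i<N. if i = j then cnj (\<Phi> (fst q) $$ (snd q, i)) * k (fst p) (fst q) else 0)"
        unfolding U_def K_def kernel_at_def amplify_kernel_def
        using that \<open>p \<in> ?Y\<close> by (intro sum.cong) auto
      then show ?thesis using that by simp
    qed
    then show ?thesis
      using ipU[OF that(1) UA[OF that(2)]] by (simp add: sum_distrib_left mult_ac)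
  qed
  have LL: "amplify_ip N ipG (L q) (L p) = amplify_kernel l p q" if "p \<in> ?Y" "q \<in> ?Y" for p q
    using rkhs_kernel_at(2)[OF rkB that(1) LB[OF that(2)]] that by (simp add: L_def kernel_at_def)
  have dom: "hnorm (amplify_ip N ipH) (\<lambda>x. \<Sum>y\<in>S. c y * U y x) \<le>
      hnorm (amplify_ip N ipG) (\<lambda>x. \<Sum>y\<in>S. c y * L y x)" if S: "finite S" "S \<subseteq> ?Y" for S c
  proof (rule power2_le_imp_le)
    have "(hnorm (amplify_ip N ipG) (\<lambda>x. \<Sum>y\<in>S. c y * L y x))\<^sup>2
        - (hnorm (amplify_ip N ipH) (\<lambda>x. \<Sum>y\<in>S. c y * U y x))\<^sup>2
      = Re (\<Sum>p\<in>S. \<Sum>q\<in>S. (amplify_kernel l p q - k (fst p) (fst q) *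
        (\<Sum>j<N. \<Phi> (fst p) $$ (snd p, j) * cnj (\<Phi> (fst q) $$ (snd q, j)))) * c q * cnj (c p))"
    proof -
      have u: "(hnorm (amplify_ip N ipH) (\<lambda>x. \<Sum>y\<in>S. c y * U y x))\<^sup>2
        = Re (\<Sum>p\<in>S. \<Sum>q\<in>S. amplify_ip N ipH (U q) (U p) * c q * cnj (c p))"
        using S UA by (intro A.hnorm_sq_sum) auto
      have l: "(hnorm (amplify_ip N ipG) (\<lambda>x. \<Sum>y\<in>S. c y * L y x))\<^sup>2
        = Re (\<Sum>p\<in>S. \<Sum>q\<in>S. amplify_ip N ipG (L q) (L p) * c q * cnj (c p))"
        using S LB by (intro B.hnorm_sq_sum) auto
      show ?thesis unfolding u l minus_complex.sel[symmetric] sum_subtractf[symmetric] left_diff_distrib[symmetric]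
        using S by (intro arg_cong[where f = Re] sum.cong refl) (auto simp: UU LL subset_iff)
    qed
    then show "(hnorm (amplify_ip N ipH) (\<lambda>x. \<Sum>y\<in>S. c y * U y x))\<^sup>2
        \<le> (hnorm (amplify_ip N ipG) (\<lambda>x. \<Sum>y\<in>S. c y * L y x))\<^sup>2"
      using pd[OF S, of c] by linarith
  qed (use S LB in \<open>intro B.hnorm_nonneg B.sum_mem, auto\<close>)
  have main: "mult_op N X \<Phi> f \<in> tensor_space N G \<and>
      tensor_norm N ipG (mult_op N X \<Phi> f) \<le> tensor_norm N ipH f" if f: "f \<in> tensor_space N H" for f
  proof -
    define F where "F = (\<lambda>(x, i). if i < N then f x $ i else 0)"
    define g where "g = (\<lambda>(x, i). if i < N then mult_op N X \<Phi> f x $ i else 0)"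
    have fH: "i < N \<Longrightarrow> (\<lambda>x. f x $ i) \<in> H" and fc: "f x \<in> carrier_vec N" for i x
      using f by (auto simp: tensor_space_def)
    have FA: "F \<in> amplify N H" using fH by (auto simp: amplify_def F_def)
    have gy: "g y = amplify_ip N ipH F (U y)" if y: "y \<in> ?Y" for y
    proof -
      obtain x i where xi: "y = (x, i)" "x \<in> X" "i < N" using y by auto
      have "(\<Phi> x *\<^sub>v f x) $ i = (\<Sum>j<N. \<Phi> x $$ (i, j) * f x $ j)"
        using \<Phi>[OF xi(2)] fc[of x] xi(3)
        by (auto simp: scalar_prod_def lessThan_atLeast0 intro!: sum.cong)
      then have "g y = (\<Sum>j<N. \<Phi> (fst y) $$ (snd y, j) * F (fst y, j))"
        using xi by (simp add: g_def mult_op_def F_def)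
      then show ?thesis unfolding ipU[OF y FA] .
    qed
    have van: "g y = 0" if "y \<notin> ?Y" for y
      using that by (cases y) (auto simp: g_def mult_op_def)
    have bound: "cmod (\<Sum>y\<in>S. c y * cnj (g y)) \<le> hnorm (amplify_ip N ipH) F *
        hnorm (amplify_ip N ipG) (\<lambda>x. \<Sum>y\<in>S. c y * kernel_at ?Y (amplify_kernel l) y x)"
      if S: "finite S" "S \<subseteq> ?Y" for S c
    proof -
      have uA: "(\<lambda>x. \<Sum>y\<in>S. c y * U y x) \<in> amplify N H" using S UA by (intro A.sum_mem) auto
      have "amplify_ip N ipH (\<lambda>x. \<Sum>y\<in>S. c y * U y x) F = (\<Sum>y\<in>S. c y * amplify_ip N ipH (U y) F)"
        using S UA FA by (intro A.ip_sum) auto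
      also have "\<dots> = (\<Sum>y\<in>S. c y * cnj (g y))"
      proof (intro sum.cong refl arg_cong2[where f = "(*)"])
        fix y assume "y \<in> S"
        then have "y \<in> ?Y" using S by blast
        then show "amplify_ip N ipH (U y) F = cnj (g y)" using gy A.ip_cnj[OF FA UA] by simp
      qed
      finally have "cmod (\<Sum>y\<in>S. c y * cnj (g y)) \<le>
          hnorm (amplify_ip N ipH) (\<lambda>x. \<Sum>y\<in>S. c y * U y x) * hnorm (amplify_ip N ipH) F"
        using A.cauchy_schwarz[OF uA FA] by simp
      also have "\<dots> \<le> hnorm (amplify_ip N ipG) (\<lambda>x. \<Sum>y\<in>S. c y * L y x) * hnorm (amplify_ip N ipH) F"
        using dom[OF S] A.hnorm_nonneg[OF FA] by (rule mult_right_mono)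
      finally show ?thesis by (simp add: L_def mult.commute)
    qed
    have gB: "g \<in> amplify N G" and gn: "hnorm (amplify_ip N ipG) g \<le> hnorm (amplify_ip N ipH) F"
      using rkhs_membership[OF rkB van A.hnorm_nonneg[OF FA] bound] by blast+
    have "mult_op N X \<Phi> f x \<in> carrier_vec N" for x
      using \<Phi>[of x] fc[of x] by (auto simp: mult_op_def)
    moreover have "(\<lambda>x. mult_op N X \<Phi> f x $ i) \<in> G" if "i < N" for i
      using gB that by (auto simp: amplify_def g_def)
    moreover have "hnorm (amplify_ip N ipG) g = tensor_norm N ipG (mult_op N X \<Phi> f)"
      unfolding amplify_hnorm[OF siG gB] tensor_norm_def by (simp add: g_def)
    moreover have "hnorm (amplify_ip N ipH) F = tensor_norm N ipH f"
      unfolding amplify_hnorm[OF siH FA] tensor_norm_def by (simp add: F_def)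
    ultimately show ?thesis using gn by (auto simp: tensor_space_def)
  qed
  show "\<Phi> \<in> Mult N X H G" unfolding Mult_def using main \<Phi> by blast
  show "mult_norm N X H ipH ipG \<Phi> \<le> 1"
    unfolding mult_norm_def by (rule SUP_least) (use main in \<open>force simp: one_ereal_def\<close>)
qed

text \<open>The converse direction: with \<open>u = \<Sum> c\<^sub>i cnj (\<Phi>(z\<^sub>i)) k\<^bsub>z\<^sub>i\<^esub>\<close> and \<open>h = \<Sum> c\<^sub>i l\<^bsub>z\<^sub>i\<^esub>\<close> the inner product of
  \<open>\<Phi> u\<close> and \<open>h\<close> is \<open>\<parallel>u\<parallel>\<^sup>2\<close>, so \<open>\<parallel>u\<parallel> \<le> \<parallel>h\<parallel>\<close>; the difference of the squares is the quadratic form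
  in question.\<close>
lemma scalar_multiplier_kernel:
  assumes rkH: "is_rkhs X k H ipH" and rkG: "is_rkhs X l G ipG"
    and \<Phi>: "\<Phi> \<in> Mult 1 X H G" and norm: "mult_norm 1 X H ipH ipG \<Phi> \<le> 1"
    and z: "\<And>i. i \<in> I \<Longrightarrow> z i \<in> X"
  shows "0 \<le> Re (\<Sum>i\<in>I. \<Sum>j\<in>I. (l (z i) (z j) - k (z i) (z j) *
    (\<Phi> (z i) $$ (0, 0) * cnj (\<Phi> (z j) $$ (0, 0)))) * c j * cnj (c i))"
proof -
  interpret H: semi_inner H ipH using rkH by (intro hilbert_semi_inner rkhs_hilbert)
  interpret G: semi_inner G ipG using rkG by (intro hilbert_semi_inner rkhs_hilbert)
  define \<phi> where "\<phi> = (\<lambda>x. if x \<in> X then \<Phi> x $$ (0, 0) else 0)"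
  have \<Phi>c: "\<Phi> x \<in> carrier_mat 1 1" if "x \<in> X" for x using \<Phi> that by (simp add: Mult_def)
  have mult: "(\<lambda>x. \<phi> x * f x) \<in> G \<and> (hnorm ipH f \<le> 1 \<longrightarrow> hnorm ipG (\<lambda>x. \<phi> x * f x) \<le> 1)" if f: "f \<in> H" for f
  proof -
    let ?f = "\<lambda>x. vec 1 (\<lambda>_. f x)"
    have t: "?f \<in> tensor_space 1 H" using f by (simp add: tensor_space_def)
    then have m: "mult_op 1 X \<Phi> ?f \<in> tensor_space 1 G" using \<Phi> by (simp add: Mult_def)
    have e: "mult_op 1 X \<Phi> ?f x $ 0 = \<phi> x * f x" for x
      using \<Phi>c[of x] by (auto simp: mult_op_def \<phi>_def scalar_prod_def)
    have "(\<lambda>x. mult_op 1 X \<Phi> ?f x $ 0) \<in> G" using m unfolding tensor_space_def by blast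
    then have "(\<lambda>x. \<phi> x * f x) \<in> G" unfolding e .
    moreover have "hnorm ipG (\<lambda>x. \<phi> x * f x) \<le> 1" if "hnorm ipH f \<le> 1"
    proof -
      have tn: "tensor_norm 1 ipH ?f = hnorm ipH f"
        using H.hnorm_nonneg[OF f] by (simp add: tensor_norm_def)
      have "ereal (tensor_norm 1 ipG (mult_op 1 X \<Phi> ?f)) \<le> mult_norm 1 X H ipH ipG \<Phi>"
        unfolding mult_norm_def using t tn that by (intro SUP_upper) auto
      then have "ereal (tensor_norm 1 ipG (mult_op 1 X \<Phi> ?f)) \<le> 1" using norm by (rule order_trans)
      then show ?thesis
        using G.hnorm_nonneg[OF \<open>(\<lambda>x. \<phi> x * f x) \<in> G\<close>] by (simp add: tensor_norm_def e one_ereal_def del: One_nat_def)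
    qed
    ultimately show ?thesis by blast
  qed
  have contr: "hnorm ipG (\<lambda>x. \<phi> x * f x) \<le> hnorm ipH f" if f: "f \<in> H" for f
  proof (rule field_le_epsilon)
    fix e :: real assume e: "e > 0"
    \<comment> \<open>Dividing by \<open>\<parallel>f\<parallel> + e\<close> instead of \<open>\<parallel>f\<parallel>\<close> avoids treating \<open>\<parallel>f\<parallel> = 0\<close> separately.\<close>
    define t where "t = hnorm ipH f + e"
    have t: "t > 0" using H.hnorm_nonneg[OF f] e by (simp add: t_def)
    define c where "c = complex_of_real (1 / t)"
    have c: "cmod c = 1 / t" using t by (simp add: c_def norm_divide)
    have "hnorm ipH (\<lambda>x. c * f x) \<le> 1"
      unfolding H.hnorm_scale[OF f] c using t e by (simp add: t_def)
    then have "hnorm ipG (\<lambda>x. \<phi> x * (c * f x)) \<le> 1" using mult[OF H.scale_mem[OF f]] by blast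
    then have "cmod c * hnorm ipG (\<lambda>x. \<phi> x * f x) \<le> 1"
      using G.hnorm_scale[of "\<lambda>x. \<phi> x * f x" c] mult[OF f] by (simp add: mult.left_commute)
    then show "hnorm ipG (\<lambda>x. \<phi> x * f x) \<le> hnorm ipH f + e"
      unfolding c using t by (simp add: t_def)
  qed
  define u where "u = (\<lambda>x. \<Sum>i\<in>I. (c i * cnj (\<phi> (z i))) * kernel_at X k (z i) x)"
  define h where "h = (\<lambda>x. \<Sum>i\<in>I. c i * kernel_at X l (z i) x)"
  have kH: "kernel_at X k (z i) \<in> H" and lG: "kernel_at X l (z i) \<in> G" if "i \<in> I" for i
    using z[OF that] rkhs_kernel_at(1)[OF rkH] rkhs_kernel_at(1)[OF rkG] by auto
  have uH: "u \<in> H" unfolding u_def by (intro H.sum_mem kH)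
  have hG: "h \<in> G" unfolding h_def by (intro G.sum_mem lG)
  have gG: "(\<lambda>x. \<phi> x * u x) \<in> G" using mult[OF uH] by blast
  have "ipG (\<lambda>x. \<phi> x * u x) h = (\<Sum>i\<in>I. cnj (c i) * ipG (\<lambda>x. \<phi> x * u x) (kernel_at X l (z i)))"
    unfolding h_def by (intro G.ip_sum_right lG gG)
  also have "\<dots> = (\<Sum>i\<in>I. cnj (c i) * (\<phi> (z i) * u (z i)))"
    using z by (intro sum.cong) (auto simp: rkhs_kernel_at(2)[OF rkG _ gG])
  also have "\<dots> = (\<Sum>i\<in>I. cnj (c i * cnj (\<phi> (z i))) * ipH u (kernel_at X k (z i)))"
    using z by (intro sum.cong) (auto simp: rkhs_kernel_at(2)[OF rkH _ uH])
  also have "\<dots> = ipH u (\<lambda>x. \<Sum>i\<in>I. (c i * cnj (\<phi> (z i))) * kernel_at X k (z i) x)"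
    by (rule H.ip_sum_right[symmetric]) (auto intro: kH uH)
  also have "\<dots> = ipH u u" by (simp add: u_def)
  finally have "cmod (ipH u u) \<le> hnorm ipG (\<lambda>x. \<phi> x * u x) * hnorm ipG h"
    using G.cauchy_schwarz[OF gG hG] by simp
  also have "\<dots> \<le> hnorm ipH u * hnorm ipG h"
    using contr[OF uH] G.hnorm_nonneg[OF hG] by (rule mult_right_mono)
  finally have "hnorm ipH u * hnorm ipH u \<le> hnorm ipH u * hnorm ipG h"
    by (simp add: H.ip_self[OF uH] norm_power power2_eq_square norm_mult H.hnorm_nonneg[OF uH])
  then have "hnorm ipH u \<le> hnorm ipG h"
    using H.hnorm_nonneg[OF uH] G.hnorm_nonneg[OF hG] by (metis mult_le_cancel_left not_less order_le_less)
  then have le: "(hnorm ipH u)\<^sup>2 \<le> (hnorm ipG h)\<^sup>2"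
    using H.hnorm_nonneg[OF uH] by (intro power_mono)
  have un: "(hnorm ipH u)\<^sup>2 = Re (\<Sum>i\<in>I. \<Sum>j\<in>I. ipH (kernel_at X k (z j)) (kernel_at X k (z i)) *
      (c j * cnj (\<phi> (z j))) * cnj (c i * cnj (\<phi> (z i))))"
    unfolding u_def by (intro H.hnorm_sq_sum kH)
  have hn: "(hnorm ipG h)\<^sup>2 = Re (\<Sum>i\<in>I. \<Sum>j\<in>I. ipG (kernel_at X l (z j)) (kernel_at X l (z i)) * c j * cnj (c i))"
    unfolding h_def by (intro G.hnorm_sq_sum lG)
  have kk: "ipH (kernel_at X k (z j)) (kernel_at X k (z i)) = k (z i) (z j)"
    and ll: "ipG (kernel_at X l (z j)) (kernel_at X l (z i)) = l (z i) (z j)" if "i \<in> I" "j \<in> I" for i j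
    using rkhs_kernel_at(2)[OF rkH z[OF that(1)] kH[OF that(2)]]
      rkhs_kernel_at(2)[OF rkG z[OF that(1)] lG[OF that(2)]] z[OF that(1)] by (auto simp: kernel_at_def)
  have "Re (\<Sum>i\<in>I. \<Sum>j\<in>I. (l (z i) (z j) - k (z i) (z j) *
      (\<Phi> (z i) $$ (0, 0) * cnj (\<Phi> (z j) $$ (0, 0)))) * c j * cnj (c i)) = (hnorm ipG h)\<^sup>2 - (hnorm ipH u)\<^sup>2"
    unfolding un hn minus_complex.sel[symmetric] sum_subtractf[symmetric]
    by (intro arg_cong[where f = Re] sum.cong refl) (auto simp: kk ll \<phi>_def z algebra_simps)
  then show ?thesis using le by linarith
qed

section \<open>Positive semi-definite forms\<close>

lemma psd_mat_iff:
  "psd (mat n n f) \<longleftrightarrow> (\<forall>c. 0 \<le> (\<Sum>i<n. \<Sum>j<n. f (i, j) * c j * cnj (c i)))"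
proof -
  have form: "(mat n n f *\<^sub>v v) \<bullet>c v = (\<Sum>i<n. \<Sum>j<n. f (i, j) * (v $ j) * cnj (v $ i))"
    if "v \<in> carrier_vec n" for v
    using that by (auto simp: scalar_prod_def lessThan_atLeast0 sum_distrib_right intro!: sum.cong)
  have "(\<forall>v \<in> carrier_vec n. 0 \<le> (mat n n f *\<^sub>v v) \<bullet>c v) \<longleftrightarrow>
      (\<forall>c. 0 \<le> (\<Sum>i<n. \<Sum>j<n. f (i, j) * c j * cnj (c i)))"
  proof (intro iffI allI ballI)
    fix c assume *: "\<forall>v \<in> carrier_vec n. 0 \<le> (mat n n f *\<^sub>v v) \<bullet>c v"
    then have "0 \<le> (mat n n f *\<^sub>v vec n c) \<bullet>c vec n c" by simp
    then show "0 \<le> (\<Sum>i<n. \<Sum>j<n. f (i, j) * c j * cnj (c i))" by (simp add: form)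
  next
    fix v :: "complex vec"
    assume *: "\<forall>c. 0 \<le> (\<Sum>i<n. \<Sum>j<n. f (i, j) * c j * cnj (c i))" and "v \<in> carrier_vec n"
    then show "0 \<le> (mat n n f *\<^sub>v v) \<bullet>c v" by (simp add: form)
  qed
  then show ?thesis by (simp add: psd_def)
qed

lemma rank_one_form:
  "(\<Sum>p\<in>S. \<Sum>q\<in>S. (u p * cnj (u q)) * c q * cnj (c p)) = of_real ((cmod (\<Sum>p\<in>S. u p * cnj (c p)))\<^sup>2)"
proof -
  have "of_real ((cmod (\<Sum>p\<in>S. u p * cnj (c p)))\<^sup>2) = (\<Sum>p\<in>S. u p * cnj (c p)) * (\<Sum>q\<in>S. cnj (u q) * c q)"
    by (simp only: complex_norm_square cnj_sum complex_cnj_mult complex_cnj_cnj)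
  also have "\<dots> = (\<Sum>p\<in>S. \<Sum>q\<in>S. (u p * cnj (c p)) * (cnj (u q) * c q))" by (rule sum_product)
  finally show ?thesis by (simp add: mult_ac)
qed

text \<open>A convergent sum of rank-one kernels is positive; the concrete kernels get their positivity from
  such expansions.\<close>
lemma form_nonneg_sums:
  assumes "\<And>p q. p \<in> S \<Longrightarrow> q \<in> S \<Longrightarrow> (\<lambda>n. u n p * cnj (u n q)) sums K p q"
  shows "0 \<le> (\<Sum>p\<in>S. \<Sum>q\<in>S. K p q * c q * cnj (c p))"
proof -
  have "(\<lambda>n. \<Sum>p\<in>S. \<Sum>q\<in>S. (u n p * cnj (u n q)) * c q * cnj (c p)) sums (\<Sum>p\<in>S. \<Sum>q\<in>S. K p q * c q * cnj (c p))"
    by (intro sums_sum sums_mult2 assms)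
  then have s: "(\<lambda>n. of_real ((cmod (\<Sum>p\<in>S. u n p * cnj (c p)))\<^sup>2)) sums (\<Sum>p\<in>S. \<Sum>q\<in>S. K p q * c q * cnj (c p))"
    unfolding rank_one_form .
  have "0 \<le> Re (\<Sum>p\<in>S. \<Sum>q\<in>S. K p q * c q * cnj (c p))"
    by (rule sums_le[OF _ sums_zero sums_Re[OF s]]) simp
  moreover have "Im (\<Sum>p\<in>S. \<Sum>q\<in>S. K p q * c q * cnj (c p)) = 0"
    using sums_unique2[OF sums_Im[OF s]] by simp
  ultimately show ?thesis by (simp add: nonneg_complex_iff)
qed

lemma is_kernelI_sums:
  assumes "X \<noteq> {}" "\<And>x y. x \<in> X \<Longrightarrow> y \<in> X \<Longrightarrow> (\<lambda>n. u n x * cnj (u n y)) sums K x y"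
  shows "is_kernel X K"
  unfolding is_kernel_def psd_mat_iff
proof (intro conjI allI impI, fact assms(1))
  fix n :: nat and z c assume z: "\<forall>i<n. z i \<in> X"
  show "0 \<le> (\<Sum>i<n. \<Sum>j<n. (case (i, j) of (i, j) \<Rightarrow> K (z i) (z j)) * c j * cnj (c i))"
    unfolding prod.case
    by (rule form_nonneg_sums[of _ "\<lambda>n i. u n (z i)"]) (use z assms(2) in auto)
qed

section \<open>Gram matrices and partial isometries\<close>

definition unit_fun :: "nat \<Rightarrow> nat \<Rightarrow> complex" where
  "unit_fun i = (\<lambda>t. if t = i then 1 else 0)"

lemma sum_unit_fun:
  "i < n \<Longrightarrow> (\<Sum>t<n. unit_fun i t * f t) = f i" "i < n \<Longrightarrow> (\<Sum>t<n. f t * unit_fun i t) = f i"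
  "i < n \<Longrightarrow> (\<Sum>t<n. f t * cnj (unit_fun i t)) = f i"
proof -
  have e: "unit_fun i t * f t = (if t = i then f t else 0)" "f t * unit_fun i t = (if t = i then f t else 0)"
    "f t * cnj (unit_fun i t) = (if t = i then f t else 0)" for t
    by (simp_all add: unit_fun_def)
  show "i < n \<Longrightarrow> (\<Sum>t<n. unit_fun i t * f t) = f i" "i < n \<Longrightarrow> (\<Sum>t<n. f t * unit_fun i t) = f i"
    "i < n \<Longrightarrow> (\<Sum>t<n. f t * cnj (unit_fun i t)) = f i"
    unfolding e by simp_all
qed

text \<open>A positive semi-definite matrix is a Gram matrix: Gram--Schmidt for the form itself, applied to
  the unit vectors, gives coordinates of each unit vector.\<close>
lemma gram_factorization:
  fixes R :: nat
  assumes nonneg: "\<And>c. 0 \<le> (\<Sum>p<R. \<Sum>q<R. P p q * c q * cnj (c p))"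
    and herm: "\<And>p q. p < R \<Longrightarrow> q < R \<Longrightarrow> P q p = cnj (P p q)"
  obtains M :: nat and G where "\<And>p q. p < R \<Longrightarrow> q < R \<Longrightarrow> P p q = (\<Sum>m<M. G p m * cnj (G q m))"
proof -
  define ip where "ip = (\<lambda>c d. \<Sum>p<R. \<Sum>q<R. P p q * c p * cnj (d q))"
  interpret semi_inner "UNIV :: (nat \<Rightarrow> complex) set" ip
  proof
    fix f g :: "nat \<Rightarrow> complex"
    have "ip g f = (\<Sum>p<R. \<Sum>q<R. P q p * g q * cnj (f p))"
      unfolding ip_def by (rule sum.swap)
    also have "\<dots> = cnj (ip f g)"
      unfolding ip_def cnj_sum
    proof (intro sum.cong refl)
      fix p q assume "p \<in> {..<R}" "q \<in> {..<R}"
      then have "P q p = cnj (P p q)" by (intro herm) auto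
      then show "P q p * g q * cnj (f p) = cnj (P p q * f p * cnj (g q))" by simp
    qed
    finally show "ip g f = cnj (ip f g)" .
    have "ip f f = (\<Sum>p<R. \<Sum>q<R. P p q * (\<lambda>q. cnj (f q)) q * cnj ((\<lambda>q. cnj (f q)) p))"
      unfolding ip_def by (simp add: mult_ac)
    then show "0 \<le> ip f f" using nonneg[of "\<lambda>q. cnj (f q)"] by simp
  qed (auto simp: ip_def algebra_simps sum.distrib sum_distrib_left)
  obtain r :: nat and e where
    *: "(\<forall>m<r. e m \<in> UNIV) \<and> (\<forall>m<r. \<forall>m'<r. ip (e m) (e m') = (if m = m' then 1 else 0)) \<and>
    (\<forall>i<R. hnorm ip (\<lambda>x. unit_fun i x - (\<Sum>m<r. ip (unit_fun i) (e m) * e m x)) = 0)"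
    using gram_schmidt[of R unit_fun] by auto
  have "P p q = (\<Sum>m<r. ip (unit_fun p) (e m) * cnj (ip (unit_fun q) (e m)))" if "p < R" "q < R" for p q
  proof -
    have "P p q = ip (unit_fun p) (unit_fun q)"
    proof -
      have "ip (unit_fun p) (unit_fun q) = (\<Sum>p'<R. unit_fun p p' * (\<Sum>q'<R. P p' q' * cnj (unit_fun q q')))"
        unfolding ip_def by (simp add: sum_distrib_left mult_ac)
      then show ?thesis using that by (simp add: sum_unit_fun)
    qed
    also have "\<dots> = (\<Sum>m<r. ip (unit_fun p) (e m) * ip (e m) (unit_fun q))"
      by (rule parseval) (use * that in auto)
    also have "\<dots> = (\<Sum>m<r. ip (unit_fun p) (e m) * cnj (ip (unit_fun q) (e m)))"
      by (intro sum.cong refl arg_cong2[where f = "(*)"] ip_cnj) auto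
    finally show ?thesis .
  qed
  then show thesis by (rule that[of "\<lambda>p m. ip (unit_fun p) (e m)" r])
qed

definition dot :: "nat \<Rightarrow> (nat \<Rightarrow> complex) \<Rightarrow> (nat \<Rightarrow> complex) \<Rightarrow> complex" where
  "dot T u v = (\<Sum>t<T. u t * cnj (v t))"

lemma dot_semi_inner: "semi_inner UNIV (dot T)"
  by unfold_locales (auto simp: dot_def algebra_simps sum.distrib sum_distrib_left cnj_mult_self nonneg_complex_iff
      simp del: of_real_power intro!: sum_nonneg)

lemma dot_self_eq_0: "dot T u u = 0 \<Longrightarrow> t < T \<Longrightarrow> u t = 0"
proof -
  assume 0: "dot T u u = 0" and t: "t < T"
  have "(\<Sum>t<T. (cmod (u t))\<^sup>2) = 0"
    using 0 unfolding dot_def cnj_mult_self of_real_sum[symmetric] by (simp only: of_real_eq_0_iff)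
  then have "(cmod (u t))\<^sup>2 = 0" by (subst (asm) sum_nonneg_eq_0_iff) (use t in auto)
  then show "u t = 0" by simp
qed

lemma dot_cong: "(\<And>t. t < T \<Longrightarrow> u t = u' t) \<Longrightarrow> (\<And>t. t < T \<Longrightarrow> v t = v' t) \<Longrightarrow> dot T u v = dot T u' v'"
  unfolding dot_def by (intro sum.cong) auto

text \<open>The operator \<open>\<Sum> x\<^sub>m y\<^sub>m\<^sup>*\<close>. If both families are orthonormal, it sends \<open>y\<close> to \<open>x\<close> and annihilates the
  orthogonal complement of \<open>y\<close>.\<close>
definition partial_isometry :: "nat \<Rightarrow> nat \<Rightarrow> (nat \<Rightarrow> nat \<Rightarrow> complex) \<Rightarrow> (nat \<Rightarrow> nat \<Rightarrow> complex) \<Rightarrow>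
    (nat \<Rightarrow> complex) \<Rightarrow> nat \<Rightarrow> complex" where
  "partial_isometry T r x y v = (\<lambda>t. \<Sum>m<r. dot T v (y m) * x m t)"

text \<open>Both families induce the same form on coefficient vectors. Orthonormalising that form yields
  coefficient vectors whose combinations of \<open>X\<close> and of \<open>Y\<close> are orthonormal simultaneously. A
  residual of norm zero gives a vanishing combination of \<open>X\<close> as well as of \<open>Y\<close>.\<close>
lemma lurking_isometry:
  fixes R :: nat
  assumes gram: "\<And>p q. p < R \<Longrightarrow> q < R \<Longrightarrow> dot T (X p) (X q) = dot T (Y p) (Y q)"
  obtains r x y where
    "\<forall>m<r. \<forall>m'<r. dot T (x m) (x m') = (if m = m' then 1 else 0)"
    "\<forall>m<r. \<forall>m'<r. dot T (y m) (y m') = (if m = m' then 1 else 0)"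
    "\<forall>p<R. \<forall>t<T. partial_isometry T r x y (Y p) t = X p t"
proof -
  interpret D: semi_inner UNIV "dot T" by (rule dot_semi_inner)
  define C where "C = (\<lambda>(F :: nat \<Rightarrow> nat \<Rightarrow> complex) c t. \<Sum>p<R. c p * F p t)"
  define ip where "ip = (\<lambda>c d. dot T (C Y c) (C Y d))"
  have Cadd: "C F (\<lambda>p. c p + d p) = (\<lambda>t. C F c t + C F d t)" for F c d
    by (simp add: C_def algebra_simps sum.distrib)
  have Cscale: "C F (\<lambda>p. a * c p) = (\<lambda>t. a * C F c t)" for F c a
    by (simp add: C_def sum_distrib_left mult.assoc)
  have Cunit: "C F (unit_fun p) = F p" if "p < R" for F p
    using that by (simp add: C_def sum_unit_fun fun_eq_iff)
  have ipX: "ip c d = dot T (C X c) (C X d)" for c d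
  proof -
    have e: "dot T (C F c) (C F d) = (\<Sum>p<R. c p * (\<Sum>q<R. cnj (d q) * dot T (F p) (F q)))" for F
      unfolding C_def by (subst D.ip_sum, (rule UNIV_I)+, subst D.ip_sum_right, (rule UNIV_I)+, rule refl)
    show ?thesis unfolding ip_def e by (intro sum.cong refl arg_cong2[where f = "(*)"]) (auto simp: gram)
  qed
  interpret semi_inner UNIV ip
    by unfold_locales (auto simp: ip_def Cadd Cscale D.ip_add D.ip_scale D.ip_nonneg intro: D.ip_cnj)
  obtain r :: nat and e where
    *: "(\<forall>m<r. e m \<in> UNIV) \<and> (\<forall>m<r. \<forall>m'<r. ip (e m) (e m') = (if m = m' then 1 else 0)) \<and>
    (\<forall>i<R. hnorm ip (\<lambda>x. unit_fun i x - (\<Sum>m<r. ip (unit_fun i) (e m) * e m x)) = 0)"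
    using gram_schmidt[of R unit_fun] by auto
  define x y where "x = (\<lambda>m. C X (e m))" and "y = (\<lambda>m. C Y (e m))"
  have "partial_isometry T r x y (Y p) t = X p t" if p: "p < R" and t: "t < T" for p t
  proof -
    define d where "d = (\<lambda>x. unit_fun p x - (\<Sum>m<r. ip (unit_fun p) (e m) * e m x))"
    have "ip d d = 0" using * p ip_self[of d] by (simp add: d_def)
    then have "C X d t = 0" using dot_self_eq_0[OF _ t] by (simp add: ipX)
    moreover have "C X d t = X p t - partial_isometry T r x y (Y p) t"
    proof -
      have "C X d t = C X (unit_fun p) t - (\<Sum>q<R. \<Sum>m<r. ip (unit_fun p) (e m) * e m q * X q t)"
        by (simp add: C_def d_def left_diff_distrib sum_subtractf sum_distrib_right)
      also have "(\<Sum>q<R. \<Sum>m<r. ip (unit_fun p) (e m) * e m q * X q t) = (\<Sum>m<r. ip (unit_fun p) (e m) * C X (e m) t)"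
        by (subst sum.swap) (simp add: C_def sum_distrib_left mult.assoc)
      finally show ?thesis using p by (simp add: partial_isometry_def Cunit ip_def x_def y_def)
    qed
    ultimately show ?thesis by simp
  qed
  moreover have "dot T (x m) (x m') = (if m = m' then 1 else 0)"
    "dot T (y m) (y m') = (if m = m' then 1 else 0)" if "m < r" "m' < r" for m m'
  proof -
    have on: "ip (e m) (e m') = (if m = m' then 1 else 0)" using * that by blast
    show "dot T (x m) (x m') = (if m = m' then 1 else 0)"
      unfolding x_def ipX[symmetric] by (rule on)
    show "dot T (y m) (y m') = (if m = m' then 1 else 0)"
      using on unfolding y_def ip_def .
  qed
  ultimately show thesis by (intro that[of r x y] allI impI)
qed

text \<open>Since \<open>\<rho>\<close> is the orthogonal projection onto the complement of \<open>y\<close>, the defect \<open>I - V\<^sup>* V\<close> of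
  the partial isometry \<open>V\<close> is \<open>\<rho>\<^sup>* \<rho>\<close>. Only a Gram matrix is needed from the defect, so \<open>V\<close> need not
  be extended to a unitary.\<close>
lemma partial_isometry_defect:
  assumes x: "\<And>m m'. m < r \<Longrightarrow> m' < r \<Longrightarrow> dot T (x m) (x m') = (if m = m' then 1 else 0)"
    and y: "\<And>m m'. m < r \<Longrightarrow> m' < r \<Longrightarrow> dot T (y m) (y m') = (if m = m' then 1 else 0)"
  defines "\<rho> \<equiv> \<lambda>u t. u t - (\<Sum>m<r. dot T u (y m) * y m t)"
  shows "dot T u v - dot T (partial_isometry T r x y u) (partial_isometry T r x y v) = dot T (\<rho> u) (\<rho> v)"
proof -
  interpret D: semi_inner UNIV "dot T" by (rule dot_semi_inner)
  have e: "dot T (\<lambda>t. \<Sum>m<r. a m * w m t) (\<lambda>t. \<Sum>m<r. b m * w m t) = (\<Sum>m<r. a m * cnj (b m))"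
    if w: "\<And>m m'. m < r \<Longrightarrow> m' < r \<Longrightarrow> dot T (w m) (w m') = (if m = m' then 1 else 0)" for w a b
  proof -
    have "dot T (\<lambda>t. \<Sum>m<r. a m * w m t) (\<lambda>t. \<Sum>m<r. b m * w m t)
        = (\<Sum>m<r. a m * (\<Sum>m'<r. cnj (b m') * dot T (w m) (w m')))"
      by (subst D.ip_sum, (rule UNIV_I)+, subst D.ip_sum_right, (rule UNIV_I)+, rule refl)
    also have "\<dots> = (\<Sum>m<r. a m * (\<Sum>m'<r. if m' = m then cnj (b m') else 0))"
      by (intro sum.cong refl arg_cong2[where f = "(*)"]) (auto simp: w)
    finally show ?thesis by simp
  qed
  have l: "dot T (\<lambda>t. \<Sum>m<r. dot T u (y m) * y m t) v = (\<Sum>m<r. dot T u (y m) * cnj (dot T v (y m)))"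
  proof -
    have "dot T (\<lambda>t. \<Sum>m<r. dot T u (y m) * y m t) v = (\<Sum>m<r. dot T u (y m) * dot T (y m) v)"
      by (rule D.ip_sum) auto
    moreover have "dot T (y m) v = cnj (dot T v (y m))" for m by (rule D.ip_cnj) auto
    ultimately show ?thesis by simp
  qed
  have l': "dot T u (\<lambda>t. \<Sum>m<r. dot T v (y m) * y m t) = (\<Sum>m<r. dot T u (y m) * cnj (dot T v (y m)))"
    by (subst D.ip_sum_right) (auto simp: mult.commute)
  have ee: "dot T (\<lambda>t. \<Sum>m<r. dot T u (y m) * y m t) (\<lambda>t. \<Sum>m<r. dot T v (y m) * y m t)
      = (\<Sum>m<r. dot T u (y m) * cnj (dot T v (y m)))"
    by (rule e[OF y])
  have "dot T (\<rho> u) (\<rho> v) = dot T u v - (\<Sum>m<r. dot T u (y m) * cnj (dot T v (y m)))"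
    unfolding \<rho>_def D.ip_diff[OF UNIV_I UNIV_I UNIV_I] D.ip_diff_right[OF UNIV_I UNIV_I UNIV_I] ee l l'
    by simp
  moreover have "dot T (partial_isometry T r x y u) (partial_isometry T r x y v)
      = (\<Sum>m<r. dot T u (y m) * cnj (dot T v (y m)))"
    unfolding partial_isometry_def by (rule e[OF x])
  ultimately show ?thesis by simp
qed

lemma linear_system_solvable:
  fixes A :: "nat \<Rightarrow> nat \<Rightarrow> complex"
  assumes "\<And>g. (\<And>t. t < M \<Longrightarrow> g t = (\<Sum>t'<M. A t t' * g t')) \<Longrightarrow> (\<And>t. t < M \<Longrightarrow> g t = 0)"
  obtains g where "\<forall>t<M. g t = (\<Sum>t'<M. A t t' * g t') + d t"
proof -
  define B where "B = 1\<^sub>m M - mat M M (\<lambda>(t, t'). A t t')"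
  have B: "B \<in> carrier_mat M M" unfolding B_def by (rule minus_carrier_mat) simp
  have Bv: "(B *\<^sub>v v) $ t = v $ t - (\<Sum>t'<M. A t t' * v $ t')" if v: "v \<in> carrier_vec M" and t: "t < M" for v t
  proof -
    have "(B *\<^sub>v v) $ t = (\<Sum>t'<M. unit_fun t t' * v $ t' - A t t' * v $ t')"
      using v t by (auto simp: B_def scalar_prod_def lessThan_atLeast0 unit_fun_def algebra_simps intro!: sum.cong)
    then show ?thesis using t by (simp add: sum_subtractf sum_unit_fun)
  qed
  have "det B \<noteq> 0"
  proof
    assume "det B = 0"
    then obtain v where v: "v \<in> carrier_vec M" "v \<noteq> 0\<^sub>v M" "B *\<^sub>v v = 0\<^sub>v M"
      using det_0_iff_vec_prod_zero[OF B] by blast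
    have "v $ t = (\<Sum>t'<M. A t t' * v $ t')" if "t < M" for t
      using Bv[OF v(1) that] v(3) that by simp
    then have "v $ t = 0" if "t < M" for t using assms[of "\<lambda>t. v $ t"] that by blast
    then show False using v by (auto intro: eq_vecI)
  qed
  then obtain B' where B': "B' \<in> carrier_mat M M" "B * B' = 1\<^sub>m M"
    using det_non_zero_imp_unit[OF B] by (auto simp: Units_def ring_mat_def)
  define v where "v = B' *\<^sub>v vec M d"
  have v: "v \<in> carrier_vec M" using B' by (simp add: v_def)
  have "B *\<^sub>v v = vec M d"
    unfolding v_def using B B' by (metis assoc_mult_mat_vec one_mult_mat_vec vec_carrier)
  then have "v $ t = (\<Sum>t'<M. A t t' * v $ t') + d t" if "t < M" for t
    using Bv[OF v that] that by simp
  then show thesis by (intro that[of "\<lambda>t. v $ t"] allI impI)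
qed

section \<open>The complete Pick property of the Szego kernel\<close>

lemma mult_adjoint_index:
  assumes "A \<in> carrier_mat N N" "B \<in> carrier_mat N N" "i < N" "j < N"
  shows "(A * mat_adjoint B) $$ (i, j) = (\<Sum>t<N. A $$ (i, t) * cnj (B $$ (j, t)))"
  using assms by (auto simp: mat_adjoint_def scalar_prod_def lessThan_atLeast0 mat_of_rows_def intro!: sum.cong)

lemma psd_pick_matrix_iff:
  assumes W: "\<And>i. i < n \<Longrightarrow> W i \<in> carrier_mat N N"
  shows "psd (pick_matrix k l n N z W) \<longleftrightarrow>
    (\<forall>c. 0 \<le> (\<Sum>p<n*N. \<Sum>q<n*N. ((if p mod N = q mod N then l (z (p div N)) (z (q div N)) else 0) -
        k (z (p div N)) (z (q div N)) *
          (\<Sum>j<N. W (p div N) $$ (p mod N, j) * cnj (W (q div N) $$ (q mod N, j)))) * c q * cnj (c p)))"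
proof -
  have e: "(l (z (p div N)) (z (q div N)) \<cdot>\<^sub>m 1\<^sub>m N
        - k (z (p div N)) (z (q div N)) \<cdot>\<^sub>m (W (p div N) * mat_adjoint (W (q div N)))) $$ (p mod N, q mod N)
      = (if p mod N = q mod N then l (z (p div N)) (z (q div N)) else 0) -
        k (z (p div N)) (z (q div N)) *
          (\<Sum>j<N. W (p div N) $$ (p mod N, j) * cnj (W (q div N) $$ (q mod N, j)))"
    if "p < n * N" "q < n * N" for p q
  proof -
    have N: "N > 0" using that by (cases N) auto
    have "p div N < n" "q div N < n" using that by (auto intro: less_mult_imp_div_less)
    then have Wp: "W (p div N) \<in> carrier_mat N N" and Wq: "W (q div N) \<in> carrier_mat N N"
      using W by auto
    have m: "p mod N < N" "q mod N < N" using N by auto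
    have "mat_adjoint (W (q div N)) \<in> carrier_mat N N"
      using Wq by (auto simp: mat_adjoint_def)
    then have c: "W (p div N) * mat_adjoint (W (q div N)) \<in> carrier_mat N N" using Wp by auto
    have "(u \<cdot>\<^sub>m 1\<^sub>m N - v \<cdot>\<^sub>m Q) $$ (p mod N, q mod N)
        = (if p mod N = q mod N then u else 0) - v * Q $$ (p mod N, q mod N)"
      if "Q \<in> carrier_mat N N" for u v :: complex and Q
      using that m by (cases "p mod N = q mod N") simp_all
    from this[OF c] show ?thesis unfolding mult_adjoint_index[OF Wp Wq m] .
  qed
  show ?thesis
    unfolding pick_matrix_def block_mat_def psd_mat_iff
    by (intro arg_cong[where f = All] ext arg_cong2[where f = "(\<le>)"] refl sum.cong arg_cong2[where f = "(*)"])
      (auto simp: e)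
qed

text \<open>The vector with first \<open>M\<close> entries from \<open>h\<close>, followed by the entries of \<open>k\<close>: an element of
  \<open>\<complex>\<^sup>M \<oplus> \<complex>\<^sup>N\<close>.\<close>
definition append_at :: "nat \<Rightarrow> (nat \<Rightarrow> complex) \<Rightarrow> (nat \<Rightarrow> complex) \<Rightarrow> nat \<Rightarrow> complex" where
  "append_at M h k = (\<lambda>t. if t < M then h t else k (t - M))"

lemma sum_lessThan_add: "(\<Sum>t<M + N. f t) = (\<Sum>t<M. f t) + (\<Sum>j<N. f (M + j))" for f :: "nat \<Rightarrow> complex"
  by (induction N) (auto simp: algebra_simps)

lemma dot_append_at: "dot (M + N) (append_at M h k) (append_at M h' k') = dot M h h' + dot N k k'"
  by (simp add: dot_def sum_lessThan_add append_at_def)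

lemma dot_decompose: "dot (M + N) u v = dot M u v + dot N (\<lambda>j. u (M + j)) (\<lambda>j. v (M + j))"
  by (simp add: dot_def sum_lessThan_add)

lemma dot_unit_fun: "b < N \<Longrightarrow> dot N (unit_fun b) (unit_fun b') = (if b = b' then 1 else 0)"
  unfolding dot_def by (subst sum_unit_fun(1)) (auto simp: unit_fun_def)

lemma partial_isometry_linear:
  "partial_isometry T r x y (\<lambda>t. (\<Sum>i\<in>I. c i * F i t) + v t) s
    = (\<Sum>i\<in>I. c i * partial_isometry T r x y (F i) s) + partial_isometry T r x y v s"
proof -
  interpret D: semi_inner UNIV "dot T" by (rule dot_semi_inner)
  have "dot T (\<lambda>t. (\<Sum>i\<in>I. c i * F i t) + v t) w = (\<Sum>i\<in>I. c i * dot T (F i) w) + dot T v w" for w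
    by (subst D.ip_add, (rule UNIV_I)+, subst D.ip_sum, (rule UNIV_I)+, rule refl)
  then show ?thesis
    unfolding partial_isometry_def
    by (simp add: sum.distrib distrib_right sum_distrib_left sum_distrib_right sum.swap[of _ I] mult.assoc)
qed

lemma partial_isometry_cong:
  "(\<And>t. t < T \<Longrightarrow> u t = v t) \<Longrightarrow> partial_isometry T r x y u = partial_isometry T r x y v"
  unfolding partial_isometry_def by (intro ext sum.cong refl arg_cong2[where f = "(*)"] dot_cong) auto

lemma cmod_mult_less_1:
  assumes "cmod z < 1" "cmod w < 1" shows "cmod (z * cnj w) < 1"
proof -
  have "cmod z * cmod w < 1 * 1" using assms by (intro mult_strict_mono') auto
  then show ?thesis by (simp add: norm_mult)
qed

text \<open>The lurking isometry argument. Factor the Pick matrix as \<open>\<langle>G p, G q\<rangle>\<close>. Clearing denominators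
  shows that the vectors \<open>(G p, w p)\<close> and \<open>(a p G p, e\<^bsub>\<beta> p\<^esub>)\<close> have the same Gram matrix, so a
  partial isometry \<open>V\<close> maps the latter to the former. For every \<open>\<zeta>\<close> in the disc let \<open>g \<zeta> b\<close> be the
  solution of the fixed point equation that the first component of \<open>V (\<zeta> g, e\<^sub>b)\<close> is \<open>g\<close>, and let
  \<open>\<phi> \<zeta> b\<close> be the second component. The equation is linear with a strictly contractive linear part
  (\<open>hom\<close>), so there is exactly one solution. At \<open>\<zeta> = a p\<close> this solution is \<open>G p\<close>, and hence \<open>\<phi>\<close>
  interpolates; the identity is the defect formula for \<open>V\<close>.\<close>
lemma realization:
  fixes a :: "nat \<Rightarrow> complex" and \<beta> :: "nat \<Rightarrow> nat" and w :: "nat \<Rightarrow> nat \<Rightarrow> complex"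
  assumes a: "\<And>p. p < R \<Longrightarrow> cmod (a p) < 1" and \<beta>: "\<And>p. p < R \<Longrightarrow> \<beta> p < N"
    and psd: "\<And>c. 0 \<le> (\<Sum>p<R. \<Sum>q<R.
      ((if \<beta> p = \<beta> q then 1 else 0) - dot N (w p) (w q)) / (1 - a p * cnj (a q)) * c q * cnj (c p))"
  obtains M T \<phi> g \<rho> where
    "\<forall>p<R. \<forall>j<N. \<phi> (a p) (\<beta> p) j = w p j"
    "\<forall>\<zeta> \<eta> b b'. cmod \<zeta> < 1 \<longrightarrow> cmod \<eta> < 1 \<longrightarrow> b < N \<longrightarrow> b' < N \<longrightarrow>
      (if b = b' then 1 else 0) - dot N (\<phi> \<zeta> b) (\<phi> \<eta> b')
      = (1 - \<zeta> * cnj \<eta>) * dot M (g \<zeta> b) (g \<eta> b') + dot T (\<rho> \<zeta> b) (\<rho> \<eta> b')"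
proof -
  have ne: "1 - a p * cnj (a q) \<noteq> 0" if "p < R" "q < R" for p q
  proof -
    show ?thesis using cmod_mult_less_1[OF a[OF that(1)] a[OF that(2)]] by auto
  qed
  have herm: "((if \<beta> q = \<beta> p then 1 else 0) - dot N (w q) (w p)) / (1 - a q * cnj (a p))
      = cnj (((if \<beta> p = \<beta> q then 1 else 0) - dot N (w p) (w q)) / (1 - a p * cnj (a q)))" for p q
    by (auto simp: dot_def mult.commute)
  obtain G M where G: "\<And>p q. p < R \<Longrightarrow> q < R \<Longrightarrow>
      ((if \<beta> p = \<beta> q then 1 else 0) - dot N (w p) (w q)) / (1 - a p * cnj (a q)) = dot M (G p) (G q)"
    unfolding dot_def by (rule gram_factorization[OF psd[unfolded dot_def] herm[unfolded dot_def]]) auto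
  define T where "T = M + N"
  define X where "X = (\<lambda>p. append_at M (G p) (w p))"
  define Y where "Y = (\<lambda>p. append_at M (\<lambda>t. a p * G p t) (unit_fun (\<beta> p)))"
  interpret DM: semi_inner UNIV "dot M" by (rule dot_semi_inner)
  interpret DN: semi_inner UNIV "dot N" by (rule dot_semi_inner)
  interpret DT: semi_inner UNIV "dot T" by (rule dot_semi_inner)
  have scaled: "dot M (\<lambda>t. \<zeta> * h t) (\<lambda>t. \<eta> * h' t) = \<zeta> * cnj \<eta> * dot M h h'" for \<zeta> \<eta> h h'
    by (simp add: dot_def sum_distrib_left mult_ac)
  have gram: "dot T (X p) (X q) = dot T (Y p) (Y q)" if "p < R" "q < R" for p q
    using G[OF that] ne[OF that]
    unfolding T_def X_def Y_def dot_append_at scaled dot_unit_fun[OF \<beta>[OF that(1)]]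
    by (simp add: field_simps)
  obtain r x y where
    x: "\<forall>m<r. \<forall>m'<r. dot T (x m) (x m') = (if m = m' then 1 else 0)" and
    y: "\<forall>m<r. \<forall>m'<r. dot T (y m) (y m') = (if m = m' then 1 else 0)" and
    VY': "\<forall>p<R. \<forall>t<T. partial_isometry T r x y (Y p) t = X p t"
    by (rule lurking_isometry[OF gram])
  then have VY: "\<And>p t. p < R \<Longrightarrow> t < T \<Longrightarrow> partial_isometry T r x y (Y p) t = X p t"
    by blast
  define V where "V = partial_isometry T r x y"
  define d where "d = (\<lambda>u t. u t - (\<Sum>m<r. dot T u (y m) * y m t))"
  have defect: "dot T u v - dot T (V u) (V v) = dot T (d u) (d v)" for u v
    unfolding V_def d_def by (rule partial_isometry_defect) (use x y in auto)
  have hom: "h t = 0" if \<zeta>: "cmod \<zeta> < 1" and t: "t < M"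
    and h: "\<And>t. t < M \<Longrightarrow> V (append_at M (\<lambda>t. \<zeta> * h t) (\<lambda>_. 0)) t = h t" for \<zeta> h t
  proof -
    define u where "u = append_at M (\<lambda>t. \<zeta> * h t) (\<lambda>_. 0)"
    define s where "s = (hnorm (dot M) h)\<^sup>2"
    have s: "dot M h h = of_real s" unfolding s_def by (rule DM.ip_self) simp
    have "dot T u u = (\<zeta> * cnj \<zeta>) * of_real s"
      unfolding u_def T_def dot_append_at scaled s[symmetric] by (simp add: dot_def)
    then have 1: "dot T u u = of_real ((cmod \<zeta>)\<^sup>2 * s)" unfolding cnj_mult_self by simp
    have "dot M (V u) (V u) = dot M h h" unfolding u_def by (intro dot_cong h)
    then have "dot T (V u) (V u) = of_real s + dot N (\<lambda>j. V u (M + j)) (\<lambda>j. V u (M + j))"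
      unfolding T_def dot_decompose s by simp
    moreover have "0 \<le> dot N (\<lambda>j. V u (M + j)) (\<lambda>j. V u (M + j))" "0 \<le> dot T (d u) (d u)"
      by (auto intro: DN.ip_nonneg DT.ip_nonneg)
    ultimately have "Re (dot T (V u) (V u)) \<ge> s" "Re (dot T (V u) (V u)) \<le> (cmod \<zeta>)\<^sup>2 * s"
      using defect[of u u, symmetric] 1 by (auto simp: nonneg_complex_iff)
    then have "s \<le> (cmod \<zeta>)\<^sup>2 * s" by linarith
    moreover have "(cmod \<zeta>)\<^sup>2 < 1" using \<zeta> by (simp add: power_less_one_iff)
    moreover have "0 \<le> s" by (simp add: s_def)
    ultimately have "s = 0"
      by (metis less_le mult.commute mult_less_cancel_left_pos mult.right_neutral not_less)
    then show ?thesis using s t by (intro dot_self_eq_0) auto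
  qed
  \<comment> \<open>The fixed point equation, and its expansion into a linear system for the entries of \<open>h\<close>.\<close>
  define sol where "sol = (\<lambda>\<zeta> b h. \<forall>t<M. V (append_at M (\<lambda>t. \<zeta> * h t) (unit_fun b)) t = h t)"
  have Vexp: "V (append_at M (\<lambda>t. \<zeta> * h t) k) s = (\<Sum>t<M. \<zeta> * V (unit_fun t) s * h t) + V (append_at M (\<lambda>_. 0) k) s" for \<zeta> h k s
  proof -
    have "append_at M (\<lambda>t. \<zeta> * h t) k = (\<lambda>t. (\<Sum>t'<M. (\<zeta> * h t') * unit_fun t' t) + append_at M (\<lambda>_. 0) k t)"
    proof
      fix t
      have "(\<Sum>t'<M. (\<zeta> * h t') * unit_fun t' t) = (\<Sum>t'<M. if t' = t then \<zeta> * h t' else 0)"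
        by (intro sum.cong) (auto simp: unit_fun_def)
      then show "append_at M (\<lambda>t. \<zeta> * h t) k t = (\<Sum>t'<M. (\<zeta> * h t') * unit_fun t' t) + append_at M (\<lambda>_. 0) k t"
        by (simp add: append_at_def)
    qed
    then show ?thesis
      unfolding V_def by (simp only: partial_isometry_linear) (simp add: mult_ac)
  qed
  have V0: "V (append_at M (\<lambda>_. 0) (\<lambda>_. 0)) s = 0" for s
    by (simp add: V_def partial_isometry_def append_at_def dot_def)
  have ex: "\<exists>h. sol \<zeta> b h" if \<zeta>: "cmod \<zeta> < 1" for \<zeta> b
  proof -
    have "h t = 0"
      if *: "\<And>t. t < M \<Longrightarrow> h t = (\<Sum>t'<M. \<zeta> * V (unit_fun t') t * h t')" and t: "t < M" for h t
    proof (rule hom[OF \<zeta> t])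
      fix t assume "t < M"
      then show "V (append_at M (\<lambda>t. \<zeta> * h t) (\<lambda>_. 0)) t = h t"
        unfolding Vexp V0 using *[of t] by simp
    qed
    then obtain h where "\<forall>t<M. h t = (\<Sum>t'<M. \<zeta> * V (unit_fun t') t * h t') + V (append_at M (\<lambda>_. 0) (unit_fun b)) t"
      by (rule linear_system_solvable)
    then have "sol \<zeta> b h" unfolding sol_def Vexp by metis
    then show ?thesis by blast
  qed
  have unique: "h t = h' t" if \<zeta>: "cmod \<zeta> < 1" and h: "sol \<zeta> b h" "sol \<zeta> b h'" and t: "t < M" for \<zeta> b h h' t
  proof -
    have "h t - h' t = 0"
    proof (rule hom[OF \<zeta> t])
      fix t assume t: "t < M"
      have "h t - h' t = (\<Sum>t'<M. \<zeta> * V (unit_fun t') t * h t') - (\<Sum>t'<M. \<zeta> * V (unit_fun t') t * h' t')"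
        using h t unfolding sol_def Vexp by (metis (no_types, lifting) add_diff_cancel_right)
      then show "V (append_at M (\<lambda>t. \<zeta> * (h t - h' t)) (\<lambda>_. 0)) t = h t - h' t"
        unfolding Vexp V0 by (simp add: right_diff_distrib sum_subtractf)
    qed
    then show ?thesis by simp
  qed
  define g where "g = (\<lambda>\<zeta> b. SOME h. sol \<zeta> b h)"
  have g: "sol \<zeta> b (g \<zeta> b)" if "cmod \<zeta> < 1" for \<zeta> b
    unfolding g_def using ex[OF that] by (rule someI_ex)
  define U where "U = (\<lambda>\<zeta> b. append_at M (\<lambda>t. \<zeta> * g \<zeta> b t) (unit_fun b))"
  define \<phi> where "\<phi> = (\<lambda>\<zeta> b j. V (U \<zeta> b) (M + j))"
  have interp: "\<phi> (a p) (\<beta> p) j = w p j" if p: "p < R" and j: "j < N" for p j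
  proof -
    have "sol (a p) (\<beta> p) (G p)"
      using VY[OF p] unfolding sol_def V_def Y_def X_def by (auto simp: T_def append_at_def)
    then have "g (a p) (\<beta> p) t = G p t" if "t < M" for t
      using unique[OF a[OF p] g[OF a[OF p]]] that by blast
    then have "V (U (a p) (\<beta> p)) = V (Y p)"
      unfolding V_def U_def Y_def by (intro partial_isometry_cong) (auto simp: append_at_def)
    then show ?thesis using VY[OF p, of "M + j"] j by (simp add: \<phi>_def V_def X_def T_def append_at_def)
  qed
  have main: "(if b = b' then 1 else 0) - dot N (\<phi> \<zeta> b) (\<phi> \<eta> b')
      = (1 - \<zeta> * cnj \<eta>) * dot M (g \<zeta> b) (g \<eta> b') + dot T (d (U \<zeta> b)) (d (U \<eta> b'))"
    if "cmod \<zeta> < 1" "cmod \<eta> < 1" "b < N" "b' < N" for \<zeta> \<eta> b b'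
  proof -
    have "dot T (U \<zeta> b) (U \<eta> b') = \<zeta> * cnj \<eta> * dot M (g \<zeta> b) (g \<eta> b') + (if b = b' then 1 else 0)"
      unfolding U_def T_def dot_append_at scaled dot_unit_fun[OF that(3)] by simp
    moreover have "dot M (V (U \<zeta> b)) (V (U \<eta> b')) = dot M (g \<zeta> b) (g \<eta> b')"
      using g[OF that(1), of b] g[OF that(2), of b'] by (intro dot_cong) (auto simp: sol_def U_def)
    then have "dot T (V (U \<zeta> b)) (V (U \<eta> b')) = dot M (g \<zeta> b) (g \<eta> b') + dot N (\<phi> \<zeta> b) (\<phi> \<eta> b')"
      unfolding T_def dot_decompose \<phi>_def by simp
    ultimately show ?thesis using defect[of "U \<zeta> b" "U \<eta> b'", symmetric] by (simp add: algebra_simps)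
  qed
  show thesis by (rule that[of \<phi> M g T "\<lambda>\<zeta> b. d (U \<zeta> b)"]) (intro allI impI interp main; assumption)+
qed

lemma szego_sums:
  assumes "cmod z < 1" "cmod w < 1"
  shows "(\<lambda>n. z ^ n * cnj (w ^ n)) sums (1 / (1 - z * cnj w))"
  using geometric_sums[OF cmod_mult_less_1[OF assms]] by (simp add: power_mult_distrib)

text \<open>Dividing the identity of the realization by \<open>1 - \<zeta> x cnj (\<zeta> y)\<close> writes \<open>s (I - \<Phi> \<Phi>\<^sup>*)\<close> as the sum of a Gram
  matrix and \<open>s\<close> times a Gram matrix, which is positive.\<close>
theorem szego_complete_pick:
  fixes \<zeta> :: "'x \<Rightarrow> complex"
  assumes ne: "X \<noteq> {}" and \<zeta>: "\<And>x. x \<in> X \<Longrightarrow> cmod (\<zeta> x) < 1"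
  defines "s \<equiv> \<lambda>x y. 1 / (1 - \<zeta> x * cnj (\<zeta> y))"
  shows "complete_pick_kernel X s"
  unfolding complete_pick_kernel_def
proof
  show "is_kernel X s"
    unfolding s_def
    by (rule is_kernelI_sums[of _ "\<lambda>n x. \<zeta> x ^ n"]) (use ne \<zeta> szego_sums in auto)
  show "complete_pick_pair X s s"
    unfolding complete_pick_pair_def
  proof (intro allI impI)
    fix H ipH G ipG and n N :: nat and z W
    assume rkH: "is_rkhs X s H ipH" and rkG: "is_rkhs X s G ipG" and N: "1 \<le> N"
      and z: "\<forall>i<n. z i \<in> X" and W: "\<forall>i<n. W i \<in> carrier_mat N N"
      and psd: "psd (pick_matrix s s n N z W)"
    define R where "R = n * N"
    define a where "a = (\<lambda>p. \<zeta> (z (p div N)))"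
    define w where "w = (\<lambda>p j. W (p div N) $$ (p mod N, j))"
    have divn: "p div N < n" if "p < R" for p
      using that unfolding R_def by (rule less_mult_imp_div_less)
    have a: "cmod (a p) < 1" if "p < R" for p unfolding a_def using divn[OF that] z by (intro \<zeta>) auto
    have m: "p mod N < N" if "p < R" for p using N by simp
    have form: "0 \<le> (\<Sum>p<R. \<Sum>q<R. ((if p mod N = q mod N then 1 else 0) - dot N (w p) (w q))
        / (1 - a p * cnj (a q)) * c q * cnj (c p))" for c
    proof -
      have "(\<Sum>p<R. \<Sum>q<R. ((if p mod N = q mod N then 1 else 0) - dot N (w p) (w q))
        / (1 - a p * cnj (a q)) * c q * cnj (c p)) =
        (\<Sum>p<R. \<Sum>q<R. ((if p mod N = q mod N then s (z (p div N)) (z (q div N)) else 0) -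
          s (z (p div N)) (z (q div N)) *
          (\<Sum>j<N. W (p div N) $$ (p mod N, j) * cnj (W (q div N) $$ (q mod N, j)))) * c q * cnj (c p))"
        by (intro sum.cong refl arg_cong2[where f = "(*)"])
          (auto simp: s_def a_def w_def dot_def diff_divide_distrib)
      then show ?thesis using psd W unfolding R_def by (simp add: psd_pick_matrix_iff)
    qed
    obtain M T \<phi> g \<rho> where
      interp: "\<forall>p<R. \<forall>j<N. \<phi> (a p) (p mod N) j = w p j" and
      ident: "\<forall>\<zeta> \<eta> b b'. cmod \<zeta> < 1 \<longrightarrow> cmod \<eta> < 1 \<longrightarrow> b < N \<longrightarrow> b' < N \<longrightarrow>
      (if b = b' then 1 else 0) - dot N (\<phi> \<zeta> b) (\<phi> \<eta> b')
      = (1 - \<zeta> * cnj \<eta>) * dot M (g \<zeta> b) (g \<eta> b') + dot T (\<rho> \<zeta> b) (\<rho> \<eta> b')"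
      by (rule realization[OF a m form])
    define \<Phi> where "\<Phi> = (\<lambda>x. mat N N (\<lambda>(b, j). \<phi> (\<zeta> x) b j))"
    have \<Phi>: "\<Phi> x \<in> carrier_mat N N" for x by (simp add: \<Phi>_def)
    have "\<Phi> (z i) = W i" if i: "i < n" for i
    proof (rule eq_matI)
      fix b j assume "b < dim_row (W i)" "j < dim_col (W i)"
      then have b: "b < N" and j: "j < N" using W i by auto
      have "i * N + b < R"
      proof -
        have "i * N + b < (i + 1) * N" using b by simp
        also have "\<dots> \<le> n * N" using i by (intro mult_le_mono1) simp
        finally show ?thesis by (simp add: R_def)
      qed
      then have "\<phi> (a (i * N + b)) ((i * N + b) mod N) j = w (i * N + b) j"
        using interp j by blast
      then have "\<phi> (\<zeta> (z i)) b j = W i $$ (b, j)"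
        using b j by (simp add: a_def w_def)
      then show "\<Phi> (z i) $$ (b, j) = W i $$ (b, j)" using b j by (simp add: \<Phi>_def)
    qed (use W i in \<open>auto simp: \<Phi>_def\<close>)
    moreover have pd: "0 \<le> Re (\<Sum>p\<in>S. \<Sum>q\<in>S. (amplify_kernel s p q - s (fst p) (fst q) *
        (\<Sum>j<N. \<Phi> (fst p) $$ (snd p, j) * cnj (\<Phi> (fst q) $$ (snd q, j)))) * c q * cnj (c p))"
      if S: "finite S" "S \<subseteq> X \<times> {..<N}" for S c
    proof -
      let ?g = "\<lambda>p. g (\<zeta> (fst p)) (snd p)" and ?\<rho> = "\<lambda>p. \<rho> (\<zeta> (fst p)) (snd p)"
      have e: "amplify_kernel s p q - s (fst p) (fst q) *
        (\<Sum>j<N. \<Phi> (fst p) $$ (snd p, j) * cnj (\<Phi> (fst q) $$ (snd q, j)))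
        = (\<Sum>t<M. ?g p t * cnj (?g q t)) + (\<Sum>t<T. s (fst p) (fst q) * (?\<rho> p t * cnj (?\<rho> q t)))"
        if "p \<in> S" "q \<in> S" for p q
      proof -
        have X: "fst p \<in> X" "fst q \<in> X" "snd p < N" "snd q < N" using that S by auto
        have "1 - \<zeta> (fst p) * cnj (\<zeta> (fst q)) \<noteq> 0"
          using cmod_mult_less_1[OF \<zeta>[OF X(1)] \<zeta>[OF X(2)]] by auto
        then have s1: "s (fst p) (fst q) * ((1 - \<zeta> (fst p) * cnj (\<zeta> (fst q))) * u) = u" for u
          by (simp add: s_def)
        have "amplify_kernel s p q - s (fst p) (fst q) *
            (\<Sum>j<N. \<Phi> (fst p) $$ (snd p, j) * cnj (\<Phi> (fst q) $$ (snd q, j)))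
          = s (fst p) (fst q) * ((if snd p = snd q then 1 else 0) - dot N (\<phi> (\<zeta> (fst p)) (snd p)) (\<phi> (\<zeta> (fst q)) (snd q)))"
          using X by (simp add: amplify_kernel_def \<Phi>_def dot_def right_diff_distrib)
        also have "\<dots> = dot M (?g p) (?g q) + s (fst p) (fst q) * dot T (?\<rho> p) (?\<rho> q)"
          unfolding ident[rule_format, OF \<zeta>[OF X(1)] \<zeta>[OF X(2)] X(3) X(4)] distrib_left s1 ..
        finally show ?thesis by (simp add: dot_def sum_distrib_left)
      qed
      have 1: "0 \<le> (\<Sum>p\<in>S. \<Sum>q\<in>S. ?g p t * cnj (?g q t) * c q * cnj (c p))" for t
        unfolding rank_one_form by (simp add: nonneg_complex_iff del: of_real_power)
      have 2: "0 \<le> (\<Sum>p\<in>S. \<Sum>q\<in>S. s (fst p) (fst q) * (?\<rho> p t * cnj (?\<rho> q t)) * c q * cnj (c p))" for t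
      proof (rule form_nonneg_sums[of _ "\<lambda>n p. \<zeta> (fst p) ^ n * ?\<rho> p t"])
        fix p q assume "p \<in> S" "q \<in> S"
        then have "cmod (\<zeta> (fst p)) < 1" "cmod (\<zeta> (fst q)) < 1" using S by (auto intro!: \<zeta>)
        from sums_mult2[OF szego_sums[OF this], of "?\<rho> p t * cnj (?\<rho> q t)"]
        show "(\<lambda>n. \<zeta> (fst p) ^ n * ?\<rho> p t * cnj (\<zeta> (fst q) ^ n * ?\<rho> q t)) sums (s (fst p) (fst q) * (?\<rho> p t * cnj (?\<rho> q t)))"
          by (simp add: s_def mult_ac)
      qed
      have "(\<Sum>p\<in>S. \<Sum>q\<in>S. (amplify_kernel s p q - s (fst p) (fst q) *
          (\<Sum>j<N. \<Phi> (fst p) $$ (snd p, j) * cnj (\<Phi> (fst q) $$ (snd q, j)))) * c q * cnj (c p))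
        = (\<Sum>p\<in>S. \<Sum>q\<in>S. (\<Sum>t<M. ?g p t * cnj (?g q t) * c q * cnj (c p))
          + (\<Sum>t<T. s (fst p) (fst q) * (?\<rho> p t * cnj (?\<rho> q t)) * c q * cnj (c p)))"
        by (intro sum.cong refl) (simp add: e distrib_right sum_distrib_right)
      also have "\<dots> = (\<Sum>t<M. \<Sum>p\<in>S. \<Sum>q\<in>S. ?g p t * cnj (?g q t) * c q * cnj (c p))
          + (\<Sum>t<T. \<Sum>p\<in>S. \<Sum>q\<in>S. s (fst p) (fst q) * (?\<rho> p t * cnj (?\<rho> q t)) * c q * cnj (c p))"
        unfolding sum.distrib sum.swap[of _ S "{..<M}"] sum.swap[of _ S "{..<T}"] ..
      also have "0 \<le> \<dots>" by (intro add_nonneg_nonneg sum_nonneg 1 2)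
      finally show ?thesis by (simp only: nonneg_complex_iff)
    qed
    ultimately show "\<exists>\<Phi>\<in>Mult N X H G. mult_norm N X H ipH ipG \<Phi> \<le> 1 \<and> (\<forall>i<n. \<Phi> (z i) = W i)"
      using contractive_multiplierI[OF rkH rkG \<Phi> pd] by (intro bexI[of _ \<Phi>] conjI allI impI) simp_all
  qed
qed

section \<open>Power series spaces\<close>

text \<open>Square-summable sequences, the model from which the spaces of the diagonal kernels are
  obtained.\<close>
definition ell2 :: "(nat \<Rightarrow> complex) set" where
  "ell2 = {a. summable (\<lambda>n. (cmod (a n))\<^sup>2)}"

definition ell2_ip :: "(nat \<Rightarrow> complex) \<Rightarrow> (nat \<Rightarrow> complex) \<Rightarrow> complex" where
  "ell2_ip a b = (\<Sum>n. a n * cnj (b n))"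

lemma ell2_summable:
  assumes "a \<in> ell2" "b \<in> ell2"
  shows "summable (\<lambda>n. a n * cnj (b n))"
proof (rule summable_comparison_test')
  show "summable (\<lambda>n. (cmod (a n))\<^sup>2 + (cmod (b n))\<^sup>2)"
    using assms by (intro summable_add) (auto simp: ell2_def)
  fix n
  have "cmod (a n) * cmod (b n) \<le> (cmod (a n))\<^sup>2 + (cmod (b n))\<^sup>2"
    using sum_squares_bound[of "cmod (a n)" "cmod (b n)"]
      mult_nonneg_nonneg[OF norm_ge_zero[of "a n"] norm_ge_zero[of "b n"]] by linarith
  then show "norm (a n * cnj (b n)) \<le> (cmod (a n))\<^sup>2 + (cmod (b n))\<^sup>2"
    by (simp add: norm_mult)
qed

lemma ell2_add: assumes "a \<in> ell2" "b \<in> ell2" shows "(\<lambda>n. a n + b n) \<in> ell2"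
  unfolding ell2_def mem_Collect_eq
proof (rule summable_comparison_test')
  show "summable (\<lambda>n. 2 * (cmod (a n))\<^sup>2 + 2 * (cmod (b n))\<^sup>2)"
    using assms by (intro summable_add summable_mult) (auto simp: ell2_def)
  fix n
  have "(cmod (a n + b n))\<^sup>2 \<le> (cmod (a n) + cmod (b n))\<^sup>2"
    by (intro power_mono norm_triangle_ineq) simp
  also have "\<dots> \<le> 2 * (cmod (a n))\<^sup>2 + 2 * (cmod (b n))\<^sup>2"
    using sum_squares_bound[of "cmod (a n)" "cmod (b n)"] by (simp add: power2_sum)
  finally show "norm ((cmod (a n + b n))\<^sup>2) \<le> 2 * (cmod (a n))\<^sup>2 + 2 * (cmod (b n))\<^sup>2" by simp
qed

lemma ell2_scale: "a \<in> ell2 \<Longrightarrow> (\<lambda>n. c * a n) \<in> ell2"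
  by (auto simp: ell2_def norm_mult power_mult_distrib intro: summable_mult)

lemma ell2_ip_self: "a \<in> ell2 \<Longrightarrow> ell2_ip a a = of_real (\<Sum>n. (cmod (a n))\<^sup>2)"
  unfolding ell2_ip_def cnj_mult_self by (rule suminf_of_real[symmetric]) (simp add: ell2_def)

lemma ell2_semi_inner: "semi_inner ell2 ell2_ip"
proof
  show "(\<lambda>n. 0) \<in> ell2" by (simp add: ell2_def)
  fix f g h c
  assume f: "f \<in> ell2" and g: "g \<in> ell2" and h: "h \<in> ell2"
  show "ell2_ip (\<lambda>x. f x + g x) h = ell2_ip f h + ell2_ip g h"
    unfolding ell2_ip_def using f g h by (simp add: suminf_add ell2_summable distrib_right)
next
  fix f h c assume "f \<in> ell2" "h \<in> ell2"
  then show "ell2_ip (\<lambda>x. c * f x) h = c * ell2_ip f h"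
    unfolding ell2_ip_def by (simp add: suminf_mult ell2_summable mult.assoc)
next
  fix f g assume "f \<in> ell2" "g \<in> ell2"
  then have "cnj (\<Sum>n. f n * cnj (g n)) = (\<Sum>n. cnj (f n * cnj (g n)))"
    by (intro bounded_linear.suminf[OF bounded_linear_cnj] ell2_summable)
  then show "ell2_ip g f = cnj (ell2_ip f g)" by (simp add: ell2_ip_def mult.commute)
next
  fix f assume f: "f \<in> ell2"
  then have "0 \<le> (\<Sum>n. (cmod (f n))\<^sup>2)" by (intro suminf_nonneg) (auto simp: ell2_def)
  then show "0 \<le> ell2_ip f f" by (simp add: ell2_ip_self[OF f] nonneg_complex_iff)
qed (auto intro: ell2_add ell2_scale)

lemma ell2_hnorm: "a \<in> ell2 \<Longrightarrow> (hnorm ell2_ip a)\<^sup>2 = (\<Sum>n. (cmod (a n))\<^sup>2)"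
  by (simp add: semi_inner.hnorm_sq[OF ell2_semi_inner] ell2_ip_self)

lemma ell2_partial_le: "a \<in> ell2 \<Longrightarrow> (\<Sum>n<K. (cmod (a n))\<^sup>2) \<le> (hnorm ell2_ip a)\<^sup>2"
  unfolding ell2_hnorm by (intro sum_le_suminf) (auto simp: ell2_def)

lemma ell2_boundedI:
  assumes "\<And>K. (\<Sum>n<K. (cmod (a n))\<^sup>2) \<le> B\<^sup>2" "0 \<le> B"
  shows "a \<in> ell2" and "hnorm ell2_ip a \<le> B"
proof -
  show a: "a \<in> ell2"
    unfolding ell2_def mem_Collect_eq by (rule summableI_nonneg_bounded) (use assms in auto)
  have "(hnorm ell2_ip a)\<^sup>2 \<le> B\<^sup>2"
    unfolding ell2_hnorm[OF a] by (rule suminf_le_const) (use a assms in \<open>auto simp: ell2_def\<close>)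
  then show "hnorm ell2_ip a \<le> B" using \<open>0 \<le> B\<close> by (rule power2_le_imp_le)
qed

lemma ell2_hilbert: "hilbert_function_space UNIV ell2 ell2_ip"
proof -
  interpret semi_inner ell2 ell2_ip by (rule ell2_semi_inner)
  have d: "a = (\<lambda>n. 0)" if a: "a \<in> ell2" and 0: "ell2_ip a a = 0" for a
  proof
    fix n
    have "(hnorm ell2_ip a)\<^sup>2 = 0" by (simp add: hnorm_sq[OF a] 0)
    then have "(\<Sum>n<Suc n. (cmod (a n))\<^sup>2) \<le> 0" using ell2_partial_le[OF a, of "Suc n"] by simp
    moreover have "(cmod (a n))\<^sup>2 \<le> (\<Sum>n<Suc n. (cmod (a n))\<^sup>2)" by (rule member_le_sum) auto
    ultimately have "(cmod (a n))\<^sup>2 \<le> 0" by linarith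
    then show "a n = 0" by simp
  qed
  have c: "\<exists>f\<in>ell2. (\<lambda>n. hnorm ell2_ip (\<lambda>x. F n x - f x)) \<longlonglongrightarrow> 0"
    if F: "\<forall>n. F n \<in> ell2"
      and cau: "\<forall>e>0. \<exists>M::nat. \<forall>m\<ge>M. \<forall>n\<ge>M. hnorm ell2_ip (\<lambda>x. F m x - F n x) < e" for F
  proof -
    have D: "(\<lambda>x. F m x - F n x) \<in> ell2" for m n using F by (intro diff_mem) auto
    have "Cauchy (\<lambda>n. F n k)" for k
    proof (rule metric_CauchyI)
      fix e :: real assume e: "e > 0"
      obtain M :: nat where M: "\<And>m n. M \<le> m \<Longrightarrow> M \<le> n \<Longrightarrow> hnorm ell2_ip (\<lambda>x. F m x - F n x) < e"
        using cau e by blast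
      have "dist (F m k) (F n k) < e" if "M \<le> m" "M \<le> n" for m n
      proof -
        have "(cmod (F m k - F n k))\<^sup>2 \<le> (\<Sum>k<Suc k. (cmod (F m k - F n k))\<^sup>2)"
          by (rule member_le_sum) auto
        also have "\<dots> \<le> (hnorm ell2_ip (\<lambda>x. F m x - F n x))\<^sup>2" by (rule ell2_partial_le[OF D])
        finally have "cmod (F m k - F n k) \<le> hnorm ell2_ip (\<lambda>x. F m x - F n x)"
          using hnorm_nonneg[OF D] by (rule power2_le_imp_le)
        then show ?thesis using M[OF that] by (simp add: dist_norm)
      qed
      then show "\<exists>M. \<forall>m\<ge>M. \<forall>n\<ge>M. dist (F m k) (F n k) < e" by blast
    qed
    define f where "f = (\<lambda>k. lim (\<lambda>n. F n k))"
    have lim: "(\<lambda>n. F n k) \<longlonglongrightarrow> f k" for k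
      unfolding f_def using \<open>\<And>k. Cauchy (\<lambda>n. F n k)\<close> by (simp add: Cauchy_convergent convergent_LIMSEQ_iff[symmetric])
    \<comment> \<open>Partial sums pass to the limit \<open>n \<rightarrow> \<infinity>\<close> before the length \<open>K\<close> does.\<close>
    have near: "(\<lambda>k. F m k - f k) \<in> ell2 \<and> hnorm ell2_ip (\<lambda>k. F m k - f k) \<le> e"
      if M: "\<And>m n. M \<le> m \<Longrightarrow> M \<le> n \<Longrightarrow> hnorm ell2_ip (\<lambda>x. F m x - F n x) < e" and m: "M \<le> m" and e: "e > 0"
      for e and M m :: nat
    proof -
      have "(\<Sum>k<K. (cmod (F m k - f k))\<^sup>2) \<le> e\<^sup>2" for K
      proof (rule LIMSEQ_le_const2)
        show "(\<lambda>n. \<Sum>k<K. (cmod (F m k - F n k))\<^sup>2) \<longlonglongrightarrow> (\<Sum>k<K. (cmod (F m k - f k))\<^sup>2)"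
          by (intro tendsto_intros lim)
        have "(\<Sum>k<K. (cmod (F m k - F n k))\<^sup>2) \<le> e\<^sup>2" if "M \<le> n" for n
        proof -
          have "(\<Sum>k<K. (cmod (F m k - F n k))\<^sup>2) \<le> (hnorm ell2_ip (\<lambda>x. F m x - F n x))\<^sup>2"
            by (rule ell2_partial_le[OF D])
          also have "\<dots> \<le> e\<^sup>2"
            using M[OF m that] hnorm_nonneg[OF D, of m n] by (intro power_mono) auto
          finally show ?thesis .
        qed
        then show "\<exists>N. \<forall>n\<ge>N. (\<Sum>k<K. (cmod (F m k - F n k))\<^sup>2) \<le> e\<^sup>2" by blast
      qed
      then show ?thesis using ell2_boundedI[of "\<lambda>k. F m k - f k" e] e by simp
    qed
    have one: "(0::real) < 1" by simp
    obtain M :: nat where M: "\<forall>m\<ge>M. \<forall>n\<ge>M. hnorm ell2_ip (\<lambda>x. F m x - F n x) < 1"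
      using cau[rule_format, OF one] by (elim exE)
    from near[OF M[rule_format] order_refl one] have "(\<lambda>k. F M k - f k) \<in> ell2" by blast
    then have "(\<lambda>k. F M k - (F M k - f k)) \<in> ell2" by (rule diff_mem[OF F[rule_format]])
    then have f: "f \<in> ell2" by simp
    have "(\<lambda>n. hnorm ell2_ip (\<lambda>x. F n x - f x)) \<longlonglongrightarrow> 0"
    proof (rule LIMSEQ_I)
      fix e :: real assume e: "e > 0"
      have "e / 2 > 0" using e by simp
      obtain M :: nat where M: "\<forall>m\<ge>M. \<forall>n\<ge>M. hnorm ell2_ip (\<lambda>x. F m x - F n x) < e / 2"
        using cau[rule_format, OF \<open>e / 2 > 0\<close>] by (elim exE)
      have "norm (hnorm ell2_ip (\<lambda>x. F n x - f x) - 0) < e" if "M \<le> n" for n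
      proof -
        have "hnorm ell2_ip (\<lambda>x. F n x - f x) \<le> e / 2" "(\<lambda>x. F n x - f x) \<in> ell2"
          using near[OF M[rule_format] that \<open>e / 2 > 0\<close>] by auto
        then show ?thesis using hnorm_nonneg e by auto
      qed
      then show "\<exists>no. \<forall>n\<ge>no. norm (hnorm ell2_ip (\<lambda>x. F n x - f x) - 0) < e" by blast
    qed
    with f show ?thesis by (intro bexI[of _ f])
  qed
  show ?thesis
    by (rule hilbertI[OF ell2_semi_inner]) (assumption | rule d c | simp)+
qed

text \<open>The space consists of the functions \<open>\<Sum> a\<^sub>n u\<^sub>n\<close> with square-summable \<open>a\<close>. Independence of the
  \<open>u\<^sub>n\<close> makes the coefficients unique, and the inner product is transported along this bijection.\<close>
lemma rkhs_of_feature_map: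
  assumes u: "\<And>x. x \<in> X \<Longrightarrow> (\<lambda>n. cnj (u n x)) \<in> ell2"
    and indep: "\<And>a. a \<in> ell2 \<Longrightarrow> (\<And>x. x \<in> X \<Longrightarrow> (\<Sum>n. a n * u n x) = 0) \<Longrightarrow> a = (\<lambda>n. 0)"
    and K: "\<And>x y. x \<in> X \<Longrightarrow> y \<in> X \<Longrightarrow> K x y = (\<Sum>n. u n x * cnj (u n y))"
  shows "\<exists>H ip. is_rkhs X K H ip"
proof -
  interpret semi_inner ell2 ell2_ip by (rule ell2_semi_inner)
  define \<tau> where "\<tau> = (\<lambda>a x. if x \<in> X then ell2_ip a (\<lambda>n. cnj (u n x)) else 0)"
  define H where "H = \<tau> ` ell2"
  define \<sigma> where "\<sigma> = inv_into ell2 \<tau>"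
  define ip where "ip = (\<lambda>f g. ell2_ip (\<sigma> f) (\<sigma> g))"
  have \<tau>_add: "\<tau> (\<lambda>n. a n + b n) = (\<lambda>x. \<tau> a x + \<tau> b x)" if "a \<in> ell2" "b \<in> ell2" for a b
    using that by (auto simp: \<tau>_def ip_add u)
  have \<tau>_scale: "\<tau> (\<lambda>n. c * a n) = (\<lambda>x. c * \<tau> a x)" if "a \<in> ell2" for a c
    using that by (auto simp: \<tau>_def ip_scale u)
  have \<tau>_diff: "\<tau> (\<lambda>n. a n - b n) = (\<lambda>x. \<tau> a x - \<tau> b x)" if "a \<in> ell2" "b \<in> ell2" for a b
    using that by (auto simp: \<tau>_def ip_diff u)
  have inj: "inj_on \<tau> ell2"
  proof (rule inj_onI)
    fix a b assume a: "a \<in> ell2" and b: "b \<in> ell2" and ab: "\<tau> a = \<tau> b"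
    have "(\<lambda>n. a n - b n) = (\<lambda>n. 0)"
    proof (rule indep[OF diff_mem[OF a b]])
      fix x assume "x \<in> X"
      moreover have "\<tau> (\<lambda>n. a n - b n) x = 0" using fun_cong[OF \<tau>_diff[OF a b], of x] ab by simp
      ultimately show "(\<Sum>n. (a n - b n) * u n x) = 0" by (simp add: \<tau>_def ell2_ip_def)
    qed
    then show "a = b" by (simp add: fun_eq_iff)
  qed
  have \<sigma>: "\<sigma> (\<tau> a) = a" if "a \<in> ell2" for a unfolding \<sigma>_def using inj that by (rule inv_into_f_f)
  have ip: "ip (\<tau> a) (\<tau> b) = ell2_ip a b" if "a \<in> ell2" "b \<in> ell2" for a b
    using that by (simp add: ip_def \<sigma>)
  have hn: "hnorm ip (\<tau> a) = hnorm ell2_ip a" if "a \<in> ell2" for a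
    using that by (simp add: hnorm_def ip)
  have si: "semi_inner H ip"
  proof
    show "(\<lambda>x. 0) \<in> H"
      using \<tau>_scale[OF zero_mem, of 0] zero_mem unfolding H_def by (intro image_eqI[of _ _ "\<lambda>n. 0"]) simp_all
  next
    fix f g assume "f \<in> H" "g \<in> H"
    then obtain a b where [simp]: "f = \<tau> a" "g = \<tau> b" "a \<in> ell2" "b \<in> ell2" by (auto simp: H_def)
    show "(\<lambda>x. f x + g x) \<in> H"
      unfolding H_def by (rule image_eqI[of _ _ "\<lambda>n. a n + b n"]) (simp_all add: \<tau>_add add_mem)
    show "ip g f = cnj (ip f g)" by (simp add: ip) (rule ip_cnj; simp)
    fix h assume "h \<in> H"
    then obtain c where [simp]: "h = \<tau> c" "c \<in> ell2" by (auto simp: H_def)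
    show "ip (\<lambda>x. f x + g x) h = ip f h + ip g h"
      by (simp add: \<tau>_add[symmetric] ip add_mem ip_add)
  next
    fix f c assume "f \<in> H"
    then obtain a where [simp]: "f = \<tau> a" "a \<in> ell2" by (auto simp: H_def)
    show "(\<lambda>x. c * f x) \<in> H"
      unfolding H_def by (rule image_eqI[of _ _ "\<lambda>n. c * a n"]) (simp_all add: \<tau>_scale scale_mem)
    show "0 \<le> ip f f" by (simp add: ip ip_nonneg)
    fix h assume "h \<in> H"
    then obtain b where [simp]: "h = \<tau> b" "b \<in> ell2" by (auto simp: H_def)
    show "ip (\<lambda>x. c * f x) h = c * ip f h"
      by (simp add: \<tau>_scale[symmetric] ip scale_mem ip_scale)
  qed
  have \<tau>0: "\<tau> (\<lambda>n. 0) = (\<lambda>x. 0)" using \<tau>_scale[OF zero_mem, of 0] by simp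
  have d: "f = (\<lambda>x. 0)" if f: "f \<in> H" "ip f f = 0" for f
  proof -
    obtain a where a: "f = \<tau> a" "a \<in> ell2" using f(1) by (auto simp: H_def)
    then have "ell2_ip a a = 0" using f(2) by (simp add: ip)
    then have "a = (\<lambda>n. 0)" using ell2_hilbert a unfolding hilbert_function_space_def by blast
    then show ?thesis using a \<tau>0 by simp
  qed
  have c: "\<exists>f\<in>H. (\<lambda>n. hnorm ip (\<lambda>x. F n x - f x)) \<longlonglongrightarrow> 0"
    if F: "\<forall>n. F n \<in> H"
      and cau: "\<forall>e>0. \<exists>M::nat. \<forall>m\<ge>M. \<forall>n\<ge>M. hnorm ip (\<lambda>x. F m x - F n x) < e" for F
  proof -
    define A where "A = (\<lambda>n. \<sigma> (F n))"
    have A: "A n \<in> ell2" and FA: "F n = \<tau> (A n)" for n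
      using F unfolding A_def \<sigma>_def H_def by (simp_all add: inv_into_into f_inv_into_f)
    have "hnorm ip (\<lambda>x. F m x - F n x) = hnorm ell2_ip (\<lambda>k. A m k - A n k)" for m n
      unfolding FA \<tau>_diff[OF A A, symmetric] by (rule hn[OF diff_mem[OF A A]])
    then have "\<And>e. e > 0 \<Longrightarrow> \<exists>M::nat. \<forall>m\<ge>M. \<forall>n\<ge>M. hnorm ell2_ip (\<lambda>k. A m k - A n k) < e"
      using cau by simp
    then obtain a where a: "a \<in> ell2" "(\<lambda>n. hnorm ell2_ip (\<lambda>k. A n k - a k)) \<longlonglongrightarrow> 0"
      by (rule hilbert_complete[OF ell2_hilbert, of A, OF A])
    have "hnorm ip (\<lambda>x. F n x - \<tau> a x) = hnorm ell2_ip (\<lambda>k. A n k - a k)" for n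
      unfolding FA \<tau>_diff[OF A a(1), symmetric] by (rule hn[OF diff_mem[OF A a(1)]])
    then have "(\<lambda>n. hnorm ip (\<lambda>x. F n x - \<tau> a x)) \<longlonglongrightarrow> 0" using a(2) by simp
    moreover have "\<tau> a \<in> H" using a(1) by (simp add: H_def)
    ultimately show ?thesis by (intro bexI[of _ "\<tau> a"])
  qed
  have "f x = 0" if "f \<in> H" "x \<notin> X" for f x using that by (auto simp: H_def \<tau>_def)
  then have hil: "hilbert_function_space X H ip"
    by (intro hilbertI[OF si]) (assumption | rule d c)+
  have "is_rkhs X K H ip"
    unfolding is_rkhs_def
  proof (intro conjI hil ballI)
    fix w assume w: "w \<in> X"
    have e: "(\<lambda>z. if z \<in> X then K z w else 0) = \<tau> (\<lambda>n. cnj (u n w))"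
      using w by (auto simp: \<tau>_def ell2_ip_def K mult.commute)
    then show "(\<lambda>z. if z \<in> X then K z w else 0) \<in> H" using u[OF w] by (simp add: H_def)
    fix f assume "f \<in> H"
    then obtain a where "f = \<tau> a" "a \<in> ell2" by (auto simp: H_def)
    then show "ip f (\<lambda>z. if z \<in> X then K z w else 0) = f w"
      unfolding e using u[OF w] w by (simp add: ip) (simp add: \<tau>_def)
  qed
  then show ?thesis by blast
qed

text \<open>The origin is excluded so that the hypothesis survives division by \<open>x\<close> in the induction; the
  constant coefficient is the limit at the origin.\<close>
lemma powser_coefficients_zero:
  fixes a :: "nat \<Rightarrow> complex"
  assumes r: "0 < r" and "\<And>x. x \<noteq> 0 \<Longrightarrow> norm x < r \<Longrightarrow> (\<lambda>n. a n * x ^ n) sums 0"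
  shows "a n = 0"
  using assms(2)
proof (induction n arbitrary: a)
  case 0
  have "((\<lambda>x::complex. 0) \<longlongrightarrow> a 0) (at 0)" by (rule powser_limit_0_strong[OF r 0])
  then show ?case by (metis LIM_unique tendsto_const trivial_limit_at)
next
  case (Suc n)
  have "((\<lambda>x::complex. 0) \<longlongrightarrow> a 0) (at 0)" by (rule powser_limit_0_strong[OF r Suc.prems])
  then have a0: "a 0 = 0" by (metis LIM_unique tendsto_const trivial_limit_at)
  have "(\<lambda>n. a (Suc n) * x ^ n) sums 0" if x: "x \<noteq> 0" "norm x < r" for x
  proof -
    have s: "(\<lambda>n. a (Suc n) * x ^ Suc n) sums 0"
      using Suc.prems[OF x] a0 by (subst sums_Suc_iff) simp
    have e: "(\<lambda>n. inverse x * (a (Suc n) * x ^ Suc n)) = (\<lambda>n. a (Suc n) * x ^ n)"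
      using x by (auto simp: field_simps)
    show ?thesis using sums_mult[OF s, of "inverse x"] unfolding e mult_zero_right .
  qed
  then show ?case by (rule Suc.IH)
qed

section \<open>Diagonal kernels on the disc\<close>

definition disc_point :: "complex \<Rightarrow> nat \<Rightarrow> complex" where
  "disc_point t = (\<lambda>i. if i = 0 then t else 0)"

lemma disc_point_mem: "disc_point t \<in> polydisc 1 1 \<longleftrightarrow> cmod t < 1"
  by (auto simp: disc_point_def polydisc_def Cspace_def)

lemma polydisc_1: "polydisc 1 r = disc_point ` ball 0 r"
proof (intro equalityI subsetI)
  fix z assume z: "z \<in> polydisc 1 r"
  then have "z = disc_point (z 0)" by (auto simp: disc_point_def polydisc_def Cspace_def)
  then show "z \<in> disc_point ` ball 0 r" using z by (auto simp: polydisc_def intro!: image_eqI[of _ _ "z 0"])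
qed (auto simp: disc_point_def polydisc_def Cspace_def)

lemma polydisc_bound: "z \<in> polydisc 1 r \<Longrightarrow> cmod (z 0) < r"
  by (simp add: polydisc_def)

lemma domain_polydisc_1: "domain_in 1 (polydisc 1 1)"
  unfolding domain_in_def
proof (intro conjI)
  have "open {z :: nat \<Rightarrow> complex. cmod (z 0) < 1}"
    by (intro open_Collect_less continuous_intros continuous_on_product_coordinates)
  moreover have "polydisc 1 1 = Cspace 1 \<inter> {z. cmod (z 0) < 1}" by (auto simp: polydisc_def)
  ultimately show "openin (top_of_set (Cspace 1)) (polydisc 1 1)"
    by (auto simp: openin_open)
  have "continuous_on (ball 0 1) disc_point"
  proof (rule continuous_on_coordinatewise_then_product)
    fix i show "continuous_on (ball 0 1) (\<lambda>t. disc_point t i)"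
      by (cases "i = 0") (simp_all add: disc_point_def)
  qed
  then show "connected (polydisc 1 1)"
    unfolding polydisc_1 by (rule connected_continuous_image) simp
  show "polydisc 1 1 \<noteq> {}" unfolding polydisc_1 by simp
qed

lemma holomorphic_several_cong:
  assumes "holomorphic_several d f \<Omega>" and fg: "\<And>z. z \<in> \<Omega> \<Longrightarrow> g z = f z"
  shows "holomorphic_several d g \<Omega>"
proof -
  have "(\<lambda>t. g (z(i := t))) holomorphic_on {t. z(i := t) \<in> \<Omega>} \<longleftrightarrow>
      (\<lambda>t. f (z(i := t))) holomorphic_on {t. z(i := t) \<in> \<Omega>}" for z i
    by (intro holomorphic_cong refl fg) simp
  moreover have "continuous_on \<Omega> g \<longleftrightarrow> continuous_on \<Omega> f"
    by (intro continuous_on_cong refl fg)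
  ultimately show ?thesis using assms(1) unfolding holomorphic_several_def by blast
qed

lemma holomorphic_several_slice:
  assumes F: "F holomorphic_on ball 0 1" and c: "cmod c < 1"
  shows "holomorphic_several 1 (\<lambda>z. F (z 0 * c)) (polydisc 1 1)"
proof -
  have b: "t * c \<in> ball 0 1" if "cmod t < 1" for t
  proof -
    have "cmod t * cmod c < 1 * 1" using that c by (intro mult_strict_mono') auto
    then show ?thesis by (simp add: norm_mult)
  qed
  show ?thesis
    unfolding holomorphic_several_def
  proof (intro conjI ballI allI impI)
    show "continuous_on (polydisc 1 1) (\<lambda>z. F (z 0 * c))"
      by (rule continuous_on_compose2[OF holomorphic_on_imp_continuous_on[OF F]])
        (auto intro!: continuous_intros continuous_on_subset[OF continuous_on_product_coordinates] b dest: polydisc_bound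
          simp del: mem_ball One_nat_def)
    fix z and i :: nat assume "z \<in> polydisc 1 1" and "i < 1"
    then have i: "i = 0" by simp
    have "(\<lambda>t. F (t * c)) holomorphic_on {t. z(i := t) \<in> polydisc 1 1}"
      by (rule holomorphic_on_compose_gen[OF _ F, of "\<lambda>t. t * c", unfolded o_def])
        (auto intro!: holomorphic_intros b dest: polydisc_bound simp: i simp del: mem_ball One_nat_def)
    then show "(\<lambda>t. F ((z(i := t)) 0 * c)) holomorphic_on {t. z(i := t) \<in> polydisc 1 1}" by (simp add: i)
  qed
qed

lemma power_series_summable:
  fixes \<kappa> :: "nat \<Rightarrow> real"
  assumes "\<And>x. cmod x < 1 \<Longrightarrow> (\<lambda>n. of_real (\<kappa> n) * x ^ n) sums F x" "0 \<le> r" "r < 1"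
  shows "summable (\<lambda>n. \<kappa> n * r ^ n)"
proof -
  have "(\<lambda>n. Re (of_real (\<kappa> n) * of_real r ^ n)) sums Re (F (of_real r))"
    using assms by (intro sums_Re assms(1)) simp
  then show ?thesis unfolding of_real_power[symmetric] of_real_mult[symmetric] Re_complex_of_real by (rule sums_summable)
qed

text \<open>The feature map is \<open>u\<^sub>n(z) = sqrt \<kappa>\<^sub>n z\<^sup>n\<close>. Holomorphy in the second variable reduces to the first
  because the coefficients are real.\<close>
lemma diagonal_power_series_kernel:
  fixes \<kappa> :: "nat \<Rightarrow> real"
  assumes \<kappa>: "\<And>n. 0 < \<kappa> n"
    and F: "\<And>x. cmod x < 1 \<Longrightarrow> (\<lambda>n. of_real (\<kappa> n) * x ^ n) sums F x"
    and hol: "F holomorphic_on ball 0 1"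
  shows "diagonal_holomorphic_kernel 1 (polydisc 1 1) (\<lambda>z w. F (z 0 * cnj (w 0)))"
    and "\<exists>H ip. is_rkhs (polydisc 1 1) (\<lambda>z w. F (z 0 * cnj (w 0))) H ip"
proof -
  let ?D = "polydisc 1 1"
  define u where "u = (\<lambda>n (z :: nat \<Rightarrow> complex). of_real (sqrt (\<kappa> n)) * z 0 ^ n)"
  have uu: "u n z * cnj (u n w) = of_real (\<kappa> n) * (z 0 * cnj (w 0)) ^ n" for n z w
  proof -
    have "complex_of_real (sqrt (\<kappa> n)) * of_real (sqrt (\<kappa> n)) = of_real (\<kappa> n)"
      unfolding of_real_mult[symmetric] using \<kappa>[of n] by simp
    then show ?thesis by (simp add: u_def power_mult_distrib mult_ac)
  qed
  have S: "(\<lambda>n. u n z * cnj (u n w)) sums F (z 0 * cnj (w 0))" if "z \<in> ?D" "w \<in> ?D" for z w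
    unfolding uu by (intro F cmod_mult_less_1 polydisc_bound that)
  have conj: "cnj (F (z 0 * cnj (w 0))) = F (w 0 * cnj (z 0))" if "z \<in> ?D" "w \<in> ?D" for z w
  proof -
    have "(\<lambda>n. cnj (u n z * cnj (u n w))) sums cnj (F (z 0 * cnj (w 0)))"
      using S[OF that] by (simp only: sums_cnj)
    then have "(\<lambda>n. u n w * cnj (u n z)) sums cnj (F (z 0 * cnj (w 0)))" by (simp add: mult.commute)
    then show ?thesis using S[OF that(2,1)] by (rule sums_unique2)
  qed
  have ne: "?D \<noteq> {}" unfolding polydisc_1 by simp
  show "diagonal_holomorphic_kernel 1 ?D (\<lambda>z w. F (z 0 * cnj (w 0)))"
    unfolding diagonal_holomorphic_kernel_def
  proof (intro conjI ballI)
    show "domain_in 1 ?D" by (rule domain_polydisc_1)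
    show "(\<lambda>i. 0) \<in> ?D" by (simp add: polydisc_def Cspace_def)
    show "is_kernel ?D (\<lambda>z w. F (z 0 * cnj (w 0)))" using ne S by (rule is_kernelI_sums)
  next
    fix w assume "w \<in> ?D"
    then show "holomorphic_several 1 (\<lambda>z. F (z 0 * cnj (w 0))) ?D"
      by (intro holomorphic_several_slice[OF hol]) (simp add: polydisc_bound)
  next
    fix z assume z: "z \<in> ?D"
    have "holomorphic_several 1 (\<lambda>w. F (w 0 * cnj (z 0))) ?D"
      using z by (intro holomorphic_several_slice[OF hol]) (simp add: polydisc_bound)
    then show "holomorphic_several 1 (\<lambda>w. cnj (F (z 0 * cnj (w 0)))) ?D"
      by (rule holomorphic_several_cong) (use conj[OF z] in simp)
  next
    show "\<exists>c. (\<forall>a\<in>multi_indices 1. 0 < c a) \<and> (\<exists>r>0. polydisc 1 r \<subseteq> ?D \<and>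
         (\<forall>z\<in>polydisc 1 r. \<forall>w\<in>polydisc 1 r.
             ((\<lambda>a. of_real (c a) * monomial 1 a z * cnj (monomial 1 a w)) has_sum F (z 0 * cnj (w 0))) (multi_indices 1)))"
    proof (intro exI[of _ "\<lambda>a. \<kappa> (a 0)"] conjI ballI exI[of _ 1])
      fix z w assume z: "z \<in> ?D" and w: "w \<in> ?D"
      have "0 \<le> cmod (z 0) * cmod (w 0)" "cmod (z 0) * cmod (w 0) < 1"
        using cmod_mult_less_1[OF polydisc_bound[OF z] polydisc_bound[OF w]] by (auto simp: norm_mult)
      then have "summable (\<lambda>n. \<kappa> n * (cmod (z 0) * cmod (w 0)) ^ n)" by (intro power_series_summable[OF F])
      then have "summable (\<lambda>n. norm (u n z * cnj (u n w)))"
        unfolding uu using \<kappa> by (simp add: norm_mult norm_power less_imp_le)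
      then have hs: "((\<lambda>n. u n z * cnj (u n w)) has_sum F (z 0 * cnj (w 0))) UNIV"
        using S[OF z w] by (rule norm_summable_imp_has_sum)
      show "((\<lambda>a. of_real (\<kappa> (a 0)) * monomial 1 a z * cnj (monomial 1 a w)) has_sum F (z 0 * cnj (w 0))) (multi_indices 1)"
      proof (subst has_sum_reindex_bij_witness[where T = UNIV and j = "\<lambda>a. a 0" and i = "\<lambda>n i. if i = 0 then n else 0"
            and h = "\<lambda>n. u n z * cnj (u n w)" and s' = "F (z 0 * cnj (w 0))"])
        fix a :: "nat \<Rightarrow> nat"
        show "u (a 0) z * cnj (u (a 0) w) = of_real (\<kappa> (a 0)) * monomial 1 a z * cnj (monomial 1 a w)"
          unfolding uu by (simp add: monomial_def power_mult_distrib)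
      qed (use hs in \<open>auto simp: multi_indices_def fun_eq_iff\<close>)
    qed (use \<kappa> in auto)
  qed
  have mem: "(\<lambda>n. cnj (u n z)) \<in> ell2" if z: "z \<in> ?D" for z
  proof -
    have "(cmod (z 0))\<^sup>2 < 1" using polydisc_bound[OF z] by (simp add: power_less_one_iff)
    then have "summable (\<lambda>n. \<kappa> n * ((cmod (z 0))\<^sup>2) ^ n)" by (intro power_series_summable[OF F]) auto
    moreover have "(cmod (cnj (u n z)))\<^sup>2 = \<kappa> n * ((cmod (z 0))\<^sup>2) ^ n" for n
      using \<kappa>[of n] by (simp add: u_def norm_mult norm_power power_mult_distrib power_even_eq[symmetric] power_commutes flip: power_mult)
        (simp add: mult.commute)
    ultimately show ?thesis by (simp add: ell2_def)
  qed
  have indep: "a = (\<lambda>n. 0)" if a: "a \<in> ell2" and 0: "\<And>z. z \<in> ?D \<Longrightarrow> (\<Sum>n. a n * u n z) = 0" for a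
  proof
    fix n
    have "a n * of_real (sqrt (\<kappa> n)) = 0"
    proof (rule powser_coefficients_zero[of 1])
      fix x :: complex assume "norm x < 1"
      then have x: "disc_point x \<in> ?D" by (simp add: disc_point_mem del: One_nat_def)
      have "summable (\<lambda>n. a n * cnj (cnj (u n (disc_point x))))"
        by (intro ell2_summable a mem x)
      then have "(\<lambda>n. a n * u n (disc_point x)) sums 0" using 0[OF x] by (simp add: summable_sums_iff)
      then show "(\<lambda>n. a n * of_real (sqrt (\<kappa> n)) * x ^ n) sums 0"
        by (simp add: u_def disc_point_def mult.assoc)
    qed simp
    then show "a n = 0" using \<kappa>[of n] by simp
  qed
  have sum: "F (z 0 * cnj (w 0)) = (\<Sum>n. u n z * cnj (u n w))" if "z \<in> ?D" "w \<in> ?D" for z w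
    using S[OF that] by (rule sums_unique)
  show "\<exists>H ip. is_rkhs ?D (\<lambda>z w. F (z 0 * cnj (w 0))) H ip"
  proof (rule rkhs_of_feature_map[of ?D u])
    show "(\<lambda>n. cnj (u n z)) \<in> ell2" if "z \<in> ?D" for z using that by (rule mem)
    show "a = (\<lambda>n. 0)" if "a \<in> ell2" "\<And>z. z \<in> ?D \<Longrightarrow> (\<Sum>n. a n * u n z) = 0" for a
      using that by (rule indep)
    show "F (z 0 * cnj (w 0)) = (\<Sum>n. u n z * cnj (u n w))" if "z \<in> ?D" "w \<in> ?D" for z w
      using that by (rule sum)
  qed
qed

section \<open>The three kernels\<close>

definition szego :: "complex \<Rightarrow> complex" where
  "szego x = 1 / (1 - x)"

text \<open>The function \<open>s / h\<close> with \<open>h = 1 / (1 - x\<^sup>2 / 4)\<^sup>2\<close>.\<close>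
definition damped_szego :: "complex \<Rightarrow> complex" where
  "damped_szego x = (1 - x\<^sup>2 / 4)\<^sup>2 / (1 - x)"

lemma szego_powser: "cmod x < 1 \<Longrightarrow> (\<lambda>n. of_real 1 * x ^ n) sums szego x"
  using geometric_sums[of x] by (simp add: szego_def)

lemma szego_holomorphic: "szego holomorphic_on ball 0 1"
  unfolding szego_def by (intro holomorphic_intros) auto

text \<open>The sequence \<open>1, 1, 1/2, 1/2, 9/16, 9/16, ...\<close>, written as a constant sequence plus a finite
  correction, which mirrors how its power series is summed.\<close>
definition damped_szego_coeff :: "nat \<Rightarrow> real" where
  "damped_szego_coeff n = 9 / 16 + (if n \<in> {..<4} then (if n < 2 then 7 / 16 else - 1 / 16) else 0)"

lemma damped_szego_powser:
  assumes x: "cmod x < 1"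
  shows "(\<lambda>n. of_real (damped_szego_coeff n) * x ^ n) sums damped_szego x"
proof -
  define d where "d = (\<lambda>n::nat. (if n < 2 then 7 / 16 else - 1 / 16) * x ^ n)"
  have "(\<lambda>n. 9 / 16 * x ^ n) sums (9 / 16 * (1 / (1 - x)))"
    by (intro sums_mult geometric_sums x)
  moreover have "(\<lambda>n. if n \<in> {..<4} then d n else 0) sums (\<Sum>n<4. d n)"
    by (rule sums_If_finite_set) simp
  ultimately have "(\<lambda>n. 9 / 16 * x ^ n + (if n \<in> {..<4} then d n else 0)) sums (9 / 16 * (1 / (1 - x)) + (\<Sum>n<4. d n))"
    by (rule sums_add)
  moreover have "(\<lambda>n. 9 / 16 * x ^ n + (if n \<in> {..<4} then d n else 0)) = (\<lambda>n. of_real (damped_szego_coeff n) * x ^ n)"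
    by (auto simp: damped_szego_coeff_def d_def fun_eq_iff algebra_simps)
  moreover have "9 / 16 * (1 / (1 - x)) + (\<Sum>n<4. d n) = damped_szego x"
  proof -
    have "(\<Sum>n<4. d n) = 7 / 16 * (1 + x) - 1 / 16 * (x\<^sup>2 + x ^ 3)"
      by (simp add: d_def eval_nat_numeral algebra_simps)
    have "1 - x \<noteq> 0" using x by auto
    then show ?thesis
      unfolding \<open>(\<Sum>n<4. d n) = _\<close> by (simp add: damped_szego_def field_simps power2_eq_square power3_eq_cube)
  qed
  ultimately show ?thesis by simp
qed

lemma damped_szego_holomorphic: "damped_szego holomorphic_on ball 0 1"
  unfolding damped_szego_def by (intro holomorphic_intros) auto

lemma damped_szego_nonzero:
  assumes "cmod x < 1"
  shows "1 - x\<^sup>2 / 4 \<noteq> 0" "damped_szego x \<noteq> 0"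
proof -
  have "cmod (x\<^sup>2 / 4) \<noteq> 1" using assms power_le_one[of "cmod x" 2] by (simp add: norm_divide norm_power)
  then have "x\<^sup>2 / 4 \<noteq> 1" by (metis norm_one)
  then show 1: "1 - x\<^sup>2 / 4 \<noteq> 0" by auto
  have "1 - x \<noteq> 0" using assms by auto
  with 1 show "damped_szego x \<noteq> 0" by (auto simp: damped_szego_def)
qed

lemma szego_over_damped_kernel:
  "is_kernel (polydisc 1 1) (\<lambda>z w. szego (z 0 * cnj (w 0)) / damped_szego (z 0 * cnj (w 0)))"
proof (rule is_kernelI_sums)
  show "polydisc 1 1 \<noteq> {}" unfolding polydisc_1 by simp
  fix z w assume zw: "z \<in> polydisc 1 1" "w \<in> polydisc 1 1"
  define x where "x = z 0 * cnj (w 0)"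
  have x: "cmod x < 1" unfolding x_def by (intro cmod_mult_less_1 polydisc_bound zw)
  then have ne: "1 - x \<noteq> 0" by auto
  have "cmod (x\<^sup>2 / 4) < 1" using x power_le_one[of "cmod x" 2] by (simp add: norm_divide norm_power)
  then have "(\<lambda>n. of_nat (Suc n) * (x\<^sup>2 / 4) ^ n) sums (1 / (1 - x\<^sup>2 / 4)\<^sup>2)" by (rule geometric_deriv_sums)
  moreover have "1 / (1 - x\<^sup>2 / 4)\<^sup>2 = szego x / damped_szego x"
    using ne damped_szego_nonzero(1)[OF x] by (simp add: szego_def damped_szego_def)
  moreover have "of_nat (Suc n) * (x\<^sup>2 / 4) ^ n
      = (of_real (sqrt (Suc n)) * (z 0 ^ 2 / 2) ^ n) * cnj (of_real (sqrt (Suc n)) * (w 0 ^ 2 / 2) ^ n)" for n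
  proof -
    have "of_nat (Suc n) = complex_of_real (sqrt (Suc n)) * of_real (sqrt (Suc n))"
      unfolding of_real_mult[symmetric] real_sqrt_mult_self by simp
    moreover have "(x\<^sup>2 / 4) ^ n = (z 0 ^ 2 / 2) ^ n * cnj ((w 0 ^ 2 / 2) ^ n)"
      by (simp add: x_def power_mult_distrib power_divide flip: power_mult_distrib)
    ultimately show ?thesis by simp
  qed
  ultimately show "(\<lambda>n. (of_real (sqrt (Suc n)) * (z 0 ^ 2 / 2) ^ n) * cnj (of_real (sqrt (Suc n)) * (w 0 ^ 2 / 2) ^ n))
      sums (szego (z 0 * cnj (w 0)) / damped_szego (z 0 * cnj (w 0)))"
    unfolding x_def by simp
qed

section \<open>A scalar interpolation problem without solution\<close>

definition omega :: complex where
  "omega = Complex (- 1 / 2) (sqrt 3 / 2)"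

text \<open>Besides the three interpolation nodes, \<open>node 3\<close> is the origin, where the contradiction arises.\<close>
definition node :: "nat \<Rightarrow> complex" where
  "node i = (if i = 0 then 1 / 2 else if i = 1 then omega / 2 else if i = 2 then (- 1 - omega) / 2 else 0)"

text \<open>The factor is \<open>1 / sqrt A\<close> for the constant term \<open>A = (255/256)\<^sup>2\<close> of \<open>(1 - q) k\<close> modulo \<open>x\<^sup>3 = q\<close> with
  \<open>q = 1/64\<close>. It is the largest one for which the coefficient of \<open>x\<^sup>2\<close> in \<open>l - k w cnj w\<close> is not
  negative.\<close>
definition target :: "nat \<Rightarrow> complex" where
  "target i = 256 / 255 * (node i)\<^sup>2"

lemma omega_sq: "omega * omega = - 1 - omega"
  by (simp add: omega_def complex_eq_iff)

lemma node_sum: "(\<Sum>i<3. node i) = 0"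
  by (simp add: node_def eval_nat_numeral field_simps)

lemma node_sq_sum: "(\<Sum>i<3. (node i)\<^sup>2) = 0"
  using omega_sq by (simp add: node_def eval_nat_numeral field_simps)

lemma node_cube:
  assumes "i < 3" shows "node i ^ 3 = 1 / 8"
proof -
  have "omega ^ 3 = omega * (omega * omega)" by (simp add: power3_eq_cube)
  also have "\<dots> = - omega - omega * omega" by (subst omega_sq) (simp add: right_diff_distrib)
  also have "\<dots> = 1" unfolding omega_sq by simp
  finally have 1: "omega ^ 3 = 1" .
  have "(- 1 - omega) ^ 3 = (omega * omega) ^ 3" unfolding omega_sq ..
  also have "\<dots> = 1" using 1 by (simp add: power_mult_distrib)
  finally have 2: "(- 1 - omega) ^ 3 = 1" .
  have "i = 0 \<or> i = 1 \<or> i = 2" using assms by auto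
  then show ?thesis using 1 2 by (auto simp: node_def power_divide)
qed

lemma node_bound: "cmod (node i) < 1"
proof (cases "i < 3")
  case True
  have "cmod (node i) ^ 3 = 1 / 8" using arg_cong[OF node_cube[OF True], of norm] by (simp add: norm_power norm_divide)
  then have "cmod (node i) ^ 3 < 1 ^ 3" by simp
  then show ?thesis by (rule power_less_imp_less_base) simp
qed (simp add: node_def)

text \<open>The relation \<open>x\<^sup>3 = 1/64\<close> turns the kernels into polynomials. The constant \<open>65024/65025\<close> is less
  than one, and this is the source of the failure.\<close>
lemma pick_entry:
  assumes "i < 3" "j < 3"
  defines "x \<equiv> node i * cnj (node j)"
  shows "szego x - damped_szego x * (target i * cnj (target j)) = 65024 / 65025 + 65536 / 65025 * x"
proof -
  have "x ^ 3 = node i ^ 3 * cnj (node j ^ 3)" by (simp add: x_def power_mult_distrib)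
  then have x3: "x ^ 3 = 1 / 64" using node_cube assms by simp
  have "cmod x < 1" unfolding x_def by (intro cmod_mult_less_1 node_bound)
  then have ne: "1 - x \<noteq> 0" by auto
  have t: "target i * cnj (target j) = 65536 / 65025 * x\<^sup>2"
    by (simp add: target_def x_def power_mult_distrib)
  have x4: "x ^ 4 = x / 64" and x6: "x ^ 6 = 1 / 4096"
  proof -
    have "x ^ 4 = x ^ 3 * x" by (simp add: eval_nat_numeral)
    then show "x ^ 4 = x / 64" using x3 by simp
    have "x ^ 6 = x ^ 3 * x ^ 3" by (simp add: eval_nat_numeral)
    then show "x ^ 6 = 1 / 4096" using x3 by simp
  qed
  have "x\<^sup>2 * (1 - x\<^sup>2 / 4)\<^sup>2 = x\<^sup>2 - x ^ 4 / 2 + x ^ 6 / 16"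
    by (simp add: eval_nat_numeral field_simps)
  then have p: "x\<^sup>2 * (1 - x\<^sup>2 / 4)\<^sup>2 = x\<^sup>2 - x / 128 + 1 / 65536" unfolding x4 x6 by simp
  have "szego x - damped_szego x * (target i * cnj (target j)) = (1 - 65536 / 65025 * (x\<^sup>2 * (1 - x\<^sup>2 / 4)\<^sup>2)) / (1 - x)"
    unfolding t szego_def damped_szego_def by (simp add: diff_divide_distrib mult_ac)
  also have "\<dots> = 65024 / 65025 + 65536 / 65025 * x"
    unfolding p using ne by (simp add: field_simps power2_eq_square)
  finally show ?thesis .
qed

lemma pick_problem_psd:
  "psd (pick_matrix (\<lambda>z w. damped_szego (z 0 * cnj (w 0))) (\<lambda>z w. szego (z 0 * cnj (w 0))) 3 1
     (\<lambda>i. disc_point (node i)) (\<lambda>i. mat 1 1 (\<lambda>_. target i)))"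
proof (subst psd_pick_matrix_iff)
  show "\<forall>c. 0 \<le> (\<Sum>p<3 * 1. \<Sum>q<3 * 1.
      ((if p mod 1 = q mod 1 then szego (disc_point (node (p div 1)) 0 * cnj (disc_point (node (q div 1)) 0)) else 0) -
        damped_szego (disc_point (node (p div 1)) 0 * cnj (disc_point (node (q div 1)) 0)) *
          (\<Sum>j<1. mat 1 1 (\<lambda>_. target (p div 1)) $$ (p mod 1, j) * cnj (mat 1 1 (\<lambda>_. target (q div 1)) $$ (q mod 1, j)))) * c q * cnj (c p))"
  proof
    fix c :: "nat \<Rightarrow> complex"
    have "(\<Sum>p<3. \<Sum>q<3. (szego (node p * cnj (node q)) - damped_szego (node p * cnj (node q)) * (target p * cnj (target q))) * c q * cnj (c p))
        = (\<Sum>p<3. \<Sum>q<3. 65024 / 65025 * ((1 * cnj 1) * c q * cnj (c p)) + 65536 / 65025 * ((node p * cnj (node q)) * c q * cnj (c p)))"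
      by (intro sum.cong refl, subst pick_entry) (auto simp: algebra_simps)
    also have "\<dots> = of_real (65024 / 65025 * (cmod (\<Sum>p<3. 1 * cnj (c p)))\<^sup>2 + 65536 / 65025 * (cmod (\<Sum>p<3. node p * cnj (c p)))\<^sup>2)"
      unfolding sum.distrib sum_distrib_left[symmetric] rank_one_form[of "\<lambda>_. 1"] rank_one_form[of node] by simp
    also have "0 \<le> \<dots>" by (simp add: nonneg_complex_iff del: of_real_add of_real_mult of_real_power)
    finally show "0 \<le> (\<Sum>p<3 * 1. \<Sum>q<3 * 1.
      ((if p mod 1 = q mod 1 then szego (disc_point (node (p div 1)) 0 * cnj (disc_point (node (q div 1)) 0)) else 0) -
        damped_szego (disc_point (node (p div 1)) 0 * cnj (disc_point (node (q div 1)) 0)) *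
          (\<Sum>j<1. mat 1 1 (\<lambda>_. target (p div 1)) $$ (p mod 1, j) * cnj (mat 1 1 (\<lambda>_. target (q div 1)) $$ (q mod 1, j)))) * c q * cnj (c p))"
      by (simp add: disc_point_def)
  qed
qed simp

lemma not_pick_pair:
  "\<not> complete_pick_pair (polydisc 1 1) (\<lambda>z w. damped_szego (z 0 * cnj (w 0))) (\<lambda>z w. szego (z 0 * cnj (w 0)))"
    (is "\<not> complete_pick_pair ?D ?k ?l")
proof
  assume pick: "complete_pick_pair ?D ?k ?l"
  have "\<exists>H ip. is_rkhs ?D ?k H ip"
    by (rule diagonal_power_series_kernel(2)[OF _ damped_szego_powser damped_szego_holomorphic])
      (auto simp: damped_szego_coeff_def)
  then obtain H ipH where H: "is_rkhs ?D ?k H ipH" by blast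
  have "\<exists>G ip. is_rkhs ?D ?l G ip"
    by (rule diagonal_power_series_kernel(2)[OF _ szego_powser szego_holomorphic]) auto
  then obtain G ipG where G: "is_rkhs ?D ?l G ipG" by blast
  have pts: "disc_point (node i) \<in> ?D" for i unfolding disc_point_mem by (rule node_bound)
  obtain \<Phi> where \<Phi>: "\<Phi> \<in> Mult 1 ?D H G" "mult_norm 1 ?D H ipH ipG \<Phi> \<le> 1"
    and interp: "\<And>i. i < 3 \<Longrightarrow> \<Phi> (disc_point (node i)) = mat 1 1 (\<lambda>_. target i)"
  proof -
    have "\<exists>\<Phi>\<in>Mult 1 ?D H G. mult_norm 1 ?D H ipH ipG \<Phi> \<le> 1 \<and>
        (\<forall>i<3. \<Phi> (disc_point (node i)) = mat 1 1 (\<lambda>_. target i))"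
      using pick[unfolded complete_pick_pair_def, rule_format, OF H G, of 3 1 "\<lambda>i. disc_point (node i)" "\<lambda>i. mat 1 1 (\<lambda>_. target i)"]
        pts pick_problem_psd by simp
    then show thesis using that by blast
  qed
  define v where "v = (\<lambda>i. \<Phi> (disc_point (node i)) $$ (0, 0))"
  have v: "v i = target i" if "i < 3" for i using interp[OF that] by (simp add: v_def)
  \<comment> \<open>The mean over the three nodes minus the value at the origin. The nodes and their squares have
    mean zero, so only the constant terms of the entries survive.\<close>
  define c where "c = (\<lambda>i::nat. if i = 3 then - 1 else 1 / 3 :: complex)"
  define E where "E = (\<lambda>i j. szego (node i * cnj (node j)) - damped_szego (node i * cnj (node j)) * (v i * cnj (v j)))"
  have "0 \<le> Re (\<Sum>i<4. \<Sum>j<4. E i j * c j * cnj (c i))"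
    using scalar_multiplier_kernel[OF H G \<Phi>, where I = "{..<4}" and z = "\<lambda>i. disc_point (node i)" and c = c, OF pts]
    by (simp add: E_def v_def disc_point_def)
  also have "(\<Sum>i<4. \<Sum>j<4. E i j * c j * cnj (c i)) = 65024 / 65025 - 1 - v 3 * cnj (v 3)"
  proof -
    have inner: "E i j * c j * cnj (c i) = 65024 / 65025 / 9 + 65536 / 65025 / 9 * (node i * cnj (node j))" if "i < 3" "j < 3" for i j
      using pick_entry[OF that] v that by (simp add: E_def c_def)
    have n3: "node 3 = 0" by (simp add: node_def)
    have s0: "szego 0 = 1" "damped_szego 0 = 1" by (simp_all add: szego_def damped_szego_def)
    have right: "E i 3 * c 3 * cnj (c i) = - 1 / 3 + target i * (cnj (v 3) / 3)" if "i < 3" for i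
      using that v by (simp add: E_def c_def n3 s0 field_simps)
    have left: "E 3 j * c j * cnj (c 3) = - 1 / 3 + v 3 / 3 * cnj (target j)" if "j < 3" for j
      using that v by (simp add: E_def c_def n3 s0 field_simps)
    have corner: "E 3 3 * c 3 * cnj (c 3) = 1 - v 3 * cnj (v 3)"
      by (simp add: E_def c_def n3 s0)
    have t0: "(\<Sum>i<3. target i) = 0"
      unfolding target_def sum_distrib_left[symmetric] node_sq_sum by simp
    have split: "(\<Sum>i<4. f i) = (\<Sum>i<3. f i) + f 3" for f :: "nat \<Rightarrow> complex"
      by (simp add: eval_nat_numeral)
    have "(\<Sum>i<3. \<Sum>j<3. E i j * c j * cnj (c i)) = (\<Sum>i<3. \<Sum>j<3. 65024 / 65025 / 9 + 65536 / 65025 / 9 * (node i * cnj (node j)))"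
      by (intro sum.cong refl inner) auto
    also have "\<dots> = 65024 / 65025 + 65536 / 65025 / 9 * ((\<Sum>i<3. node i) * cnj (\<Sum>j<3. node j))"
      unfolding sum.distrib sum_distrib_left[symmetric] sum_product cnj_sum by simp
    finally have a: "(\<Sum>i<3. \<Sum>j<3. E i j * c j * cnj (c i)) = 65024 / 65025" by (simp add: node_sum)
    have "(\<Sum>i<3. E i 3 * c 3 * cnj (c i)) = (\<Sum>i<3. - 1 / 3 + target i * (cnj (v 3) / 3))"
      by (intro sum.cong refl right) auto
    also have "\<dots> = - 1 + (\<Sum>i<3. target i) * (cnj (v 3) / 3)"
      unfolding sum.distrib sum_distrib_right[symmetric] by simp
    finally have b: "(\<Sum>i<3. E i 3 * c 3 * cnj (c i)) = - 1" by (simp add: t0)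
    have "(\<Sum>j<3. E 3 j * c j * cnj (c 3)) = (\<Sum>j<3. - 1 / 3 + v 3 / 3 * cnj (target j))"
      by (intro sum.cong refl left) auto
    also have "\<dots> = - 1 + v 3 / 3 * cnj (\<Sum>j<3. target j)"
      unfolding sum.distrib sum_distrib_left[symmetric] cnj_sum by simp
    finally have d: "(\<Sum>j<3. E 3 j * c j * cnj (c 3)) = - 1" by (simp add: t0)
    show ?thesis unfolding split sum.distrib a b d corner by simp
  qed
  also have "Re (65024 / 65025 - 1 - v 3 * cnj (v 3)) = - 1 / 65025 - (cmod (v 3))\<^sup>2"
    unfolding cnj_mult_self by simp
  finally show False using zero_le_power2[of "cmod (v 3)"] by linarith
qed

theorem proposition7p4:
  shows "\<exists>(d::nat) (\<Omega> :: (nat \<Rightarrow> complex) set) k l s.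
     1 \<le> d \<and>
     diagonal_holomorphic_kernel d \<Omega> k \<and>
     diagonal_holomorphic_kernel d \<Omega> l \<and>
     diagonal_holomorphic_kernel d \<Omega> s \<and>
     complete_pick_kernel \<Omega> s \<and>
     is_quotient_kernel \<Omega> s k \<and>
     is_quotient_kernel \<Omega> l s \<and>
     \<not> complete_pick_pair \<Omega> k l"
proof -
  let ?D = "polydisc 1 1"
  let ?k = "\<lambda>z w :: nat \<Rightarrow> complex. damped_szego (z 0 * cnj (w 0))"
  let ?s = "\<lambda>z w :: nat \<Rightarrow> complex. szego (z 0 * cnj (w 0))"
  have x: "cmod (z 0 * cnj (w 0)) < 1" if "z \<in> ?D" "w \<in> ?D" for z w
    by (intro cmod_mult_less_1 polydisc_bound that)
  have ne: "?D \<noteq> {}" unfolding polydisc_1 by simp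
  have s0: "?s z w \<noteq> 0" if "z \<in> ?D" "w \<in> ?D" for z w
    using x[OF that] by (auto simp: szego_def)
  have k: "diagonal_holomorphic_kernel 1 ?D ?k"
    by (rule diagonal_power_series_kernel(1)[OF _ damped_szego_powser damped_szego_holomorphic])
      (auto simp: damped_szego_coeff_def)
  have s: "diagonal_holomorphic_kernel 1 ?D ?s"
    by (rule diagonal_power_series_kernel(1)[OF _ szego_powser szego_holomorphic]) auto
  have "complete_pick_kernel ?D ?s"
    unfolding szego_def by (rule szego_complete_pick[OF ne polydisc_bound])
  moreover have "is_quotient_kernel ?D ?s ?k"
    unfolding is_quotient_kernel_def using szego_over_damped_kernel damped_szego_nonzero(2)[OF x] by blast
  moreover have "is_quotient_kernel ?D ?s ?s"
    unfolding is_quotient_kernel_def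
  proof (intro conjI ballI s0)
    have one: "(\<lambda>n. (if n = 0 then 1 else 0) * cnj (if n = 0 then 1 else 0)) sums (?s z w / ?s z w)"
      if "z \<in> ?D" "w \<in> ?D" for z w
      using s0[OF that] sums_single[of 0 "\<lambda>_. 1::complex"] by (simp add: if_distrib cong: if_cong)
    show "is_kernel ?D (\<lambda>z w. ?s z w / ?s z w)"
      by (rule is_kernelI_sums[OF ne, of "\<lambda>n z. if n = 0 then 1 else 0"]) (rule one)
  qed
  ultimately show ?thesis using k s not_pick_pair by blast
qed

end
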